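(* Let $N\geq 2$ be an integer, let $\mathbb{K}$ be a field, and let $\mathcal{A}=A(E,R)$ be an $N$-homogeneous algebra over $\mathbb{K}$, with dual $N$-homogeneous algebra $\mathcal{A}^!$. Let $P_{\mathcal{A}}(t)=\sum_{n\ge 0}\dim(\mathcal{A}_n)t^n$ be the Poincaré series of $\mathcal{A}$, let $$Q_{\mathcal{A}}(t)=\sum_{n\geq 0}\bigl(\dim(\mathcal{A}^!_{nN})\,t^{nN}-\dim(\mathcal{A}^!_{nN+1})\,t^{nN+1}\bigr),$$ and let $\chi_{\mathcal{A}}(t)=\sum_{n\geq 0}\chi^{(n)}t^n$, where $\chi^{(n)}$ is the Euler characteristic of the homogeneous component $C^{(n)}_{N-1,0}$ of total degree $n$ of the Koszul complex of $\mathcal{A}$. Then, as formal power series, $$P_{\mathcal{A}}(t)\,Q_{\mathcal{A}}(t)=\chi_{\mathcal{A}}(t).$$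
   Context: All vector spaces and algebras are over the field $\mathbb{K}$; algebras are associative and unital. An $N$-homogeneous algebra is an algebra of the form $\mathcal{A}=A(E,R)=T(E)/(R)$, where $E$ is a finite-dimensional vector space, $T(E)$ its tensor algebra, and $(R)$ the two-sided ideal generated by a vector subspace $R\subset E^{\otimes N}$. It is graded, $\mathcal{A}=\bigoplus_{n\ge 0}\mathcal{A}_n$, with elements of $E$ in degree 1; set $\mathcal{A}_k=0$ for $k<0$. Its dual is $\mathcal{A}^!=A(E^*,R^\perp)$, where $R^\perp\subset (E^{*})^{\otimes N}=(E^{\otimes N})^*$ is the annihilator of $R$. One has $(\mathcal{A}^!_n)^*=E^{\otimes n}$ for $n<N$ and $(\mathcal{A}^!_n)^*=\bigcap_{r+s=n-N}E^{\otimes r}\otimes R\otimes E^{\otimes s}\subset E^{\otimes n}$ for $n\ge N$. Let $K_n(\mathcal{A})=\mathcal{A}\otimes(\mathcal{A}^!_n)^*$ (a left $\mathcal{A}$-module), and let $d:K_{n+1}(\mathcal{A})\to K_n(\mathcal{A})$ be the $\mathcal{A}$-module homomorphism induced by $a\otimes(e_0\otimes e_1\otimes\cdots\otimes e_n)\mapsto (ae_0)\otimes(e_1\otimes\cdots\otimes e_n)$; it satisfies $d^N=0$. The Koszul complex of $\mathcal{A}$ is the ordinary chain complex $C_{N-1,0}$ $$\cdots\xrightarrow{d}\mathcal{A}\otimes(\mathcal{A}^!_N)^*\xrightarrow{d^{N-1}}\mathcal{A}\otimes(\mathcal{A}^!_1)^*\xrightarrow{d}\mathcal{A}\to 0,$$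 whose term in homological degree $2k$ is $\mathcal{A}\otimes(\mathcal{A}^!_{kN})^*$ and in homological degree $2k+1$ is $\mathcal{A}\otimes(\mathcal{A}^!_{kN+1})^*$, with differential $d$ from degree $2k+1$ to $2k$ and $d^{N-1}$ from degree $2k$ to $2k-1$. It splits as a direct sum of subcomplexes $C_{N-1,0}=\bigoplus_n C^{(n)}_{N-1,0}$ homogeneous for the total degree, where $C^{(n)}_{N-1,0}$ is $$\cdots\xrightarrow{d}\mathcal{A}_{n-N}\otimes(\mathcal{A}^!_N)^*\xrightarrow{d^{N-1}}\mathcal{A}_{n-1}\otimes(\mathcal{A}^!_1)^*\xrightarrow{d}\mathcal{A}_n\to 0.$$ Each $C^{(n)}_{N-1,0}$ is a finite-dimensional complex; its Euler characteristic is $\chi^{(n)}$. *)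

theory Defs
  imports
    "Jordan_Normal_Form.VS_Connect"
    "HOL-Algebra.QuotRing"
    "HOL-Library.Poly_Mapping"
    "HOL-Computational_Algebra.Formal_Power_Series"
begin

(* The ground field is an arbitrary type 'k of class field; as a record it is class_ring.
   Vector spaces and algebras over it are records of type module, whose ring part carries the
   product of an algebra. *)

abbreviation vdim :: "('k::field, 'v, 'm) module_scheme \<Rightarrow> nat" where
  "vdim V \<equiv> vectorspace.dim class_ring V"

abbreviation vspan :: "('k::field, 'v, 'm) module_scheme \<Rightarrow> 'v set \<Rightarrow> 'v set" where
  "vspan V \<equiv> LinearCombinations.module.span class_ring V"

(* The quotient ring M Quot W with the induced scalar multiplication. It is used both for
   quotients of algebras by two-sided ideals and for quotients of vector spaces by subspaces;
   in the second case the fields mult and one carry no meaning. *)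

definition quot_module :: "('k, 'v, 'm) module_scheme \<Rightarrow> 'v set \<Rightarrow> ('k, 'v set) module" where
  "quot_module M W =
    ring.extend (M Quot W)
      (module.fields (\<lambda>c X. \<Union>x\<in>X. W +>\<^bsub>M\<^esub> (c \<odot>\<^bsub>M\<^esub> x)))"

definition free_space :: "'x set \<Rightarrow> ('k::field, 'x \<Rightarrow>\<^sub>0 'k) module" where
  "free_space X =
    \<lparr>carrier = {p. Poly_Mapping.keys p \<subseteq> X}, monoid.mult = undefined, one = undefined,
     zero = 0, add = (+), smult = (\<lambda>c. Poly_Mapping.map ((*) c))\<rparr>"

(* Lists under concatenation form the free monoid, so that the convolution product of
   Poly_Mapping on 'e list \<Rightarrow>\<^sub>0 'k is the product of the free associative algebra. *)

instantiation list :: (type) monoid_add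
begin
definition zero_list :: "'a list" where "zero_list = []"
definition plus_list :: "'a list \<Rightarrow> 'a list \<Rightarrow> 'a list" where "plus_list = (@)"
instance by standard (simp_all add: zero_list_def plus_list_def)
end

definition free_algebra :: "'x set \<Rightarrow> ('k::field, 'x list \<Rightarrow>\<^sub>0 'k) module" where
  "free_algebra X = (free_space (lists X))\<lparr>monoid.mult := (*), one := 1\<rparr>"

definition bilinear_relations ::
  "('k::field, 'v, 'm) module_scheme \<Rightarrow> ('k, 'w, 'n) module_scheme \<Rightarrow> ('v \<times> 'w \<Rightarrow>\<^sub>0 'k) set" where
  "bilinear_relations V W = vspan (free_space (carrier V \<times> carrier W))
    ({Poly_Mapping.single (x \<oplus>\<^bsub>V\<^esub> x', y) 1 - Poly_Mapping.single (x, y) 1 - Poly_Mapping.single (x', y) 1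
       |x x' y. x \<in> carrier V \<and> x' \<in> carrier V \<and> y \<in> carrier W} \<union>
     {Poly_Mapping.single (x, y \<oplus>\<^bsub>W\<^esub> y') 1 - Poly_Mapping.single (x, y) 1 - Poly_Mapping.single (x, y') 1
       |x y y'. x \<in> carrier V \<and> y \<in> carrier W \<and> y' \<in> carrier W} \<union>
     {Poly_Mapping.single (c \<odot>\<^bsub>V\<^esub> x, y) 1 - Poly_Mapping.single (x, y) c
       |c x y. x \<in> carrier V \<and> y \<in> carrier W} \<union>
     {Poly_Mapping.single (x, c \<odot>\<^bsub>W\<^esub> y) 1 - Poly_Mapping.single (x, y) c
       |c x y. x \<in> carrier V \<and> y \<in> carrier W})"

definition tensor_prod ::
  "('k::field, 'v, 'm) module_scheme \<Rightarrow> ('k, 'w, 'n) module_scheme \<Rightarrow>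
   ('k, ('v \<times> 'w \<Rightarrow>\<^sub>0 'k) set) module" where
  "tensor_prod V W = quot_module (free_space (carrier V \<times> carrier W)) (bilinear_relations V W)"

definition pure_tensor ::
  "('k::field, 'v, 'm) module_scheme \<Rightarrow> ('k, 'w, 'n) module_scheme \<Rightarrow> 'v \<Rightarrow> 'w \<Rightarrow> ('v \<times> 'w \<Rightarrow>\<^sub>0 'k) set"
  where
  "pure_tensor V W x y =
    bilinear_relations V W +>\<^bsub>free_space (carrier V \<times> carrier W)\<^esub> Poly_Mapping.single (x, y) 1"

definition tensor_ideal :: "('k::field, 'e, 'm) module_scheme \<Rightarrow> ('e list \<Rightarrow>\<^sub>0 'k) set" where
  "tensor_ideal E = Idl\<^bsub>free_algebra (carrier E)\<^esub>
    ({Poly_Mapping.single [x \<oplus>\<^bsub>E\<^esub> y] 1 - Poly_Mapping.single [x] 1 - Poly_Mapping.single [y] 1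
       |x y. x \<in> carrier E \<and> y \<in> carrier E} \<union>
     {Poly_Mapping.single [c \<odot>\<^bsub>E\<^esub> x] 1 - Poly_Mapping.single [x] c
       |c x. x \<in> carrier E})"

definition tensor_algebra ::
  "('k::field, 'e, 'm) module_scheme \<Rightarrow> ('k, ('e list \<Rightarrow>\<^sub>0 'k) set) module" where
  "tensor_algebra E = quot_module (free_algebra (carrier E)) (tensor_ideal E)"

(* tensor_word E [x1, ..., xn] is x1 \<otimes> ... \<otimes> xn, and tensor_word E [] is the unit of T(E). *)

definition tensor_word ::
  "('k::field, 'e, 'm) module_scheme \<Rightarrow> 'e list \<Rightarrow> ('e list \<Rightarrow>\<^sub>0 'k) set" where
  "tensor_word E xs = tensor_ideal E +>\<^bsub>free_algebra (carrier E)\<^esub> Poly_Mapping.single xs 1"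

definition tensor_power ::
  "('k::field, 'e, 'm) module_scheme \<Rightarrow> nat \<Rightarrow> ('e list \<Rightarrow>\<^sub>0 'k) set set" where
  "tensor_power E n =
    vspan (tensor_algebra E) {tensor_word E xs |xs. xs \<in> lists (carrier E) \<and> length xs = n}"

definition relation_ideal ::
  "('k::field, 'e, 'm) module_scheme \<Rightarrow> ('e list \<Rightarrow>\<^sub>0 'k) set set \<Rightarrow> ('e list \<Rightarrow>\<^sub>0 'k) set set" where
  "relation_ideal E R = Idl\<^bsub>tensor_algebra E\<^esub> R"

definition homogeneous_algebra ::
  "('k::field, 'e, 'm) module_scheme \<Rightarrow> ('e list \<Rightarrow>\<^sub>0 'k) set set \<Rightarrow>
   ('k, ('e list \<Rightarrow>\<^sub>0 'k) set set) module" where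
  "homogeneous_algebra E R = quot_module (tensor_algebra E) (relation_ideal E R)"

definition algebra_proj ::
  "('k::field, 'e, 'm) module_scheme \<Rightarrow> ('e list \<Rightarrow>\<^sub>0 'k) set set \<Rightarrow>
   ('e list \<Rightarrow>\<^sub>0 'k) set \<Rightarrow> ('e list \<Rightarrow>\<^sub>0 'k) set set" where
  "algebra_proj E R t = relation_ideal E R +>\<^bsub>tensor_algebra E\<^esub> t"

definition algebra_component ::
  "('k::field, 'e, 'm) module_scheme \<Rightarrow> ('e list \<Rightarrow>\<^sub>0 'k) set set \<Rightarrow> nat \<Rightarrow>
   ('e list \<Rightarrow>\<^sub>0 'k) set set set" where
  "algebra_component E R n = algebra_proj E R ` tensor_power E n"

definition dim_component ::
  "('k::field, 'e, 'm) module_scheme \<Rightarrow> ('e list \<Rightarrow>\<^sub>0 'k) set set \<Rightarrow> nat \<Rightarrow> nat" where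
  "dim_component E R n = vdim ((homogeneous_algebra E R)\<lparr>carrier := algebra_component E R n\<rparr>)"

definition dual_space :: "('k::field, 'e, 'm) module_scheme \<Rightarrow> ('k, 'e \<Rightarrow> 'k) module" where
  "dual_space E = (ring.func_space class_ring (carrier E))
    \<lparr>carrier := {f \<in> extensional (carrier E).
       (\<forall>x\<in>carrier E. \<forall>y\<in>carrier E. f (x \<oplus>\<^bsub>E\<^esub> y) = f x + f y) \<and>
       (\<forall>c. \<forall>x\<in>carrier E. f (c \<odot>\<^bsub>E\<^esub> x) = c * f x)}\<rparr>"

(* The bilinear extension of (f1 \<otimes> ... \<otimes> fn, x1 \<otimes> ... \<otimes> xn) \<mapsto> f1 x1 * ... * fn xn, words of different
   lengths being orthogonal. On representatives of tensors over the dual of E and over E it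
   depends only on the tensors, and it realises the identification of the n-th tensor power
   of the dual with the dual of the n-th tensor power. *)

definition word_pairing :: "(('e \<Rightarrow> 'k) list \<Rightarrow>\<^sub>0 'k::field) \<Rightarrow> ('e list \<Rightarrow>\<^sub>0 'k) \<Rightarrow> 'k" where
  "word_pairing p q =
    (\<Sum>fs\<in>Poly_Mapping.keys p. \<Sum>xs | xs \<in> Poly_Mapping.keys q \<and> length xs = length fs.
       Poly_Mapping.lookup p fs * Poly_Mapping.lookup q xs * (\<Prod>i<length fs. (fs ! i) (xs ! i)))"

definition annihilator ::
  "('k::field, 'e, 'm) module_scheme \<Rightarrow> nat \<Rightarrow> ('e list \<Rightarrow>\<^sub>0 'k) set set \<Rightarrow>
   (('e \<Rightarrow> 'k) list \<Rightarrow>\<^sub>0 'k) set set" where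
  "annihilator E N R =
    {s \<in> tensor_power (dual_space E) N. \<forall>t\<in>R. \<forall>p\<in>s. \<forall>q\<in>t. word_pairing p q = 0}"

definition dim_dual_component ::
  "('k::field, 'e, 'm) module_scheme \<Rightarrow> nat \<Rightarrow> ('e list \<Rightarrow>\<^sub>0 'k) set set \<Rightarrow> nat \<Rightarrow> nat" where
  "dim_dual_component E N R n = dim_component (dual_space E) (annihilator E N R) n"

(* The dual of the component of degree m of the dual algebra, as a subspace of the m-th
   tensor power of E. *)

definition koszul_coeff ::
  "('k::field, 'e, 'm) module_scheme \<Rightarrow> nat \<Rightarrow> ('e list \<Rightarrow>\<^sub>0 'k) set set \<Rightarrow> nat \<Rightarrow>
   ('e list \<Rightarrow>\<^sub>0 'k) set set" where
  "koszul_coeff E N R m =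
    (if m < N then tensor_power E m
     else \<Inter>r\<in>{..m - N}. vspan (tensor_algebra E)
       {x \<otimes>\<^bsub>tensor_algebra E\<^esub> y \<otimes>\<^bsub>tensor_algebra E\<^esub> z |x y z.
          x \<in> tensor_power E r \<and> y \<in> R \<and> z \<in> tensor_power E (m - N - r)})"

(* All the spaces of the Koszul complex are realised inside A \<otimes> T(E). *)

definition koszul_ambient where
  "koszul_ambient E R = tensor_prod (homogeneous_algebra E R) (tensor_algebra E)"

definition koszul_tensor where
  "koszul_tensor E R a t = pure_tensor (homogeneous_algebra E R) (tensor_algebra E) a t"

(* The linear map with a \<otimes> (x0 \<otimes> ... \<otimes> xm) \<mapsto> (a x0) \<otimes> (x1 \<otimes> ... \<otimes> xm), which vanishes on A \<otimes> 1. *)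

definition koszul_d where
  "koszul_d E R = (THE d.
     d \<in> LinearCombinations.module_hom class_ring (koszul_ambient E R) (koszul_ambient E R) \<and>
     d \<in> extensional (carrier (koszul_ambient E R)) \<and>
     (\<forall>a\<in>carrier (homogeneous_algebra E R).
        d (koszul_tensor E R a (tensor_word E [])) = \<zero>\<^bsub>koszul_ambient E R\<^esub> \<and>
        (\<forall>x\<in>carrier E. \<forall>xs\<in>lists (carrier E).
           d (koszul_tensor E R a (tensor_word E (x # xs))) =
           koszul_tensor E R
             (a \<otimes>\<^bsub>homogeneous_algebra E R\<^esub> algebra_proj E R (tensor_word E [x]))
             (tensor_word E xs))))"

(* The part of total degree n of the tensor product of A with koszul_coeff E N R m. *)

definition koszul_part where
  "koszul_part E N R n m =
    (if m \<le> n then vspan (koszul_ambient E R)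
       {koszul_tensor E R a w |a w. a \<in> algebra_component E R (n - m) \<and> w \<in> koszul_coeff E N R m}
     else {\<zero>\<^bsub>koszul_ambient E R\<^esub>})"

definition koszul_degree :: "nat \<Rightarrow> nat \<Rightarrow> nat" where
  "koszul_degree N k = (if even k then (k div 2) * N else (k div 2) * N + 1)"

definition koszul_chain where
  "koszul_chain E N R n k = koszul_part E N R n (koszul_degree N k)"

definition koszul_boundary where
  "koszul_boundary E N R k = (if odd k then koszul_d E R else koszul_d E R ^^ (N - 1))"

(* Chain complexes ... \<rightarrow> C 2 \<rightarrow> C 1 \<rightarrow> C 0 \<rightarrow> 0 of subspaces C k of one vector space M, with
   differentials D k : C k \<rightarrow> C (k - 1) for k > 0; the map D 0 is not used. *)

definition homology ::
  "('k::field, 'v, 'm) module_scheme \<Rightarrow> (nat \<Rightarrow> 'v set) \<Rightarrow> (nat \<Rightarrow> 'v \<Rightarrow> 'v) \<Rightarrow> nat \<Rightarrow>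
   ('k, 'v set) module" where
  "homology M C D k =
    quot_module (M\<lparr>carrier := {x \<in> C k. k = 0 \<or> D k x = \<zero>\<^bsub>M\<^esub>}\<rparr>) (D (Suc k) ` C (Suc k))"

definition euler_char ::
  "('k::field, 'v, 'm) module_scheme \<Rightarrow> (nat \<Rightarrow> 'v set) \<Rightarrow> (nat \<Rightarrow> 'v \<Rightarrow> 'v) \<Rightarrow> int" where
  "euler_char M C D =
    (\<Sum>k | vdim (homology M C D k) \<noteq> 0. (-1) ^ k * int (vdim (homology M C D k)))"

definition poincare_series ::
  "('k::field, 'e, 'm) module_scheme \<Rightarrow> ('e list \<Rightarrow>\<^sub>0 'k) set set \<Rightarrow> int fps" where
  "poincare_series E R = Abs_fps (\<lambda>n. int (dim_component E R n))"

(* An infinite sum in the X-adic topology on int fps; suminf is written out because the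
   summation notation is shared with Sum_any. *)

definition dual_series ::
  "('k::field, 'e, 'm) module_scheme \<Rightarrow> nat \<Rightarrow> ('e list \<Rightarrow>\<^sub>0 'k) set set \<Rightarrow> int fps" where
  "dual_series E N R =
    suminf (\<lambda>n.
      fps_const (int (dim_dual_component E N R (n * N))) * fps_X ^ (n * N)
      - fps_const (int (dim_dual_component E N R (n * N + 1))) * fps_X ^ (n * N + 1))"

definition euler_series ::
  "('k::field, 'e, 'm) module_scheme \<Rightarrow> nat \<Rightarrow> ('e list \<Rightarrow>\<^sub>0 'k) set set \<Rightarrow> int fps" where
  "euler_series E N R = Abs_fps (\<lambda>n.
     euler_char (koszul_ambient E R) (koszul_chain E N R n) (koszul_boundary E N R))"

end

theory Submission
  imports Defs
begin

text \<open>
  The components of the Koszul complex are tensor products, so the dimension of the part of total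
  degree n built on $\mathcal{A}^!_m$ is the product of the dimensions of $\mathcal{A}_{n-m}$ and
  $\mathcal{A}^!_m$; the Euler--Poincare principle turns this into the coefficient identity.

  All vector spaces are moved into spaces of finitely supported functions, where the linear algebra
  of the type-class library applies. A finite basis B of E makes the tensor algebra the space of
  functions on words over B. The relation ideal I is spanned by the products u r v with u, v words
  and r a relation, and the quotient by I is realised as the range of a linear projection with
  kernel I. The dual algebra lives on the same words, and the two are related by the dot product:
  an element of degree m is orthogonal to the ideal generated by the annihilator of R iff all its
  slices, obtained by fixing a prefix u and a suffix v of the words, lie in R. The N-th power of the
  Koszul map sends $a \otimes q$ to the sum of the $a u \otimes q_u$ over the words u of length N,
  which vanishes because it multiplies a by slices of q, that is, by relations.
\<close>

subsection \<open>Linear algebra of finitely supported functions\<close>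

text \<open>The spaces to be compared are cosets of cosets, of different types for A, for its dual
  and for the complex. Their dimensions become comparable after injective linear maps into functions
  on words or pairs of words. For A such a map is an arbitrary linear choice of representatives,
  respecting neither products nor degrees. No isomorphism with the dual of the degree m part of the
  dual algebra is built. Its dimension and that of the space of elements with all slices in R arise
  from the same subtraction: the dimension of the m-th tensor power minus that of the degree m part
  of the ideal generated by the annihilator. The differential is a definite description. A
  coordinate model, pulled back to the abstract complex, gives existence; uniqueness is checked on
  spanning tensors. The boundaries alternate between d and its power N - 1, so the vanishing of the
  N-th power of d makes consecutive boundaries compose to 0. Since N is at least 2, the k-th term of
  the complex sits in internal degree at least k. Total degree n therefore involves only k \<le> n,
  which bounds the Euler sum and makes the series converge coefficientwise.\<close>

abbreviation "single \<equiv> Poly_Mapping.single"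
abbreviation "lookup \<equiv> Poly_Mapping.lookup"
abbreviation "keys \<equiv> Poly_Mapping.keys"

abbreviation smul :: "'k::field \<Rightarrow> ('x \<Rightarrow>\<^sub>0 'k) \<Rightarrow> ('x \<Rightarrow>\<^sub>0 'k)" where
  "smul \<equiv> \<lambda>c. Poly_Mapping.map ((*) c)"

abbreviation plinear :: "(('x \<Rightarrow>\<^sub>0 'k::field) \<Rightarrow> ('y \<Rightarrow>\<^sub>0 'k)) \<Rightarrow> bool" where
  "plinear \<equiv> Vector_Spaces.linear smul smul"

lemma lookup_smul [simp]:
  "lookup (smul c p) x = c * lookup p x"
  by (simp add: Poly_Mapping.map.rep_eq when_def)

interpretation pm: vector_space "smul :: 'k::field \<Rightarrow> ('x \<Rightarrow>\<^sub>0 'k) \<Rightarrow> _"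
  by unfold_locales (simp_all add: poly_mapping_eq_iff fun_eq_iff lookup_add algebra_simps)

interpretation pmp: vector_space_pair
  "smul :: 'k::field \<Rightarrow> ('x \<Rightarrow>\<^sub>0 'k) \<Rightarrow> _" "smul :: 'k \<Rightarrow> ('y \<Rightarrow>\<^sub>0 'k) \<Rightarrow> _"
  by unfold_locales

lemma plinearI:
  assumes "\<And>p q. f (p + q) = f p + f q" "\<And>c p. f (smul c p) = smul c (f p)"
  shows "plinear f"
  unfolding Vector_Spaces.linear_iff
  by (intro conjI allI assms pm.vector_space_axioms)

lemma plinear_compose: "plinear f \<Longrightarrow> plinear g \<Longrightarrow> plinear (\<lambda>x. g (f x))"
  using Vector_Spaces.linear_compose[of smul smul f smul g] by (simp add: o_def)

lemma keys_smul: "keys (smul c p) \<subseteq> keys p"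
  by (auto simp: in_keys_iff)

lemma smul_single [simp]: "smul c (single x d) = single x (c * d)"
  by (rule poly_mapping_eqI) (simp add: lookup_single when_def)

lemma keys_sum_subset:
  "(\<And>i. i \<in> S \<Longrightarrow> keys (f i) \<subseteq> X) \<Longrightarrow> keys (sum f S) \<subseteq> X"
  by (induction S rule: infinite_finite_induct) (use keys_add in fastforce)+

lemma keys_subspace: "pm.subspace {p :: 'x \<Rightarrow>\<^sub>0 'k::field. keys p \<subseteq> X}"
proof (rule pm.subspaceI)
  fix p q :: "'x \<Rightarrow>\<^sub>0 'k" assume "p \<in> {p. keys p \<subseteq> X}" "q \<in> {p. keys p \<subseteq> X}"
  then show "p + q \<in> {p. keys p \<subseteq> X}" using keys_add[of p q] by blast
next
  fix p :: "'x \<Rightarrow>\<^sub>0 'k" and c assume "p \<in> {p. keys p \<subseteq> X}"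
  then show "smul c p \<in> {p. keys p \<subseteq> X}" using keys_smul[of c p] by blast
qed simp

lemma poly_mapping_decomp:
  fixes p :: "'x \<Rightarrow>\<^sub>0 'k::field"
  assumes "finite S" "keys p \<subseteq> S"
  shows "p = (\<Sum>w\<in>S. single w (lookup p w))"
proof (rule poly_mapping_eqI)
  fix x
  show "lookup p x =
    lookup (\<Sum>w\<in>S. single w (lookup p w)) x"
    using assms by (auto simp: lookup_sum lookup_single when_def in_keys_iff)
qed

lemma span_singles:
  "pm.span ((\<lambda>w. single w (1::'k::field)) ` X) = {p. keys p \<subseteq> X}"
proof (intro equalityI subsetI)
  fix p assume "p \<in> pm.span ((\<lambda>w. single w (1::'k)) ` X)"
  moreover have "pm.span ((\<lambda>w. single w (1::'k)) ` X) \<subseteq> {p. keys p \<subseteq> X}"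
    by (rule pm.span_minimal[OF _ keys_subspace]) auto
  ultimately show "p \<in> {p. keys p \<subseteq> X}" by blast
next
  fix p :: "_ \<Rightarrow>\<^sub>0 'k" assume p: "p \<in> {p. keys p \<subseteq> X}"
  have "(\<Sum>w\<in>keys p. smul (lookup p w) (single w 1))
    \<in> pm.span ((\<lambda>w. single w (1::'k)) ` X)"
    using p by (intro pm.span_sum pm.span_scale pm.span_base) auto
  then show "p \<in> pm.span ((\<lambda>w. single w (1::'k)) ` X)"
    using poly_mapping_decomp[of "keys p" p] by simp
qed

lemma plinear_eq_on_singles:
  assumes "plinear f" "plinear g"
    and "\<And>w. w \<in> X \<Longrightarrow> f (single w 1) = g (single w 1)"
    and "keys p \<subseteq> X"
  shows "f p = g p"
proof (rule pmp.linear_eq_on_span[OF assms(1,2)])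
  show "p \<in> pm.span ((\<lambda>w. single w 1) ` X)" using assms(4) by (simp add: span_singles)
qed (use assms(3) in auto)

lemma keys_span_induct [consumes 1, case_names single add]:
  fixes p :: "'x \<Rightarrow>\<^sub>0 'k::field"
  assumes "keys p \<subseteq> X"
    and "\<And>w c. w \<in> X \<or> c = 0 \<Longrightarrow> P (single w c)"
    and "\<And>p q. keys p \<subseteq> X \<Longrightarrow> keys q \<subseteq> X \<Longrightarrow> P p \<Longrightarrow> P q \<Longrightarrow> P (p + q)"
  shows "P p"
proof -
  have P0: "P 0" using assms(2)[of undefined 0] by simp
  have "P (\<Sum>w\<in>S. single w (lookup p w))" if "finite S" "S \<subseteq> X" for S
    using that
  proof induction
    case (insert x S)
    have "keys (\<Sum>w\<in>S. single w (lookup p w)) \<subseteq> X"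
      using insert.prems by (intro keys_sum_subset) (auto split: if_splits)
    then show ?case using insert by (auto intro!: assms(2,3) split: if_splits)
  qed (use P0 in simp)
  from this[of "keys p"] show ?thesis
    using poly_mapping_decomp[of "keys p" p] assms(1) by simp
qed

definition lin_ext :: "('x \<Rightarrow> ('y \<Rightarrow>\<^sub>0 'k)) \<Rightarrow> ('x \<Rightarrow>\<^sub>0 'k::field) \<Rightarrow> ('y \<Rightarrow>\<^sub>0 'k)" where
  "lin_ext g p = (\<Sum>w\<in>keys p. smul (lookup p w) (g w))"

lemma lin_ext_superset:
  assumes "finite S" "keys p \<subseteq> S"
  shows "lin_ext g p = (\<Sum>w\<in>S. smul (lookup p w) (g w))"
  unfolding lin_ext_def using assms by (intro sum.mono_neutral_left) (auto simp: in_keys_iff)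

lemma lin_ext_single [simp]: "lin_ext g (single w c) = smul c (g w)"
  by (simp add: lin_ext_superset[of "{w}"])

lemma plinear_lin_ext:
  fixes g :: "'x \<Rightarrow> ('y \<Rightarrow>\<^sub>0 'k::field)"
  shows "plinear (lin_ext g)"
proof (rule plinearI)
  fix p q :: "'x \<Rightarrow>\<^sub>0 'k" and c
  let ?S = "keys p \<union> keys q"
  show "lin_ext g (p + q) = lin_ext g p + lin_ext g q"
    using keys_add[of p q]
    by (simp add: lin_ext_superset[of ?S] lookup_add pm.scale_left_distrib sum.distrib)
  show "lin_ext g (smul c p) = smul c (lin_ext g p)"
    using keys_smul[of c p]
    by (simp add: lin_ext_superset[of "keys p"] pm.scale_sum_right)
qed

text \<open>Coordinates with respect to B are unique. Membership in the first span confines the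
  support of the coordinates of x to A, membership in the second to the complement, so all
  coordinates vanish.\<close>

lemma span_decomp_zero:
  fixes x :: "'x \<Rightarrow>\<^sub>0 'k::field"
  assumes "pm.independent B" "A \<subseteq> B" "x \<in> pm.span A" "x \<in> pm.span (B - A)"
  shows "x = 0"
proof -
  have "pm.representation B x v = 0" for v
  proof (cases "v \<in> A")
    case True
    have "pm.representation B x = pm.representation (B - A) x"
      using assms by (intro pm.representation_extend) auto
    then show ?thesis using True pm.representation_ne_zero[of "B - A" x v] by auto
  next
    case False
    have "pm.representation B x = pm.representation A x"
      using assms by (intro pm.representation_extend) auto
    then show ?thesis using False pm.representation_ne_zero[of A x v] by auto
  qed
  moreover have "x \<in> pm.span B" using assms pm.span_mono by blast
  ultimately show ?thesis
    using pm.sum_nonzero_representation_eq[OF assms(1), of x] by simp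
qed

text \<open>\<open>pm.dim\<close> counts a basis by \<open>card\<close> and is thus 0 on
  infinite-dimensional spaces, and the ambient space of all words is in general one. Finiteness is
  therefore tracked for each subspace.\<close>

definition fdim :: "('x \<Rightarrow>\<^sub>0 'k::field) set \<Rightarrow> bool" where
  "fdim S \<longleftrightarrow> (\<exists>F. finite F \<and> S \<subseteq> pm.span F)"

lemma fdim_subset: "fdim T \<Longrightarrow> S \<subseteq> T \<Longrightarrow> fdim S"
  unfolding fdim_def by blast

lemma fdim_image: "plinear f \<Longrightarrow> fdim S \<Longrightarrow> fdim (f ` S)"
  unfolding fdim_def by (metis finite_imageI pmp.linear_spans_image)

lemma fdim_keys: "finite X \<Longrightarrow> fdim {p :: 'x \<Rightarrow>\<^sub>0 'k::field. keys p \<subseteq> X}"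
  unfolding fdim_def by (metis finite_imageI order_refl span_singles)

lemma fdim_independent_finite: "fdim S \<Longrightarrow> pm.independent B \<Longrightarrow> B \<subseteq> S \<Longrightarrow> finite B"
  unfolding fdim_def using pm.independent_span_bound by (metis subset_trans)

lemma dim_zero: "pm.dim {0} = 0"
  using pm.dim_span_eq_card_independent[OF pm.independent_empty] by simp

text \<open>A basis A of the kernel is extended to a basis B of S. By
  \<open>span_decomp_zero\<close>, f is injective on the span of B - A, and the image of that span
  is the image of S. Everything is relative to S because the ambient space may be
  infinite-dimensional.\<close>

lemma rank_nullity:
  assumes f: "plinear f" and S: "pm.subspace S" and fd: "fdim S"
  shows "pm.dim S = pm.dim (f ` S) + pm.dim {x \<in> S. f x = 0}"
proof -
  let ?K = "{x \<in> S. f x = 0}"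
  have K: "pm.subspace ?K"
    using pm.subspace_inter[OF S pmp.linear_subspace_kernel[OF f]]
    by (simp add: Int_def)
  obtain A where A: "A \<subseteq> ?K" "pm.independent A" "?K \<subseteq> pm.span A" "card A = pm.dim ?K"
    using pm.basis_exists by blast
  obtain B where B: "A \<subseteq> B" "B \<subseteq> S" "pm.independent B" "S \<subseteq> pm.span B"
    using pm.maximal_independent_subset_extend[of A S] A by blast
  have finB: "finite B" using fdim_independent_finite[OF fd] B by blast
  have sp: "pm.span (B - A) \<subseteq> S" using B S by (intro pm.span_minimal) auto
  have inj: "inj_on f (pm.span (B - A))"
  proof (subst pmp.linear_inj_on_iff_eq_0[OF f], blast, intro ballI impI)
    fix x assume "x \<in> pm.span (B - A)" "f x = 0"
    moreover from this have "x \<in> pm.span A" using sp A by blast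
    ultimately show "x = 0" using span_decomp_zero B by blast
  qed
  have ind: "pm.independent (f ` (B - A))"
    using pmp.linear_independent_injective_image[OF f _ inj] B pm.independent_mono by blast
  have "f ` S \<subseteq> pm.span (f ` B)" using pmp.linear_spans_image[OF f] B by blast
  also have "\<dots> \<subseteq> pm.span (f ` (B - A))"
  proof (rule pm.span_minimal[OF _ pm.subspace_span])
    show "f ` B \<subseteq> pm.span (f ` (B - A))"
    proof
      fix y assume "y \<in> f ` B"
      then obtain b where b: "b \<in> B" "y = f b" by blast
      show "y \<in> pm.span (f ` (B - A))"
      proof (cases "b \<in> A")
        case True
        then have "y = 0" using A b by auto
        then show ?thesis by (simp add: pm.span_zero)
      qed (use b in \<open>auto intro: pm.span_base\<close>)
    qed
  qed
  finally have "pm.dim (f ` S) = card (f ` (B - A))"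
    using pm.basis_card_eq_dim[OF _ _ ind, of "f ` S"] B(2) by (simp add: image_mono subset_trans[OF Diff_subset])
  also have "\<dots> = card (B - A)"
    by (rule card_image[OF inj_on_subset[OF inj pm.span_superset]])
  also have "\<dots> = card B - card A" using B finB by (meson card_Diff_subset finite_subset)
  finally show ?thesis
    using A(4) pm.basis_card_eq_dim[OF B(2,4,3)] card_mono[OF finB B(1)] by linarith
qed

text \<open>A basis A of K is completed to a basis of the whole space; \<pi> kills A and fixes the
  other basis vectors. Then x - \<pi> x lies in K for basis vectors, hence for all x, and this keeps
  the kernel inside K.\<close>

lemma ex_projection:
  assumes "pm.subspace (K :: ('x \<Rightarrow>\<^sub>0 'k::field) set)"
  obtains \<pi> where "plinear \<pi>" "\<And>x. x - \<pi> x \<in> K" "\<And>x. \<pi> x = 0 \<longleftrightarrow> x \<in> K"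
proof -
  obtain A where A: "A \<subseteq> K" "pm.independent A" "K \<subseteq> pm.span A"
    by (rule pm.maximal_independent_subset)
  obtain \<pi> where \<pi>: "plinear \<pi>" "\<And>b. b \<in> pm.extend_basis A \<Longrightarrow> \<pi> b = (if b \<in> A then 0 else b)"
    using pmp.linear_independent_extend[OF pm.independent_extend_basis[OF A(2)], of "\<lambda>b. if b \<in> A then 0 else b"]
    by blast
  have K0: "\<pi> x = 0" if "x \<in> K" for x
  proof (rule pmp.linear_eq_0_on_span[OF \<pi>(1)])
    show "\<pi> b = 0" if "b \<in> A" for b
      using that \<pi>(2)[of b] pm.extend_basis_superset[OF A(2)] by auto
    show "x \<in> pm.span A" using that A by blast
  qed
  have diff: "x - \<pi> x \<in> K" for x
  proof -
    have "x \<in> pm.span (pm.extend_basis A)" by (simp add: A(2))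
    then show ?thesis
    proof (induction rule: pm.span_induct_alt)
      case base
      then show ?case using pmp.linear_0[OF \<pi>(1)] pm.subspace_0[OF assms] by simp
    next
      case (step c x y)
      have "x - \<pi> x \<in> K" using \<pi>(2)[OF step(1)] A pm.subspace_0[OF assms] by auto
      then have "smul c (x - \<pi> x) + (y - \<pi> y) \<in> K"
        using step assms by (intro pm.subspace_add pm.subspace_scale)
      then show ?case
        by (simp add: pmp.linear_add[OF \<pi>(1)] pmp.linear_scale[OF \<pi>(1)] pm.scale_right_diff_distrib
            add_diff_add)
    qed
  qed
  have "\<pi> x = 0 \<longleftrightarrow> x \<in> K" for x using K0 diff[of x] by auto
  then show ?thesis using that \<pi>(1) diff by blast
qed

section \<open>Scalars in the convolution product\<close>

lemma smul_conv_mult: "smul c (p :: 'x::monoid_add \<Rightarrow>\<^sub>0 'k::field) = single 0 c * p"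
  by (rule mult_map_scale_conv_mult)

lemma smul_mult_left [simp]:
  "smul c p * q = smul c (p * q :: 'x::monoid_add \<Rightarrow>\<^sub>0 'k::field)"
  unfolding smul_conv_mult by (simp add: mult.assoc)

text \<open>Constants sit at the neutral element of the index monoid and are therefore central,
  although the convolution product itself is not commutative. Scalars can thus leave a product on
  either side.\<close>

lemma single_0_commute:
  "p * single 0 c = single 0 c * (p :: 'x::monoid_add \<Rightarrow>\<^sub>0 'k::field)"
proof -
  have "keys p \<subseteq> UNIV" by simp
  then show ?thesis
    by (induction rule: keys_span_induct) (simp_all add: mult_single mult.commute[of c] distrib_left distrib_right)
qed

lemma smul_mult_right [simp]:
  "p * smul c q = smul c (p * q :: 'x::monoid_add \<Rightarrow>\<^sub>0 'k::field)"
  unfolding smul_conv_mult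
  by (simp only: mult.assoc[symmetric] single_0_commute[of p])

subsection \<open>Vector spaces embedded into function spaces\<close>

text \<open>M is not assumed to be a vector space: an injective map that respects zero, addition and
  scalars imports all axioms from the function space. Every quotient below obtains its vector space
  structure in this way.\<close>

locale embedding =
  fixes M :: "('k::field, 'v, 'm) module_scheme" and f :: "'v \<Rightarrow> ('x \<Rightarrow>\<^sub>0 'k)"
  assumes inj: "inj_on f (carrier M)"
    and zero_closed: "\<zero>\<^bsub>M\<^esub> \<in> carrier M" and f_zero: "f \<zero>\<^bsub>M\<^esub> = 0"
    and add_closed: "\<And>x y. x \<in> carrier M \<Longrightarrow> y \<in> carrier M \<Longrightarrow> x \<oplus>\<^bsub>M\<^esub> y \<in> carrier M"
    and f_add: "\<And>x y. x \<in> carrier M \<Longrightarrow> y \<in> carrier M \<Longrightarrow> f (x \<oplus>\<^bsub>M\<^esub> y) = f x + f y"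
    and smult_closed: "\<And>c x. x \<in> carrier M \<Longrightarrow> c \<odot>\<^bsub>M\<^esub> x \<in> carrier M"
    and f_smult: "\<And>c x. x \<in> carrier M \<Longrightarrow> f (c \<odot>\<^bsub>M\<^esub> x) = smul c (f x)"
begin

lemma eqI: "x \<in> carrier M \<Longrightarrow> y \<in> carrier M \<Longrightarrow> f x = f y \<Longrightarrow> x = y"
  using inj by (simp add: inj_on_eq_iff)

lemma vectorspace: "vectorspace class_ring M"
proof (rule vs_criteria)
  show "\<forall>v\<in>carrier M. \<exists>w\<in>carrier M. v \<oplus>\<^bsub>M\<^esub> w = \<zero>\<^bsub>M\<^esub>"
  proof
    fix v assume v: "v \<in> carrier M"
    then have "v \<oplus>\<^bsub>M\<^esub> ((-1) \<odot>\<^bsub>M\<^esub> v) = \<zero>\<^bsub>M\<^esub>"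
      by (intro eqI) (simp_all add: add_closed f_add smult_closed f_smult zero_closed f_zero)
    then show "\<exists>w\<in>carrier M. v \<oplus>\<^bsub>M\<^esub> w = \<zero>\<^bsub>M\<^esub>" using v smult_closed by blast
  qed
qed (use class_field in \<open>auto intro!: eqI simp: add_closed f_add smult_closed f_smult
      zero_closed f_zero algebra_simps pm.scale_left_distrib pm.scale_right_distrib\<close>)

lemma f_finsum: "g \<in> S \<rightarrow> carrier M \<Longrightarrow> finite S \<Longrightarrow> f (finsum M g S) = (\<Sum>v\<in>S. f (g v))"
proof -
  interpret V: vectorspace class_ring M by (rule vectorspace)
  show "g \<in> S \<rightarrow> carrier M \<Longrightarrow> finite S \<Longrightarrow> f (finsum M g S) = (\<Sum>v\<in>S. f (g v))"
  proof (induction S rule: infinite_finite_induct)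
    case (insert x S)
    then have "finsum M g (insert x S) = g x \<oplus>\<^bsub>M\<^esub> finsum M g S" by (intro V.finsum_insert) auto
    then show ?case using insert by (simp add: f_add V.finsum_closed)
  qed (simp_all add: f_zero)
qed

lemma image_subspace_of_submodule:
  assumes "submodule class_ring W M" shows "pm.subspace (f ` W)"
proof (rule pm.subspaceI)
  interpret submodule class_ring W M by fact
  show "0 \<in> f ` W" using f_zero zero_closed by (metis imageI submodule.zero_closed[OF assms])
  fix x y and c :: 'k assume "x \<in> f ` W" "y \<in> f ` W"
  then obtain u v where uv: "u \<in> W" "v \<in> W" "x = f u" "y = f v" by blast
  moreover have "u \<in> carrier M" "v \<in> carrier M" using uv subset by blast+
  ultimately have "x + y = f (u \<oplus>\<^bsub>M\<^esub> v)" "smul c x = f (c \<odot>\<^bsub>M\<^esub> u)"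
    by (simp_all only: f_add f_smult)
  moreover have "u \<oplus>\<^bsub>M\<^esub> v \<in> W" "c \<odot>\<^bsub>M\<^esub> u \<in> W"
    using uv m_closed[of u v] submodule.smult_closed[OF assms, of c u] by simp_all
  ultimately show "x + y \<in> f ` W" "smul c x \<in> f ` W" by blast+
qed

lemma image_vspan:
  assumes "A \<subseteq> carrier M"
  shows "f ` vspan M A = pm.span (f ` A)"
proof -
  interpret V: vectorspace class_ring M by (rule vectorspace)
  show ?thesis
  proof
    show "pm.span (f ` A) \<subseteq> f ` vspan M A"
      using V.in_own_span[OF assms] image_subspace_of_submodule[OF V.span_is_submodule[OF assms]]
      by (intro pm.span_minimal) auto
    show "f ` vspan M A \<subseteq> pm.span (f ` A)"
    proof
      fix y assume "y \<in> f ` vspan M A"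
      then obtain a B where B: "finite B" "B \<subseteq> A" "y = f (V.lincomb a B)"
        unfolding V.span_def by blast
      have "f (V.lincomb a B) = (\<Sum>v\<in>B. f (a v \<odot>\<^bsub>M\<^esub> v))"
        unfolding V.lincomb_def using B assms smult_closed by (intro f_finsum) auto
      also have "\<dots> = (\<Sum>v\<in>B. smul (a v) (f v))"
        using B assms by (intro sum.cong refl f_smult) auto
      also have "\<dots> \<in> pm.span (f ` A)"
        using B by (intro pm.span_sum pm.span_scale pm.span_base) auto
      finally show "y \<in> pm.span (f ` A)" using B by simp
    qed
  qed
qed

lemma vspan_closed: "A \<subseteq> carrier M \<Longrightarrow> vspan M A \<subseteq> carrier M"
  using module.span_is_subset2[of class_ring M A] vectorspace unfolding vectorspace_def by blast

lemma mem_vspan_iff: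
  assumes "A \<subseteq> carrier M" "x \<in> carrier M"
  shows "x \<in> vspan M A \<longleftrightarrow> f x \<in> pm.span (f ` A)"
  using inj_on_image_mem_iff[OF inj assms(2) vspan_closed[OF assms(1)]] image_vspan[OF assms(1)]
  by simp

text \<open>Closure of W is read off from the image: by injectivity, an element of the carrier lies
  in W as soon as its value under f lies in the image of W.\<close>

lemma restrict_carrier:
  assumes "W \<subseteq> carrier M" "pm.subspace (f ` W)"
  shows "embedding (M\<lparr>carrier := W\<rparr>) f"
proof
  have *: "x \<in> W" if "x \<in> carrier M" "f x \<in> f ` W" for x
    using that assms(1) inj_on_image_mem_iff[OF inj] by blast
  show "inj_on f (carrier (M\<lparr>carrier := W\<rparr>))" using assms(1) inj by (auto intro: inj_on_subset)
  show "\<zero>\<^bsub>M\<lparr>carrier := W\<rparr>\<^esub> \<in> carrier (M\<lparr>carrier := W\<rparr>)"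
    using *[OF zero_closed] f_zero pm.subspace_0[OF assms(2)] by simp
  fix x y c assume x: "x \<in> carrier (M\<lparr>carrier := W\<rparr>)"
  then have x': "x \<in> W" "x \<in> carrier M" using assms by auto
  show "c \<odot>\<^bsub>M\<lparr>carrier := W\<rparr>\<^esub> x \<in> carrier (M\<lparr>carrier := W\<rparr>)"
    using *[OF smult_closed[OF x'(2)], of c] pm.subspace_scale[OF assms(2), of "f x" c] x'
    by (simp add: f_smult)
  show "f (c \<odot>\<^bsub>M\<lparr>carrier := W\<rparr>\<^esub> x) = smul c (f x)" using x' by (simp add: f_smult)
  assume y: "y \<in> carrier (M\<lparr>carrier := W\<rparr>)"
  then have y': "y \<in> W" "y \<in> carrier M" using assms by auto
  show "x \<oplus>\<^bsub>M\<lparr>carrier := W\<rparr>\<^esub> y \<in> carrier (M\<lparr>carrier := W\<rparr>)"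
    using *[OF add_closed[OF x'(2) y'(2)]] pm.subspace_add[OF assms(2), of "f x" "f y"] x' y'
    by (simp add: f_add)
  show "f (x \<oplus>\<^bsub>M\<lparr>carrier := W\<rparr>\<^esub> y) = f x + f y" using x' y' by (simp add: f_add)
qed (simp_all add: f_zero)

lemma image_subspace: "pm.subspace (f ` carrier M)"
proof (rule pm.subspaceI)
  show "0 \<in> f ` carrier M" using zero_closed f_zero by (metis imageI)
next
  fix x y assume "x \<in> f ` carrier M" "y \<in> f ` carrier M"
  then obtain u v where "u \<in> carrier M" "v \<in> carrier M" "x = f u" "y = f v" by blast
  then show "x + y \<in> f ` carrier M" using f_add[of u v] add_closed[of u v] by (metis imageI)
next
  fix x c assume "x \<in> f ` carrier M"
  then obtain u where "u \<in> carrier M" "x = f u" by blast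
  then show "smul c x \<in> f ` carrier M" using f_smult[of u c] smult_closed[of u c] by (metis imageI)
qed

text \<open>\<open>V.dim\<close> is the least cardinality of a finite spanning set. A basis of the
  image pulls back along f to such a set, and the image of any spanning set spans the image, so none
  can be smaller.\<close>

lemma vdim_eq:
  assumes "fdim (f ` carrier M)"
  shows "vdim M = pm.dim (f ` carrier M)"
proof -
  interpret V: vectorspace class_ring M by (rule vectorspace)
  obtain B where B: "B \<subseteq> f ` carrier M" "pm.independent B" "f ` carrier M \<subseteq> pm.span B"
      "card B = pm.dim (f ` carrier M)"
    using pm.basis_exists by blast
  obtain A where A: "A \<subseteq> carrier M" "B = f ` A" using B(1) by (meson subset_imageE)
  have injA: "inj_on f A" using A inj inj_on_subset by blast
  have finB: "finite B" using fdim_independent_finite assms B by blast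
  have span: "vspan M A = carrier M"
  proof
    show "carrier M \<subseteq> vspan M A" using B(3) mem_vspan_iff[OF A(1)] A(2) by auto
  qed (use vspan_closed A in auto)
  show ?thesis unfolding V.dim_def
  proof (rule Least_equality)
    show "\<exists>A. finite A \<and> card A = pm.dim (f ` carrier M) \<and> A \<subseteq> carrier M \<and> V.span A = carrier M"
      using A B span finB injA by (metis card_image finite_image_iff)
    fix n assume "\<exists>A. finite A \<and> card A = n \<and> A \<subseteq> carrier M \<and> V.span A = carrier M"
    then obtain A where A: "finite A" "card A = n" "A \<subseteq> carrier M" "V.span A = carrier M" by blast
    have "pm.dim (f ` carrier M) \<le> card (f ` A)"
      using image_vspan[OF A(3)] A by (intro pm.dim_le_card) auto
    also have "\<dots> \<le> n" using A card_image_le by blast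
    finally show "pm.dim (f ` carrier M) \<le> n" .
  qed
qed

end

section \<open>Quotients by the kernel of a linear map\<close>

text \<open>Meaningful only on sets on which h is constant, as are the cosets of the kernel of h.\<close>

definition induced :: "('v \<Rightarrow> 'y) \<Rightarrow> 'v set \<Rightarrow> 'y" where
  "induced h X = h (SOME x. x \<in> X)"

text \<open>The first isomorphism theorem as a locale: a linear map h with kernel W embeds the
  quotient of M by W into a function space, with the range of h as image. The map f provides the
  linear structure of M itself.\<close>

locale quotient_map = embedding M f for M :: "('k::field, 'v, 'm) module_scheme"
    and f :: "'v \<Rightarrow> ('x \<Rightarrow>\<^sub>0 'k)" +
  fixes W :: "'v set" and h :: "'v \<Rightarrow> ('y \<Rightarrow>\<^sub>0 'k)"
  assumes W_subset: "W \<subseteq> carrier M"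
    and h_add: "\<And>x y. x \<in> carrier M \<Longrightarrow> y \<in> carrier M \<Longrightarrow> h (x \<oplus>\<^bsub>M\<^esub> y) = h x + h y"
    and h_smult: "\<And>c x. x \<in> carrier M \<Longrightarrow> h (c \<odot>\<^bsub>M\<^esub> x) = smul c (h x)"
    and h_kernel: "\<And>x. x \<in> carrier M \<Longrightarrow> h x = 0 \<longleftrightarrow> x \<in> W"
begin

text \<open>Differences are written with the scalar -1, because f and h are specified on sums and
  scalar multiples.\<close>

lemma minus_closed_eq:
  assumes "x \<in> carrier M" "y \<in> carrier M"
  shows "x \<oplus>\<^bsub>M\<^esub> ((-1) \<odot>\<^bsub>M\<^esub> y) \<in> carrier M"
    and "x \<oplus>\<^bsub>M\<^esub> ((-1) \<odot>\<^bsub>M\<^esub> y) \<oplus>\<^bsub>M\<^esub> y = x"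
    and "h (x \<oplus>\<^bsub>M\<^esub> ((-1) \<odot>\<^bsub>M\<^esub> y)) = h x - h y"
  using assms
  by (auto intro!: eqI simp: add_closed smult_closed f_add f_smult h_add h_smult)

lemma coset_eq:
  assumes "x \<in> carrier M"
  shows "W +>\<^bsub>M\<^esub> x = {y \<in> carrier M. h y = h x}"
proof (intro equalityI subsetI)
  fix y assume "y \<in> W +>\<^bsub>M\<^esub> x"
  then obtain w where "w \<in> W" "y = w \<oplus>\<^bsub>M\<^esub> x" by (auto simp: a_r_coset_def')
  then show "y \<in> {y \<in> carrier M. h y = h x}"
    using assms W_subset h_kernel[of w] by (auto simp: add_closed h_add)
next
  fix y assume "y \<in> {y \<in> carrier M. h y = h x}"
  then have y: "y \<in> carrier M" "h y = h x" by auto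
  have "y \<oplus>\<^bsub>M\<^esub> ((-1) \<odot>\<^bsub>M\<^esub> x) \<in> W"
    using minus_closed_eq[OF y(1) assms] h_kernel y(2) by simp
  then show "y \<in> W +>\<^bsub>M\<^esub> x"
    using minus_closed_eq(2)[OF y(1) assms] by (force simp: a_r_coset_def')
qed

lemma coset_eq_iff:
  "x \<in> carrier M \<Longrightarrow> y \<in> carrier M \<Longrightarrow> W +>\<^bsub>M\<^esub> x = W +>\<^bsub>M\<^esub> y \<longleftrightarrow> h x = h y"
  by (auto simp: coset_eq)

lemma induced_coset [simp]: "x \<in> carrier M \<Longrightarrow> induced h (W +>\<^bsub>M\<^esub> x) = h x"
  unfolding induced_def coset_eq
  by (rule someI2[of "\<lambda>y. y \<in> {y \<in> carrier M. h y = h x}" x]) auto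

lemma carrier_quot: "carrier (quot_module M W) = (\<lambda>x. W +>\<^bsub>M\<^esub> x) ` carrier M"
  by (auto simp: quot_module_def ring.extend_def FactRing_def A_RCOSETS_def' )

lemma zero_quot: "\<zero>\<^bsub>quot_module M W\<^esub> = W +>\<^bsub>M\<^esub> \<zero>\<^bsub>M\<^esub>"
proof -
  have "h \<zero>\<^bsub>M\<^esub> = 0"
    using h_smult[OF zero_closed, of 0] f_smult[OF zero_closed, of 0] smult_closed[OF zero_closed, of 0]
    by (metis eqI f_zero pm.scale_zero_left zero_closed)
  then have "W +>\<^bsub>M\<^esub> \<zero>\<^bsub>M\<^esub> = {y \<in> carrier M. h y = 0}" by (simp add: coset_eq zero_closed)
  also have "\<dots> = W" using W_subset h_kernel by blast
  finally have "W +>\<^bsub>M\<^esub> \<zero>\<^bsub>M\<^esub> = W" .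
  then show ?thesis by (simp add: quot_module_def ring.extend_def FactRing_def)
qed

lemma add_quot:
  assumes x: "x \<in> carrier M" and y: "y \<in> carrier M"
  shows "(W +>\<^bsub>M\<^esub> x) \<oplus>\<^bsub>quot_module M W\<^esub> (W +>\<^bsub>M\<^esub> y) = W +>\<^bsub>M\<^esub> (x \<oplus>\<^bsub>M\<^esub> y)"
proof -
  have "(W +>\<^bsub>M\<^esub> x) <+>\<^bsub>M\<^esub> (W +>\<^bsub>M\<^esub> y) = W +>\<^bsub>M\<^esub> (x \<oplus>\<^bsub>M\<^esub> y)"
  proof (intro equalityI subsetI)
    fix z assume "z \<in> (W +>\<^bsub>M\<^esub> x) <+>\<^bsub>M\<^esub> (W +>\<^bsub>M\<^esub> y)"
    then show "z \<in> W +>\<^bsub>M\<^esub> (x \<oplus>\<^bsub>M\<^esub> y)"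
      using x y by (auto simp: set_add_def' coset_eq add_closed h_add)
  next
    fix z assume "z \<in> W +>\<^bsub>M\<^esub> (x \<oplus>\<^bsub>M\<^esub> y)"
    then have z: "z \<in> carrier M" "h z = h x + h y" using x y by (auto simp: coset_eq add_closed h_add)
    show "z \<in> (W +>\<^bsub>M\<^esub> x) <+>\<^bsub>M\<^esub> (W +>\<^bsub>M\<^esub> y)"
      unfolding set_add_def' coset_eq[OF x] coset_eq[OF y]
      using minus_closed_eq[OF z(1) y] z y by force
  qed
  then show ?thesis by (simp add: quot_module_def ring.extend_def FactRing_def)
qed

text \<open>Scalar multiplication in \<open>quot_module\<close> is a union over all representatives.
  The cosets occurring in it coincide and there is at least one, so the union is a single
  coset.\<close>

lemma smult_quot:
  assumes x: "x \<in> carrier M"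
  shows "c \<odot>\<^bsub>quot_module M W\<^esub> (W +>\<^bsub>M\<^esub> x) = W +>\<^bsub>M\<^esub> (c \<odot>\<^bsub>M\<^esub> x)"
proof -
  have "W +>\<^bsub>M\<^esub> (c \<odot>\<^bsub>M\<^esub> y) = W +>\<^bsub>M\<^esub> (c \<odot>\<^bsub>M\<^esub> x)" if "y \<in> W +>\<^bsub>M\<^esub> x" for y
    using that x by (auto simp: coset_eq smult_closed h_smult)
  moreover have "x \<in> W +>\<^bsub>M\<^esub> x" using x by (simp add: coset_eq)
  ultimately have "(\<Union>y\<in>W +>\<^bsub>M\<^esub> x. W +>\<^bsub>M\<^esub> (c \<odot>\<^bsub>M\<^esub> y)) = W +>\<^bsub>M\<^esub> (c \<odot>\<^bsub>M\<^esub> x)"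
    by (intro UN_constant_eq) blast+
  then show ?thesis by (simp add: quot_module_def ring.extend_def module.fields_def)
qed

lemma embedding_quot: "embedding (quot_module M W) (induced h)"
proof
  show "inj_on (induced h) (carrier (quot_module M W))"
    by (auto simp: carrier_quot inj_on_def coset_eq_iff)
  show "induced h \<zero>\<^bsub>quot_module M W\<^esub> = 0"
    using h_smult[OF zero_closed, of 0] f_smult[OF zero_closed, of 0] smult_closed[OF zero_closed, of 0]
    by (metis eqI f_zero induced_coset pm.scale_zero_left zero_closed zero_quot)
qed (auto simp: carrier_quot zero_quot zero_closed add_quot add_closed smult_quot smult_closed h_add h_smult)

lemma image_quot: "induced h ` carrier (quot_module M W) = h ` carrier M"
  by (force simp: carrier_quot image_image)

end

text \<open>Meant for the free algebra and the tensor algebra, whose coordinates are multiplicative.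
  The quotient algebra A gets a linear embedding instead, since a linear choice of representatives
  need not respect products.\<close>

locale alg_embedding = embedding M f for M :: "('k::field, 'v, 'm) module_scheme"
    and f :: "'v \<Rightarrow> ('x::monoid_add \<Rightarrow>\<^sub>0 'k)" +
  assumes one_closed: "\<one>\<^bsub>M\<^esub> \<in> carrier M" and f_one: "f \<one>\<^bsub>M\<^esub> = 1"
    and mult_closed: "\<And>x y. x \<in> carrier M \<Longrightarrow> y \<in> carrier M \<Longrightarrow> x \<otimes>\<^bsub>M\<^esub> y \<in> carrier M"
    and f_mult: "\<And>x y. x \<in> carrier M \<Longrightarrow> y \<in> carrier M \<Longrightarrow> f (x \<otimes>\<^bsub>M\<^esub> y) = f x * f y"
begin

lemma ring: "ring M"
proof (rule ringI)
  interpret V: vectorspace class_ring M by (rule vectorspace)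
  show "abelian_group M" by (rule V.abelian_group_axioms)
  show "Group.monoid M"
    by (rule monoidI) (auto intro!: eqI simp: one_closed f_one mult_closed f_mult mult.assoc)
qed (auto intro!: eqI simp: add_closed f_add mult_closed f_mult distrib_left distrib_right)

text \<open>A scalar acts as multiplication by a multiple of the unit; hence ring-theoretic ideals
  are automatically subspaces.\<close>

lemma smult_conv_mult: "x \<in> carrier M \<Longrightarrow> c \<odot>\<^bsub>M\<^esub> x = (c \<odot>\<^bsub>M\<^esub> \<one>\<^bsub>M\<^esub>) \<otimes>\<^bsub>M\<^esub> x"
  by (intro eqI) (simp_all add: smult_closed f_smult mult_closed f_mult one_closed f_one)

lemma ideal_smult_closed: "ideal I M \<Longrightarrow> x \<in> I \<Longrightarrow> c \<odot>\<^bsub>M\<^esub> x \<in> I"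
  using smult_conv_mult[of x c] ideal.I_l_closed[of I M x "c \<odot>\<^bsub>M\<^esub> \<one>\<^bsub>M\<^esub>"]
    additive_subgroup.a_Hcarr[OF ideal.axioms(1)] one_closed smult_closed by metis

lemma ideal_submodule: "ideal I M \<Longrightarrow> submodule class_ring I M"
proof -
  assume I: "ideal I M"
  interpret I: ideal I M by fact
  show ?thesis
    using vectorspace ideal_smult_closed[OF I] I.a_subset unfolding vectorspace_def
    by (auto simp: submodule_def)
qed

end

lemma quot_mult:
  assumes "ideal I M" "x \<in> carrier M" "y \<in> carrier M"
  shows "(I +>\<^bsub>M\<^esub> x) \<otimes>\<^bsub>quot_module M I\<^esub> (I +>\<^bsub>M\<^esub> y) = I +>\<^bsub>M\<^esub> (x \<otimes>\<^bsub>M\<^esub> y)"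
  using ideal.rcoset_mult_add[OF assms] by (simp add: quot_module_def ring.extend_def FactRing_def)

lemma quot_one: "\<one>\<^bsub>quot_module M I\<^esub> = I +>\<^bsub>M\<^esub> \<one>\<^bsub>M\<^esub>"
  by (simp add: quot_module_def ring.extend_def FactRing_def)

lemma alg_embedding_quot:
  assumes "quotient_map M f I h" "ideal I M"
    and "\<one>\<^bsub>M\<^esub> \<in> carrier M" "h \<one>\<^bsub>M\<^esub> = 1"
    and "\<And>x y. x \<in> carrier M \<Longrightarrow> y \<in> carrier M \<Longrightarrow> x \<otimes>\<^bsub>M\<^esub> y \<in> carrier M"
    and "\<And>x y. x \<in> carrier M \<Longrightarrow> y \<in> carrier M \<Longrightarrow> h (x \<otimes>\<^bsub>M\<^esub> y) = h x * h y"
  shows "alg_embedding (quot_module M I) (induced h)"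
proof -
  interpret quotient_map M f I h by fact
  interpret Q: embedding "quot_module M I" "induced h" by (rule embedding_quot)
  show ?thesis
    by unfold_locales (auto simp: carrier_quot quot_one quot_mult[OF assms(2)] assms)
qed

lemma embedding_free_space: "embedding (free_space X :: ('k::field, 'x \<Rightarrow>\<^sub>0 'k) module) id"
proof
  fix x y :: "'x \<Rightarrow>\<^sub>0 'k" and c :: 'k
  let ?F = "free_space X :: ('k, 'x \<Rightarrow>\<^sub>0 'k) module"
  assume x: "x \<in> carrier ?F"
  show "c \<odot>\<^bsub>?F\<^esub> x \<in> carrier ?F"
    using x pm.subspace_scale[OF keys_subspace[of X], of x c] by (simp add: free_space_def)
  assume y: "y \<in> carrier ?F"
  show "x \<oplus>\<^bsub>?F\<^esub> y \<in> carrier ?F"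
    using x y pm.subspace_add[OF keys_subspace[of X], of x y] by (simp add: free_space_def)
qed (simp_all add: free_space_def)

lemma keys_mult_lists:
  fixes p q :: "'x list \<Rightarrow>\<^sub>0 'k::field"
  assumes "keys p \<subseteq> lists X" "keys q \<subseteq> lists X"
  shows "keys (p * q) \<subseteq> lists X"
proof
  fix x assume "x \<in> keys (p * q)"
  then obtain a b where "a \<in> keys p" "b \<in> keys q" "x = a + b"
    using keys_mult by blast
  then show "x \<in> lists X" using assms by (auto simp: plus_list_def)
qed

lemma alg_embedding_free_algebra: "alg_embedding (free_algebra X) id"
proof -
  interpret F: embedding "free_space (lists X)" id by (rule embedding_free_space)
  show ?thesis
    using F.add_closed F.smult_closed F.zero_closed
    by unfold_locales (simp_all add: free_algebra_def free_space_def keys_mult_lists zero_list_def)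
qed

subsection \<open>The tensor algebra in coordinates\<close>

text \<open>Additive inverses come from multiplication by the negative of the unit, so closure under
  them is no separate hypothesis.\<close>

lemma (in alg_embedding) ideal_of_closed:
  assumes "K \<subseteq> carrier M" "\<zero>\<^bsub>M\<^esub> \<in> K"
    and add: "\<And>x y. x \<in> K \<Longrightarrow> y \<in> K \<Longrightarrow> x \<oplus>\<^bsub>M\<^esub> y \<in> K"
    and mult_left: "\<And>x y. x \<in> K \<Longrightarrow> y \<in> carrier M \<Longrightarrow> y \<otimes>\<^bsub>M\<^esub> x \<in> K"
    and mult_right: "\<And>x y. x \<in> K \<Longrightarrow> y \<in> carrier M \<Longrightarrow> x \<otimes>\<^bsub>M\<^esub> y \<in> K"
  shows "ideal K M"
proof (rule idealI)
  interpret R: ring M by (rule ring)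
  show "ring M" by (rule ring)
  show "subgroup K (add_monoid M)"
  proof (rule R.add.subgroupI)
    show "K \<subseteq> carrier M" "K \<noteq> {}" using assms by auto
    fix x assume x: "x \<in> K"
    then have "x \<in> carrier M" using assms by blast
    then have "\<ominus>\<^bsub>M\<^esub> x = (\<ominus>\<^bsub>M\<^esub> \<one>\<^bsub>M\<^esub>) \<otimes>\<^bsub>M\<^esub> x" by (simp add: R.l_minus)
    also have "\<dots> \<in> K" using x by (intro mult_left) auto
    finally show "\<ominus>\<^bsub>M\<^esub> x \<in> K" .
  qed (use add in auto)
qed (use mult_left mult_right in auto)

section \<open>Words, homogeneous functions and the map to coordinates\<close>

definition words :: "'i set \<Rightarrow> nat \<Rightarrow> 'i list set" where
  "words B n = {w \<in> lists B. length w = n}"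

definition homog :: "'i set \<Rightarrow> nat \<Rightarrow> ('i list \<Rightarrow>\<^sub>0 'k::field) set" where
  "homog B n = {p. keys p \<subseteq> words B n}"

lemma finite_words: "finite B \<Longrightarrow> finite (words B n)"
  using finite_lists_length_eq[of B n] by (simp add: words_def lists_eq_set)

lemma subspace_homog: "pm.subspace (homog B n)"
  unfolding homog_def by (rule keys_subspace)

lemma fdim_homog: "finite B \<Longrightarrow> fdim (homog B n)"
  unfolding homog_def by (intro fdim_keys finite_words)

lemma homog_lists: "p \<in> homog B n \<Longrightarrow> keys p \<subseteq> lists B"
  by (auto simp: homog_def words_def)

lemma homog_mult: "p \<in> homog B m \<Longrightarrow> q \<in> homog B n \<Longrightarrow> p * q \<in> homog B (m + n)"
  using keys_mult[of p q] by (fastforce simp: homog_def words_def plus_list_def)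

lemma single_mult_list:
  "single u a * single v b = single (u @ v) (a * b :: 'k::field)"
  by (simp add: mult_single plus_list_def)

text \<open>The universal property of the free monoid algebra. Both sides are bilinear in p and q,
  so single words suffice.\<close>

lemma lin_ext_mult:
  fixes g :: "'x list \<Rightarrow> ('y::monoid_add \<Rightarrow>\<^sub>0 'k::field)"
  assumes "\<And>u v. g (u @ v) = g u * g v"
  shows "lin_ext g (p * q) = lin_ext g p * lin_ext g q"
proof -
  note lin = plinear_lin_ext[of g]
  have p: "keys p \<subseteq> UNIV" and q: "keys q \<subseteq> UNIV" by simp_all
  show ?thesis
    using p
  proof (induction p rule: keys_span_induct)
    case (single u a)
    show ?case
      using q
    proof (induction q rule: keys_span_induct)
      case (single v b)
      then show ?case by (simp add: single_mult_list assms mult.commute)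
    qed (simp add: distrib_left pmp.linear_add[OF lin])
  qed (simp add: distrib_right pmp.linear_add[OF lin])
qed

text \<open>The index type of the basis is kept apart from the vectors, so that E and its dual get the same
  space of words.\<close>

locale coordinates =
  fixes E :: "('k::field, 'e, 'm) module_scheme"
    and B :: "'i set" and crd :: "'e \<Rightarrow> 'i \<Rightarrow> 'k" and bas :: "'i \<Rightarrow> 'e"
  assumes vs: "vectorspace class_ring E" and finite_B: "finite B"
    and bas_closed: "\<And>b. b \<in> B \<Longrightarrow> bas b \<in> carrier E"
    and crd_add: "\<And>x y b. x \<in> carrier E \<Longrightarrow> y \<in> carrier E \<Longrightarrow> b \<in> B \<Longrightarrow>
      crd (x \<oplus>\<^bsub>E\<^esub> y) b = crd x b + crd y b"
    and crd_smult: "\<And>c x b. x \<in> carrier E \<Longrightarrow> b \<in> B \<Longrightarrow> crd (c \<odot>\<^bsub>E\<^esub> x) b = c * crd x b"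
    and crd_bas: "\<And>b b'. b \<in> B \<Longrightarrow> b' \<in> B \<Longrightarrow> crd (bas b) b' = (if b = b' then 1 else 0)"
    and crd_eq: "\<And>x y. x \<in> carrier E \<Longrightarrow> y \<in> carrier E \<Longrightarrow> (\<And>b. b \<in> B \<Longrightarrow> crd x b = crd y b) \<Longrightarrow> x = y"
begin

sublocale E: vectorspace class_ring E by (rule vs)

definition lin :: "'e \<Rightarrow> ('i list \<Rightarrow>\<^sub>0 'k)" where
  "lin x = (\<Sum>b\<in>B. single [b] (crd x b))"

definition word :: "'e list \<Rightarrow> ('i list \<Rightarrow>\<^sub>0 'k)" where
  "word xs = prod_list (map lin xs)"

definition phi :: "('e list \<Rightarrow>\<^sub>0 'k) \<Rightarrow> ('i list \<Rightarrow>\<^sub>0 'k)" where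
  "phi = lin_ext word"

text \<open>A section of \<open>phi\<close>. The two maps are mutually inverse modulo the tensor
  ideal, which identifies the tensor algebra of E with the free algebra on B.\<close>

definition sec :: "('i list \<Rightarrow>\<^sub>0 'k) \<Rightarrow> ('e list \<Rightarrow>\<^sub>0 'k)" where
  "sec = lin_ext (\<lambda>w. single (map bas w) 1)"

lemma word_simps [simp]: "word [] = 1" "word (x # xs) = lin x * word xs"
  "word (xs @ ys) = word xs * word ys"
  by (simp_all add: word_def)

lemma plinear_phi: "plinear phi" and plinear_sec: "plinear sec"
  unfolding phi_def sec_def by (rule plinear_lin_ext)+

lemma phi_single [simp]: "phi (single w c) = smul c (word w)"
  by (simp add: phi_def)

lemma phi_mult: "phi (p * q) = phi p * phi q"
  unfolding phi_def by (rule lin_ext_mult) simp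

lemma phi_one [simp]: "phi 1 = 1"
  using phi_single[of "[]" 1] by (simp add: zero_list_def flip: single_one)

lemma sec_single [simp]: "sec (single w c) = single (map bas w) c"
  by (simp add: sec_def)

lemma sec_mult: "sec (p * q) = sec p * sec q"
  unfolding sec_def by (rule lin_ext_mult) (simp add: single_mult_list)

lemma lin_add: "x \<in> carrier E \<Longrightarrow> y \<in> carrier E \<Longrightarrow> lin (x \<oplus>\<^bsub>E\<^esub> y) = lin x + lin y"
  unfolding lin_def sum.distrib[symmetric]
  by (intro sum.cong refl) (simp add: crd_add single_add)

lemma lin_smult: "x \<in> carrier E \<Longrightarrow> lin (c \<odot>\<^bsub>E\<^esub> x) = smul c (lin x)"
  unfolding lin_def pm.scale_sum_right
  by (intro sum.cong refl) (simp add: crd_smult)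

lemma lin_bas: "b \<in> B \<Longrightarrow> lin (bas b) = single [b] 1"
proof -
  assume b: "b \<in> B"
  have "lin (bas b) = (\<Sum>b'\<in>B. if b' = b then single [b] 1 else 0)"
    unfolding lin_def by (intro sum.cong refl) (use b in \<open>auto simp: crd_bas\<close>)
  then show ?thesis using b finite_B by simp
qed

lemma word_bas: "w \<in> lists B \<Longrightarrow> word (map bas w) = single w 1"
  by (induction w) (simp_all add: lin_bas single_mult_list zero_list_def flip: single_one)

lemma lin_homog: "lin x \<in> homog B 1"
  unfolding lin_def homog_def mem_Collect_eq
  by (rule keys_sum_subset) (auto simp: words_def)

lemma one_homog: "(1 :: 'i list \<Rightarrow>\<^sub>0 'k) \<in> homog B 0"
  by (simp add: homog_def words_def zero_list_def)

lemma word_homog: "word xs \<in> homog B (length xs)"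
proof (induction xs)
  case (Cons x xs)
  then show ?case using homog_mult[OF lin_homog, of _ "length xs"] by simp
qed (simp add: one_homog)

abbreviation "F \<equiv> free_algebra (carrier E) :: ('k, 'e list \<Rightarrow>\<^sub>0 'k) module"

sublocale F: alg_embedding F id
  by (rule alg_embedding_free_algebra)

lemma F_simps [simp]: "carrier F = {p. keys p \<subseteq> lists (carrier E)}"
  "p \<oplus>\<^bsub>F\<^esub> q = p + q" "p \<otimes>\<^bsub>F\<^esub> q = p * q" "c \<odot>\<^bsub>F\<^esub> p = smul c p" "\<zero>\<^bsub>F\<^esub> = 0" "\<one>\<^bsub>F\<^esub> = 1"
  by (simp_all add: free_algebra_def free_space_def)

definition gens :: "('e list \<Rightarrow>\<^sub>0 'k) set" where
  "gens = {single [x \<oplus>\<^bsub>E\<^esub> y] 1 - single [x] 1 - single [y] 1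
       |x y. x \<in> carrier E \<and> y \<in> carrier E} \<union>
     {single [c \<odot>\<^bsub>E\<^esub> x] 1 - single [x] c
       |c x. x \<in> carrier E}"

lemma tensor_ideal_gens: "tensor_ideal E = Idl\<^bsub>F\<^esub> gens"
  by (simp add: tensor_ideal_def gens_def)

lemma gens_closed: "gens \<subseteq> carrier F"
proof -
  have 1: "single w c \<in> {p. keys p \<subseteq> lists (carrier E)}"
    if "w \<in> lists (carrier E)" for w :: "'e list" and c :: 'k
    using that by simp
  show ?thesis
  proof
    fix p assume "p \<in> gens"
    then show "p \<in> carrier F" unfolding gens_def F_simps
      by (elim UnE CollectE exE conjE; hypsubst; intro pm.subspace_diff[OF keys_subspace] 1)
        (simp_all add: E.smult_closed)
  qed
qed

lemma ideal_tensor_ideal: "ideal (tensor_ideal E) F"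
  unfolding tensor_ideal_gens
  using ring.genideal_ideal[OF F.ring gens_closed] .

lemma gens_tensor_ideal: "gens \<subseteq> tensor_ideal E"
  unfolding tensor_ideal_gens using ring.genideal_self[OF F.ring gens_closed] .

text \<open>The kernel of \<open>phi\<close> is an ideal, and it contains the generators because
  \<open>lin\<close> is linear; minimality of the generated ideal gives the inclusion.\<close>

lemma phi_tensor_ideal:
  assumes "p \<in> tensor_ideal E" shows "phi p = 0"
proof -
  have "ideal {p \<in> carrier F. phi p = 0} F"
  proof (rule F.ideal_of_closed)
    fix x y assume "x \<in> {p \<in> carrier F. phi p = 0}" "y \<in> carrier F"
    then show "y \<otimes>\<^bsub>F\<^esub> x \<in> {p \<in> carrier F. phi p = 0}" "x \<otimes>\<^bsub>F\<^esub> y \<in> {p \<in> carrier F. phi p = 0}"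
      using F.mult_closed[of x y] F.mult_closed[of y x] by (simp_all add: phi_mult)
  next
    fix x y assume "x \<in> {p \<in> carrier F. phi p = 0}" "y \<in> {p \<in> carrier F. phi p = 0}"
    then show "x \<oplus>\<^bsub>F\<^esub> y \<in> {p \<in> carrier F. phi p = 0}"
      using F.add_closed[of x y] by (simp add: pmp.linear_add[OF plinear_phi])
  qed (use pmp.linear_0[OF plinear_phi] in auto)
  moreover have "gens \<subseteq> {p \<in> carrier F. phi p = 0}"
  proof -
    have "phi p = 0" if "p \<in> gens" for p
      using that unfolding gens_def
      by (auto simp: pmp.linear_diff[OF plinear_phi] lin_add lin_smult)
    then show ?thesis using gens_closed by blast
  qed
  ultimately show ?thesis
    using ring.genideal_minimal[OF F.ring] assms unfolding tensor_ideal_gens by blast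
qed

lemma tensor_ideal_closed:
  shows "0 \<in> tensor_ideal E"
    and "p \<in> tensor_ideal E \<Longrightarrow> q \<in> tensor_ideal E \<Longrightarrow> p + q \<in> tensor_ideal E"
    and "p \<in> tensor_ideal E \<Longrightarrow> smul c p \<in> tensor_ideal E"
    and "p \<in> tensor_ideal E \<Longrightarrow> q \<in> carrier F \<Longrightarrow> q * p \<in> tensor_ideal E"
    and "p \<in> tensor_ideal E \<Longrightarrow> q \<in> carrier F \<Longrightarrow> p * q \<in> tensor_ideal E"
proof -
  interpret I: ideal "tensor_ideal E" F by (rule ideal_tensor_ideal)
  show "0 \<in> tensor_ideal E"
    using additive_subgroup.zero_closed[OF ideal.axioms(1)[OF ideal_tensor_ideal]] by simp
  show "p \<in> tensor_ideal E \<Longrightarrow> q \<in> tensor_ideal E \<Longrightarrow> p + q \<in> tensor_ideal E"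
    using additive_subgroup.a_closed[OF ideal.axioms(1)[OF ideal_tensor_ideal], of p q] by simp
  show "p \<in> tensor_ideal E \<Longrightarrow> smul c p \<in> tensor_ideal E"
    using F.ideal_smult_closed[OF ideal_tensor_ideal, of p c] by simp
  show "p \<in> tensor_ideal E \<Longrightarrow> q \<in> carrier F \<Longrightarrow> q * p \<in> tensor_ideal E"
    "p \<in> tensor_ideal E \<Longrightarrow> q \<in> carrier F \<Longrightarrow> p * q \<in> tensor_ideal E"
    using I.I_l_closed[of p q] I.I_r_closed[of p q] by simp_all
qed

lemma expansion_closed: "x \<in> carrier E \<Longrightarrow> S \<subseteq> B \<Longrightarrow> (\<lambda>b. crd x b \<odot>\<^bsub>E\<^esub> bas b) \<in> S \<rightarrow> carrier E"
  using bas_closed E.smult_closed by auto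

lemma expansion:
  assumes x: "x \<in> carrier E"
  shows "x = finsum E (\<lambda>b. crd x b \<odot>\<^bsub>E\<^esub> bas b) B"
proof -
  let ?g = "\<lambda>b. crd x b \<odot>\<^bsub>E\<^esub> bas b"
  have g: "?g \<in> S \<rightarrow> carrier E" if "S \<subseteq> B" for S using expansion_closed[OF x that] .
  have crd_sum: "crd (finsum E ?g S) b = (\<Sum>b'\<in>S. if b' = b then crd x b else 0)"
    if "finite S" "S \<subseteq> B" "b \<in> B" for S b
    using that
  proof (induction S)
    case empty
    \<comment> \<open>The zero vector is written as 0 times itself so that homogeneity, the only
      relevant assumption on \<open>crd\<close>, evaluates its coordinates.\<close>
    have "crd (0 \<odot>\<^bsub>E\<^esub> \<zero>\<^bsub>E\<^esub>) b = 0" using empty by (subst crd_smult) auto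
    then show ?case by simp
  next
    case (insert c S)
    have "finsum E ?g (insert c S) = ?g c \<oplus>\<^bsub>E\<^esub> finsum E ?g S"
      using insert g[of "insert c S"] by (intro E.finsum_insert) auto
    then show ?case
      using insert g[of S] bas_closed[of c]
      by (auto simp add: crd_add crd_smult crd_bas E.finsum_closed E.smult_closed)
  qed
  show ?thesis
  proof (rule crd_eq)
    show "finsum E ?g B \<in> carrier E" by (rule E.finsum_closed) (rule g, simp)
    show "crd x b = crd (finsum E ?g B) b" if "b \<in> B" for b
      using crd_sum[OF finite_B order_refl that] that finite_B by simp
  qed (rule x)
qed

text \<open>Modulo the linearity relations a letter equals its expansion in basis letters. The
  induction adds one basis vector at a time and spends one additivity relation and one scaling
  relation on it.\<close>

lemma sec_lin: "x \<in> carrier E \<Longrightarrow> single [x] 1 - sec (lin x) \<in> tensor_ideal E"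
proof -
  assume x: "x \<in> carrier E"
  let ?g = "\<lambda>b. crd x b \<odot>\<^bsub>E\<^esub> bas b"
  note x_eq = expansion[OF x] and g = expansion_closed[OF x]
  have "single [finsum E ?g S] 1 - (\<Sum>b\<in>S. single [bas b] (crd x b))
      \<in> tensor_ideal E" if "finite S" "S \<subseteq> B" for S
    using that
  proof (induction S)
    case empty
    have "\<zero>\<^bsub>E\<^esub> \<in> carrier E" by simp
    then have "single [0 \<odot>\<^bsub>E\<^esub> \<zero>\<^bsub>E\<^esub>] 1 - single [\<zero>\<^bsub>E\<^esub>] (0::'k) \<in> gens"
      unfolding gens_def by blast
    then show ?case using gens_tensor_ideal by auto
  next
    case (insert c S)
    have eq: "finsum E ?g (insert c S) = ?g c \<oplus>\<^bsub>E\<^esub> finsum E ?g S"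
      using insert g[of "insert c S"] by (intro E.finsum_insert) auto
    have c: "bas c \<in> carrier E" "?g c \<in> carrier E" "finsum E ?g S \<in> carrier E"
      using insert g[of "insert c S"] bas_closed by (auto intro!: E.finsum_closed)
    have 1: "single [finsum E ?g (insert c S)] 1 - single [?g c] 1
      - single [finsum E ?g S] (1::'k) \<in> tensor_ideal E"
      unfolding eq using c gens_tensor_ideal unfolding gens_def by blast
    have 2: "single [?g c] 1 - single [bas c] (crd x c) \<in> tensor_ideal E"
      using c gens_tensor_ideal unfolding gens_def by blast
    have "single [finsum E ?g (insert c S)] 1 - (\<Sum>b\<in>insert c S. single [bas b] (crd x b))
      = (single [finsum E ?g (insert c S)] 1 - single [?g c] 1
      - single [finsum E ?g S] (1::'k))
      + (single [?g c] 1 - single [bas c] (crd x c))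
      + (single [finsum E ?g S] 1 - (\<Sum>b\<in>S. single [bas b] (crd x b)))"
      using insert by simp
    also have "\<dots> \<in> tensor_ideal E" using insert 1 2 by (intro tensor_ideal_closed) auto
    finally show ?case .
  qed
  from this[OF finite_B order_refl] show ?thesis
    unfolding x_eq[symmetric] by (simp add: lin_def pmp.linear_sum[OF plinear_sec])
qed

lemma sec_closed:
  assumes "keys p \<subseteq> lists B" shows "sec p \<in> carrier F"
  using assms
proof (induction rule: keys_span_induct)
  case (single w c)
  then show ?case using bas_closed by (auto split: if_splits)
next
  case (add p q)
  then show ?case using F.add_closed[of "sec p" "sec q"] by (simp add: pmp.linear_add[OF plinear_sec])
qed

lemma phi_lists: "keys (phi p) \<subseteq> lists B"
proof -
  have "keys p \<subseteq> UNIV" by simp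
  then show ?thesis
  proof (induction rule: keys_span_induct)
    case (single w c)
    then show ?case using keys_smul[of c "word w"] homog_lists[OF word_homog[of w]] by simp
  next
    case (add p q)
    then show ?case using keys_add[of "phi p" "phi q"] by (simp add: pmp.linear_add[OF plinear_phi]) blast
  qed
qed

text \<open>Replacing every letter by its expansion changes p only within the ideal. So an element
  killed by \<open>phi\<close> lies in the ideal, the converse of
  \<open>phi_tensor_ideal\<close>.\<close>

lemma sec_phi:
  assumes "p \<in> carrier F" shows "p - sec (phi p) \<in> tensor_ideal E"
proof -
  have word: "single w 1 - sec (word w) \<in> tensor_ideal E" if "w \<in> lists (carrier E)" for w
    using that
  proof (induction w)
    case Nil
    then show ?case using tensor_ideal_closed(1) sec_single[of "[]" 1]
      by (simp add: zero_list_def flip: single_one)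
  next
    case (Cons x w)
    let ?x = "single [x] (1::'k)" and ?w = "single w (1::'k)"
    \<comment> \<open>The splitting x w - x' w' = (x - x') w + x' (w - w'), whose summands are
      covered by \<open>sec_lin\<close> and by the induction hypothesis.\<close>
    have "single (x # w) 1 - sec (word (x # w)) =
      (?x - sec (lin x)) * ?w + sec (lin x) * (?w - sec (word w))"
      by (simp add: sec_mult left_diff_distrib right_diff_distrib single_mult_list)
    also have "\<dots> \<in> tensor_ideal E"
      using Cons sec_lin[of x] sec_closed[OF homog_lists[OF lin_homog[of x]]]
      by (intro tensor_ideal_closed(2,4,5)) auto
    finally show ?case .
  qed
  have "keys p \<subseteq> lists (carrier E)" using assms by simp
  then show ?thesis
  proof (induction rule: keys_span_induct)
    case (single w c)
    show ?case
    proof (cases "c = 0")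
      case True
      then show ?thesis
        using tensor_ideal_closed(1) by (simp add: pmp.linear_0[OF plinear_sec] pmp.linear_0[OF plinear_phi])
    next
      case False
      then have "smul c (single w 1 - sec (word w)) \<in> tensor_ideal E"
        using single word by (intro tensor_ideal_closed(3)) auto
      then show ?thesis by (simp add: pm.scale_right_diff_distrib pmp.linear_scale[OF plinear_sec])
    qed
  next
    case (add p q)
    have eq: "p + q - sec (phi (p + q)) = (p - sec (phi p)) + (q - sec (phi q))"
      by (simp add: pmp.linear_add[OF plinear_sec] pmp.linear_add[OF plinear_phi])
    show ?case unfolding eq by (rule tensor_ideal_closed(2)[OF add.IH])
  qed
qed

lemma quotient_map_tensor: "quotient_map F id (tensor_ideal E) phi"
proof
  show "tensor_ideal E \<subseteq> carrier F"
    using ideal_tensor_ideal by (meson additive_subgroup.a_subset ideal.axioms(1))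
  show "phi x = 0 \<longleftrightarrow> x \<in> tensor_ideal E" if "x \<in> carrier F" for x
    using phi_tensor_ideal[of x] sec_phi[OF that] by (auto simp: pmp.linear_0[OF plinear_sec])
qed (simp_all add: pmp.linear_add[OF plinear_phi] pmp.linear_scale[OF plinear_phi])

sublocale TQ: quotient_map F id "tensor_ideal E" phi
  by (rule quotient_map_tensor)

abbreviation "T \<equiv> tensor_algebra E"

definition Phi :: "('e list \<Rightarrow>\<^sub>0 'k) set \<Rightarrow> ('i list \<Rightarrow>\<^sub>0 'k)" where
  "Phi = induced phi"

sublocale T: alg_embedding T Phi
  unfolding Phi_def tensor_algebra_def
  by (rule alg_embedding_quot[OF quotient_map_tensor ideal_tensor_ideal])
    (use F.mult_closed F.one_closed in \<open>simp_all add: phi_mult\<close>)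

lemma phi_sec: "keys p \<subseteq> lists B \<Longrightarrow> phi (sec p) = p"
  using plinear_eq_on_singles[OF plinear_compose[OF plinear_sec plinear_phi] pm.linear_ident, of "lists B" p]
  by (simp add: word_bas)

lemma Phi_image: "Phi ` carrier T = {p. keys p \<subseteq> lists B}"
proof -
  have "Phi ` carrier T = phi ` carrier F"
    unfolding Phi_def tensor_algebra_def by (rule TQ.image_quot)
  also have "\<dots> = {p. keys p \<subseteq> lists B}"
    using phi_lists phi_sec sec_closed by (auto simp: image_iff simp del: F_simps) metis
  finally show ?thesis .
qed

lemma Phi_coset: "p \<in> carrier F \<Longrightarrow> Phi (tensor_ideal E +>\<^bsub>F\<^esub> p) = phi p"
  unfolding Phi_def by (rule TQ.induced_coset)

lemma carrier_T: "carrier T = (\<lambda>p. tensor_ideal E +>\<^bsub>F\<^esub> p) ` carrier F"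
  unfolding tensor_algebra_def by (rule TQ.carrier_quot)

text \<open>Coordinates may be computed from any representative. This is what
  \<open>annihilator\<close> calls for, since it quantifies over representatives of tensors.\<close>

lemma Phi_mem: "t \<in> carrier T \<Longrightarrow> p \<in> t \<Longrightarrow> Phi t = phi p"
proof -
  assume "t \<in> carrier T" "p \<in> t"
  then obtain q where q: "q \<in> carrier F" "t = tensor_ideal E +>\<^bsub>F\<^esub> q" "p \<in> tensor_ideal E +>\<^bsub>F\<^esub> q"
    unfolding carrier_T by blast
  then show ?thesis using TQ.coset_eq[OF q(1)] Phi_coset[OF q(1)] by simp
qed

lemma T_nonempty: "t \<in> carrier T \<Longrightarrow> \<exists>p. p \<in> t \<and> p \<in> carrier F"
  by (auto simp: carrier_T TQ.coset_eq simp del: F_simps)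

lemma tensor_word_closed: "xs \<in> lists (carrier E) \<Longrightarrow> tensor_word E xs \<in> carrier T"
  unfolding tensor_word_def carrier_T by (rule imageI) simp

lemma Phi_tensor_word: "xs \<in> lists (carrier E) \<Longrightarrow> Phi (tensor_word E xs) = word xs"
  unfolding tensor_word_def by (subst Phi_coset) simp_all

lemma tensor_power_closed: "tensor_power E n \<subseteq> carrier T"
  unfolding tensor_power_def using tensor_word_closed by (intro T.vspan_closed) auto

lemma Phi_tensor_power: "Phi ` tensor_power E n = homog B n"
proof -
  let ?W = "{tensor_word E xs |xs. xs \<in> lists (carrier E) \<and> length xs = n}"
  have W: "?W \<subseteq> carrier T" using tensor_word_closed by auto
  have "Phi ` tensor_power E n = pm.span (Phi ` ?W)"
    unfolding tensor_power_def by (rule T.image_vspan[OF W])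
  also have "\<dots> = homog B n"
  proof
    show "pm.span (Phi ` ?W) \<subseteq> homog B n"
    proof (rule pm.span_minimal[OF _ subspace_homog], intro subsetI)
      fix p assume "p \<in> Phi ` ?W"
      then obtain xs where "xs \<in> lists (carrier E)" "length xs = n" "p = Phi (tensor_word E xs)" by blast
      then show "p \<in> homog B n" using word_homog[of xs] Phi_tensor_word[of xs] by simp
    qed
    have "single w 1 \<in> Phi ` ?W" if "w \<in> words B n" for w
    proof -
      have "map bas w \<in> lists (carrier E)" "length (map bas w) = n"
        using that bas_closed by (auto simp: words_def)
      then have "tensor_word E (map bas w) \<in> ?W" "single w 1 = Phi (tensor_word E (map bas w))"
        using that Phi_tensor_word[of "map bas w"] word_bas[of w] by (blast, simp add: words_def)
      then show ?thesis by (simp only: imageI)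
    qed
    then have "pm.span ((\<lambda>w. single w 1) ` words B n) \<subseteq> pm.span (Phi ` ?W)"
      by (intro pm.span_mono) auto
    then show "homog B n \<subseteq> pm.span (Phi ` ?W)" by (simp add: homog_def span_singles)
  qed
  finally show ?thesis .
qed

end

subsection \<open>The relation ideal and the quotient algebra\<close>

definition two_sided :: "'i set \<Rightarrow> ('i list \<Rightarrow>\<^sub>0 'k::field) set \<Rightarrow> ('i list \<Rightarrow>\<^sub>0 'k) set" where
  "two_sided B S = pm.span {single u 1 * r * single v 1 |u r v.
     u \<in> lists B \<and> r \<in> S \<and> v \<in> lists B}"

definition two_sided_deg ::
  "'i set \<Rightarrow> nat \<Rightarrow> ('i list \<Rightarrow>\<^sub>0 'k::field) set \<Rightarrow> nat \<Rightarrow> ('i list \<Rightarrow>\<^sub>0 'k) set" where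
  "two_sided_deg B N S n = pm.span {single u 1 * r * single v 1 |u r v.
     u \<in> lists B \<and> r \<in> S \<and> v \<in> lists B \<and> length u + N + length v = n}"

lemma single_homog: "w \<in> lists B \<Longrightarrow> single w c \<in> homog B (length w)"
  by (simp add: homog_def words_def)

lemma sandwich_homog:
  assumes "u \<in> lists B" "r \<in> homog B N" "v \<in> lists B"
  shows "single u 1 * r * single v 1 \<in> homog B (length u + N + length v)"
  using assms by (intro homog_mult single_homog)

lemma two_sided_deg_homog:
  assumes "S \<subseteq> homog B N" shows "two_sided_deg B N S n \<subseteq> homog B n"
  unfolding two_sided_deg_def
proof (rule pm.span_minimal[OF _ subspace_homog], intro subsetI)
  fix p assume "p \<in> {single u 1 * r * single v 1 |u r v.
     u \<in> lists B \<and> r \<in> S \<and> v \<in> lists B \<and> length u + N + length v = n}"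
  then obtain u r v where *: "p = single u 1 * r * single v 1"
    "u \<in> lists B" "r \<in> S" "v \<in> lists B" "length u + N + length v = n" by blast
  show "p \<in> homog B n"
    using sandwich_homog[of u B r N v] * assms by blast
qed

definition deg_part :: "nat \<Rightarrow> ('i list \<Rightarrow>\<^sub>0 'k::field) \<Rightarrow> ('i list \<Rightarrow>\<^sub>0 'k)" where
  "deg_part n = lin_ext (\<lambda>w. if length w = n then single w 1 else 0)"

lemma plinear_deg_part: "plinear (deg_part n)"
  unfolding deg_part_def by (rule plinear_lin_ext)

lemma deg_part_homog:
  assumes "p \<in> homog B m" shows "deg_part n p = (if m = n then p else 0)"
proof -
  have keys: "keys p \<subseteq> words B m" using assms by (simp add: homog_def)
  show ?thesis
  proof (cases "m = n")
    case True
    have "deg_part n p = p"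
      by (rule plinear_eq_on_singles[OF plinear_deg_part pm.linear_ident _ keys])
        (simp add: deg_part_def words_def True)
    then show ?thesis using True by simp
  next
    case False
    have "deg_part n p = 0"
      by (rule plinear_eq_on_singles[OF plinear_deg_part pmp.linear_zero _ keys])
        (use False in \<open>simp add: deg_part_def words_def\<close>)
    then show ?thesis using False by simp
  qed
qed

text \<open>The spanning products u r v are homogeneous, so \<open>deg_part n\<close> keeps those of
  degree n and kills the rest. Applied to an element that already has degree n, it leaves a
  combination of products of degree n alone.\<close>

lemma two_sided_Int_homog:
  assumes "S \<subseteq> homog B N"
  shows "two_sided B S \<inter> homog B n = two_sided_deg B N S n"
proof
  have "two_sided_deg B N S n \<subseteq> two_sided B S"
    unfolding two_sided_def two_sided_deg_def by (rule pm.span_mono) blast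
  then show "two_sided_deg B N S n \<subseteq> two_sided B S \<inter> homog B n"
    using two_sided_deg_homog[OF assms] by blast
  have *: "two_sided B S \<subseteq> {p. deg_part n p \<in> two_sided_deg B N S n}"
    unfolding two_sided_def
  proof (rule pm.span_minimal, intro subsetI)
    show "pm.subspace {p. deg_part n p \<in> two_sided_deg B N S n}"
      unfolding two_sided_deg_def
      by (rule pmp.linear_subspace_linear_preimage[OF plinear_deg_part pm.subspace_span])
    fix p assume "p \<in> {single u 1 * r * single v 1 |u r v.
     u \<in> lists B \<and> r \<in> S \<and> v \<in> lists B}"
    then obtain u r v where p: "p = single u 1 * r * single v 1"
      "u \<in> lists B" "r \<in> S" "v \<in> lists B" by blast
    have "deg_part n p = (if length u + N + length v = n then p else 0)"
      using sandwich_homog[of u B r N v] p assms by (intro deg_part_homog) blast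
    moreover have "p \<in> two_sided_deg B N S n" if "length u + N + length v = n"
      unfolding two_sided_deg_def using p that by (intro pm.span_base) blast
    ultimately show "p \<in> {p. deg_part n p \<in> two_sided_deg B N S n}"
      unfolding two_sided_deg_def using pm.span_zero by (simp split: if_splits)
  qed
  show "two_sided B S \<inter> homog B n \<subseteq> two_sided_deg B N S n"
  proof
    fix p assume p: "p \<in> two_sided B S \<inter> homog B n"
    then have "deg_part n p = p" using deg_part_homog[of p B n n] by simp
    then show "p \<in> two_sided_deg B N S n" using p * by auto
  qed
qed

lemma plinear_mult_left: "plinear (\<lambda>q. p * q :: 'x::monoid_add \<Rightarrow>\<^sub>0 'k::field)"
  and plinear_mult_right: "plinear (\<lambda>q. q * p :: 'x::monoid_add \<Rightarrow>\<^sub>0 'k::field)"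
  by (rule plinearI; simp add: distrib_left distrib_right)+

lemma subspace_two_sided: "pm.subspace (two_sided B S)"
  unfolding two_sided_def by (rule pm.subspace_span)

text \<open>A basis word multiplied from the left or right is absorbed by u or v; linearity in p
  covers the general factor.\<close>

lemma two_sided_ideal:
  assumes "q \<in> two_sided B S" "keys p \<subseteq> lists B"
  shows "p * q \<in> two_sided B S" "q * p \<in> two_sided B S"
proof -
  let ?G = "{single u 1 * r * single v 1 |u r v.
     u \<in> lists B \<and> r \<in> S \<and> v \<in> lists B} :: ('a list \<Rightarrow>\<^sub>0 'b) set"
  have left: "single w 1 * q \<in> two_sided B S" if w: "w \<in> lists B" for w
  proof -
    have "two_sided B S \<subseteq> {q. single w 1 * q \<in> two_sided B S}"
    proof (subst two_sided_def, rule pm.span_minimal, intro subsetI)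
      show "pm.subspace {q. single w 1 * q \<in> two_sided B S}"
        by (rule pmp.linear_subspace_linear_preimage[OF plinear_mult_left subspace_two_sided])
      fix q assume "q \<in> ?G"
      then obtain u r v where q: "q = single u 1 * r * single v 1"
        "u \<in> lists B" "r \<in> S" "v \<in> lists B" by blast
      then have "single w 1 * q = single (w @ u) 1 * r * single v 1"
        by (simp add: mult.assoc[symmetric] single_mult_list)
      moreover have "w @ u \<in> lists B" using w q by simp
      ultimately have "single w 1 * q \<in> ?G" using q by blast
      then have "single w 1 * q \<in> two_sided B S" unfolding two_sided_def by (rule pm.span_base)
      then show "q \<in> {q. single w 1 * q \<in> two_sided B S}" by simp
    qed
    then show ?thesis using assms by blast
  qed
  have right: "q * single w 1 \<in> two_sided B S" if w: "w \<in> lists B" for w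
  proof -
    have "two_sided B S \<subseteq> {q. q * single w 1 \<in> two_sided B S}"
    proof (subst two_sided_def, rule pm.span_minimal, intro subsetI)
      show "pm.subspace {q. q * single w 1 \<in> two_sided B S}"
        by (rule pmp.linear_subspace_linear_preimage[OF plinear_mult_right subspace_two_sided])
      fix q assume "q \<in> ?G"
      then obtain u r v where q: "q = single u 1 * r * single v 1"
        "u \<in> lists B" "r \<in> S" "v \<in> lists B" by blast
      then have "q * single w 1 = single u 1 * r * single (v @ w) 1"
        by (simp add: mult.assoc single_mult_list)
      moreover have "v @ w \<in> lists B" using w q by simp
      ultimately have "q * single w 1 \<in> ?G" using q by blast
      then have "q * single w 1 \<in> two_sided B S" unfolding two_sided_def by (rule pm.span_base)
      then show "q \<in> {q. q * single w 1 \<in> two_sided B S}" by simp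
    qed
    then show ?thesis using assms by blast
  qed
  have "p \<in> pm.span ((\<lambda>w. single w 1) ` lists B)" using assms(2) by (simp add: span_singles)
  moreover have "pm.span ((\<lambda>w. single w 1) ` lists B) \<subseteq> {p. p * q \<in> two_sided B S}"
    using left by (intro pm.span_minimal
        pmp.linear_subspace_linear_preimage[OF plinear_mult_right subspace_two_sided]) blast
  moreover have "pm.span ((\<lambda>w. single w 1) ` lists B) \<subseteq> {p. q * p \<in> two_sided B S}"
    using right by (intro pm.span_minimal
        pmp.linear_subspace_linear_preimage[OF plinear_mult_left subspace_two_sided]) blast
  ultimately show "p * q \<in> two_sided B S" "q * p \<in> two_sided B S" by blast+
qed

locale homogeneous_relations = coordinates E B crd bas
  for E :: "('k::field, 'e, 'm) module_scheme"
    and B :: "'i set" and crd :: "'e \<Rightarrow> 'i \<Rightarrow> 'k" and bas :: "'i \<Rightarrow> 'e" +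
  fixes N :: nat and R :: "('e list \<Rightarrow>\<^sub>0 'k) set set"
  assumes R_subspace: "VectorSpace.subspace class_ring R (tensor_algebra E)"
    and R_power: "R \<subseteq> tensor_power E N"
begin

definition rels :: "('i list \<Rightarrow>\<^sub>0 'k) set" where
  "rels = Phi ` R"

lemma R_closed: "R \<subseteq> carrier T"
  using R_power tensor_power_closed by blast

lemma subspace_rels: "pm.subspace rels"
  unfolding rels_def
  by (rule T.image_subspace_of_submodule[OF subspace.submod[OF R_subspace]])

lemma rels_homog: "rels \<subseteq> homog B N"
  unfolding rels_def using R_power Phi_tensor_power by blast

definition rel_ideal :: "('i list \<Rightarrow>\<^sub>0 'k) set" where
  "rel_ideal = two_sided B rels"

lemma subspace_rel_ideal: "pm.subspace rel_ideal"
  unfolding rel_ideal_def by (rule subspace_two_sided)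

lemma Phi_lists: "t \<in> carrier T \<Longrightarrow> keys (Phi t) \<subseteq> lists B"
  using Phi_image by blast

lemma ideal_relation_ideal: "ideal (relation_ideal E R) T"
  unfolding relation_ideal_def by (rule ring.genideal_ideal[OF T.ring R_closed])

lemma relation_ideal_closed: "relation_ideal E R \<subseteq> carrier T"
  using ideal_relation_ideal by (meson additive_subgroup.a_subset ideal.axioms(1))

text \<open>The generated ideal and the span of the products u r v are compared by minimality on
  both sides: the preimage of the span is an ideal containing R, and the image of the ideal is a
  subspace containing every u r v.\<close>

lemma relation_ideal_iff:
  assumes t: "t \<in> carrier T"
  shows "t \<in> relation_ideal E R \<longleftrightarrow> Phi t \<in> rel_ideal"
proof
  interpret I: ideal "relation_ideal E R" T by (rule ideal_relation_ideal)
  let ?K = "{t \<in> carrier T. Phi t \<in> rel_ideal}"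
  have "ideal ?K T"
  proof (rule T.ideal_of_closed)
    show "\<zero>\<^bsub>T\<^esub> \<in> ?K"
      using T.zero_closed pm.subspace_0[OF subspace_rel_ideal] by (simp add: T.f_zero)
    fix x y assume x: "x \<in> ?K"
    show "x \<oplus>\<^bsub>T\<^esub> y \<in> ?K" if "y \<in> ?K"
      using x that pm.subspace_add[OF subspace_rel_ideal] by (simp add: T.f_add T.add_closed)
    show "y \<otimes>\<^bsub>T\<^esub> x \<in> ?K" "x \<otimes>\<^bsub>T\<^esub> y \<in> ?K" if "y \<in> carrier T"
      using x that two_sided_ideal[OF _ Phi_lists[OF that], of "Phi x"] unfolding rel_ideal_def
      by (simp_all add: T.f_mult T.mult_closed)
  qed blast
  moreover have "R \<subseteq> ?K"
  proof
    fix r assume r: "r \<in> R"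
    have "Phi r \<in> rel_ideal"
      unfolding rel_ideal_def two_sided_def
    proof (rule pm.span_base, intro CollectI exI conjI)
      show "Phi r = single [] 1 * Phi r * single [] 1"
        by (metis mult.left_neutral mult.right_neutral single_one zero_list_def)
    qed (use r in \<open>auto simp: rels_def\<close>)
    then show "r \<in> ?K" using r R_closed by blast
  qed
  ultimately have "relation_ideal E R \<subseteq> ?K"
    unfolding relation_ideal_def by (rule ring.genideal_minimal[OF T.ring])
  then show "Phi t \<in> rel_ideal" if "t \<in> relation_ideal E R" using that by blast
  have sub: "pm.subspace (Phi ` relation_ideal E R)"
    by (rule T.image_subspace_of_submodule[OF T.ideal_submodule[OF ideal_relation_ideal]])
  have "rel_ideal \<subseteq> Phi ` relation_ideal E R"
    unfolding rel_ideal_def two_sided_def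
  proof (rule pm.span_minimal[OF _ sub], intro subsetI)
    fix p assume "p \<in> {single u 1 * r * single v 1 |u r v.
     u \<in> lists B \<and> r \<in> rels \<and> v \<in> lists B}"
    then obtain u r v where p: "p = single u 1 * r * single v 1"
      "u \<in> lists B" "r \<in> rels" "v \<in> lists B" by blast
    then have "single u 1 \<in> Phi ` carrier T" "single v 1 \<in> Phi ` carrier T"
      unfolding Phi_image by auto
    then obtain a b where ab: "a \<in> carrier T" "b \<in> carrier T"
      "single u 1 = Phi a" "single v 1 = Phi b" by blast
    obtain r' where r': "r' \<in> R" "r = Phi r'" using p unfolding rels_def by blast
    have "r' \<in> relation_ideal E R"
      unfolding relation_ideal_def using r' ring.genideal_self[OF T.ring R_closed] by blast
    then have "a \<otimes>\<^bsub>T\<^esub> r' \<otimes>\<^bsub>T\<^esub> b \<in> relation_ideal E R"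
      using ab by (intro I.I_r_closed I.I_l_closed)
    moreover have "p = Phi (a \<otimes>\<^bsub>T\<^esub> r' \<otimes>\<^bsub>T\<^esub> b)"
      using p ab r' R_closed by (auto simp: T.f_mult T.mult_closed subset_iff)
    ultimately show "p \<in> Phi ` relation_ideal E R" by blast
  qed
  then show "t \<in> relation_ideal E R" if "Phi t \<in> rel_ideal"
    using that inj_on_image_mem_iff[OF T.inj t relation_ideal_closed] by blast
qed

text \<open>An arbitrary linear choice of representatives modulo the ideal. It need not preserve
  degrees, so graded parts of A appear as images of \<open>homog B n\<close> under
  \<open>nf\<close>, not as subspaces of \<open>homog B n\<close>.\<close>

definition nf :: "('i list \<Rightarrow>\<^sub>0 'k) \<Rightarrow> ('i list \<Rightarrow>\<^sub>0 'k)" where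
  "nf = (SOME \<pi>. plinear \<pi> \<and> (\<forall>x. x - \<pi> x \<in> rel_ideal) \<and> (\<forall>x. \<pi> x = 0 \<longleftrightarrow> x \<in> rel_ideal))"

lemma nf_props: "plinear nf \<and> (\<forall>x. x - nf x \<in> rel_ideal) \<and> (\<forall>x. nf x = 0 \<longleftrightarrow> x \<in> rel_ideal)"
proof -
  have "\<exists>\<pi>. plinear \<pi> \<and> (\<forall>x. x - \<pi> x \<in> rel_ideal) \<and> (\<forall>x. \<pi> x = 0 \<longleftrightarrow> x \<in> rel_ideal)"
    by (rule ex_projection[OF subspace_rel_ideal]) blast
  then show ?thesis unfolding nf_def by (rule someI_ex)
qed

lemma plinear_nf: "plinear nf" and nf_diff: "x - nf x \<in> rel_ideal"
  and nf_eq_0: "nf x = 0 \<longleftrightarrow> x \<in> rel_ideal"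
  using nf_props by blast+

lemma nf_eq_iff: "nf x = nf y \<longleftrightarrow> x - y \<in> rel_ideal"
  using nf_eq_0[of "x - y"] by (simp add: pmp.linear_diff[OF plinear_nf])

text \<open>The substitute for multiplicativity of \<open>nf\<close>: x and \<open>nf x\<close>
  differ by an element of the ideal, and the ideal absorbs the factor y.\<close>

lemma nf_mult_nf:
  assumes "keys y \<subseteq> lists B" shows "nf (nf x * y) = nf (x * y)"
proof -
  have "(x - nf x) * y \<in> rel_ideal"
    using two_sided_ideal(2)[OF _ assms] nf_diff unfolding rel_ideal_def by blast
  then show ?thesis using nf_eq_iff[of "x * y" "nf x * y"] by (simp add: left_diff_distrib)
qed

abbreviation "A \<equiv> homogeneous_algebra E R"

definition alpha :: "('e list \<Rightarrow>\<^sub>0 'k) set set \<Rightarrow> ('i list \<Rightarrow>\<^sub>0 'k)" where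
  "alpha = induced (\<lambda>t. nf (Phi t))"

sublocale AQ: quotient_map T Phi "relation_ideal E R" "\<lambda>t. nf (Phi t)"
  by unfold_locales
    (simp_all add: relation_ideal_closed T.f_add T.f_smult pmp.linear_add[OF plinear_nf]
      pmp.linear_scale[OF plinear_nf] nf_eq_0 relation_ideal_iff)

sublocale A: embedding A alpha
  unfolding alpha_def homogeneous_algebra_def by (rule AQ.embedding_quot)

lemma carrier_A: "carrier A = algebra_proj E R ` carrier T"
  unfolding homogeneous_algebra_def algebra_proj_def[abs_def] by (rule AQ.carrier_quot)

lemma alpha_proj: "t \<in> carrier T \<Longrightarrow> alpha (algebra_proj E R t) = nf (Phi t)"
  unfolding alpha_def algebra_proj_def by (rule AQ.induced_coset)

lemma algebra_proj_closed: "t \<in> carrier T \<Longrightarrow> algebra_proj E R t \<in> carrier A"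
  unfolding carrier_A by (rule imageI)

lemma algebra_proj_mult:
  "s \<in> carrier T \<Longrightarrow> t \<in> carrier T \<Longrightarrow>
    algebra_proj E R s \<otimes>\<^bsub>A\<^esub> algebra_proj E R t = algebra_proj E R (s \<otimes>\<^bsub>T\<^esub> t)"
  unfolding homogeneous_algebra_def algebra_proj_def by (rule quot_mult[OF ideal_relation_ideal])

lemma A_mult:
  assumes a: "a \<in> carrier A" and t: "t \<in> carrier T"
  shows "a \<otimes>\<^bsub>A\<^esub> algebra_proj E R t \<in> carrier A"
    and "alpha (a \<otimes>\<^bsub>A\<^esub> algebra_proj E R t) = nf (alpha a * Phi t)"
proof -
  obtain s where s: "s \<in> carrier T" "a = algebra_proj E R s" using a unfolding carrier_A by blast
  show "a \<otimes>\<^bsub>A\<^esub> algebra_proj E R t \<in> carrier A"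
    using s t by (simp add: algebra_proj_mult algebra_proj_closed T.mult_closed)
  show "alpha (a \<otimes>\<^bsub>A\<^esub> algebra_proj E R t) = nf (alpha a * Phi t)"
    using s t nf_mult_nf[OF Phi_lists[OF t]]
    by (simp add: algebra_proj_mult alpha_proj T.mult_closed T.f_mult)
qed

lemma algebra_component_closed: "algebra_component E R n \<subseteq> carrier A"
  unfolding algebra_component_def carrier_A using tensor_power_closed by blast

lemma alpha_component: "alpha ` algebra_component E R n = nf ` homog B n"
proof -
  have "alpha ` algebra_component E R n = (\<lambda>t. nf (Phi t)) ` tensor_power E n"
    unfolding algebra_component_def image_image
    using tensor_power_closed by (intro image_cong refl alpha_proj) blast
  also have "\<dots> = nf ` homog B n" by (simp add: Phi_tensor_power[symmetric] image_image)
  finally show ?thesis .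
qed

lemma dim_component_eq_dim: "dim_component E R n = pm.dim (nf ` homog B n)"
proof -
  have sub: "pm.subspace (nf ` homog B n)"
    by (rule pmp.linear_subspace_image[OF plinear_nf subspace_homog])
  interpret C: embedding "A\<lparr>carrier := algebra_component E R n\<rparr>" alpha
    by (rule A.restrict_carrier[OF algebra_component_closed]) (simp add: alpha_component sub)
  show ?thesis
    using C.vdim_eq fdim_image[OF plinear_nf fdim_homog[OF finite_B]]
    by (simp add: dim_component_def alpha_component)
qed

text \<open>Rank and nullity of \<open>nf\<close> on the n-th tensor power, with the degree n part
  of the ideal as kernel. The additive form avoids truncated subtraction.\<close>

lemma dim_component_add:
  "dim_component E R n + pm.dim (two_sided_deg B N rels n) = pm.dim (homog B n :: ('i list \<Rightarrow>\<^sub>0 'k) set)"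
proof -
  have "{x \<in> homog B n. nf x = 0} = two_sided_deg B N rels n"
    using two_sided_Int_homog[OF rels_homog, of n] nf_eq_0 unfolding rel_ideal_def by blast
  then show ?thesis
    using rank_nullity[OF plinear_nf subspace_homog fdim_homog[OF finite_B], of n]
    by (simp add: dim_component_eq_dim)
qed

end

subsection \<open>The dot product\<close>

definition dot :: "('x \<Rightarrow>\<^sub>0 'k::field) \<Rightarrow> ('x \<Rightarrow>\<^sub>0 'k) \<Rightarrow> 'k" where
  "dot p q = (\<Sum>w\<in>keys p. lookup p w * lookup q w)"

lemma dot_superset:
  assumes "finite S" "keys p \<subseteq> S"
  shows "dot p q = (\<Sum>w\<in>S. lookup p w * lookup q w)"
  unfolding dot_def using assms by (intro sum.mono_neutral_left) (auto simp: in_keys_iff)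

lemma dot_commute: "dot p q = dot q p"
proof -
  let ?S = "keys p \<union> keys q"
  show ?thesis
    by (subst (1 2) dot_superset[of ?S]) (simp_all add: mult.commute)
qed

lemma dot_add_right: "dot p (q + r) = dot p q + dot p r"
  by (simp add: dot_def lookup_add distrib_left sum.distrib)

lemma dot_smul_right [simp]: "dot p (smul c q) = c * dot p q"
  by (simp add: dot_def sum_distrib_left mult_ac)

lemma dot_zero_right [simp]: "dot p 0 = 0"
  by (simp add: dot_def)

lemma dot_sum_right: "dot p (sum f S) = (\<Sum>i\<in>S. dot p (f i))"
  by (induction S rule: infinite_finite_induct) (simp_all add: dot_add_right)

lemma dot_add_left: "dot (p + q) r = dot p r + dot q r"
  by (simp add: dot_commute[of _ r] dot_add_right)

lemma dot_smul_left [simp]: "dot (smul c p) q = c * dot p q"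
  by (simp add: dot_commute[of _ q])

lemma dot_zero_left [simp]: "dot 0 p = 0"
  by (simp add: dot_def)

lemma dot_sum_left: "dot (sum f S) p = (\<Sum>i\<in>S. dot (f i) p)"
  by (simp add: dot_commute[of _ p] dot_sum_right)

lemma dot_single_left: "dot (single w c) p = c * lookup p w"
  by (simp add: dot_superset[of "{w}"])

lemma subspace_dot_left: "pm.subspace {p. dot p q = 0}"
  by (auto simp: pm.subspace_def dot_add_left)

lemma dim_keys:
  assumes "finite Y" shows "pm.dim {p :: 'x \<Rightarrow>\<^sub>0 'k::field. keys p \<subseteq> Y} = card Y"
proof -
  let ?s = "\<lambda>w. single w (1::'k)"
  have inj: "inj_on ?s Y" by (auto simp: inj_on_def dest: arg_cong[of _ _ "\<lambda>p. keys p"])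
  have "pm.independent (?s ` Y)"
  proof (rule pm.independent_if_scalars_zero)
    show "finite (?s ` Y)" using assms by simp
    fix f :: "('x \<Rightarrow>\<^sub>0 'k) \<Rightarrow> 'k" and p
    assume sum: "(\<Sum>p\<in>?s ` Y. smul (f p) p) = 0" and "p \<in> ?s ` Y"
    then obtain y where y: "y \<in> Y" "p = ?s y" by blast
    have "(\<Sum>w\<in>Y. single w (f (?s w))) = 0"
      using sum by (simp add: sum.reindex[OF inj] o_def)
    then have "lookup (\<Sum>w\<in>Y. single w (f (?s w))) y = 0" by simp
    then show "f p = 0" using y assms by (simp add: lookup_sum lookup_single when_def)
  qed
  then have "pm.dim (pm.span (?s ` Y)) = card (?s ` Y)" by (rule pm.dim_span_eq_card_independent)
  then show ?thesis by (simp add: span_singles card_image[OF inj])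
qed

text \<open>Over a general field the form \<open>dot\<close> has no positivity, so X and
  \<open>perp Y X\<close> may intersect; they are complementary in dimension, see
  \<open>dim_perp\<close>.\<close>

definition perp :: "'x set \<Rightarrow> ('x \<Rightarrow>\<^sub>0 'k::field) set \<Rightarrow> ('x \<Rightarrow>\<^sub>0 'k) set" where
  "perp Y X = {q. keys q \<subseteq> Y \<and> (\<forall>p\<in>X. dot p q = 0)}"

lemma subspace_perp: "pm.subspace (perp Y X)"
proof -
  have "perp Y X = {q. keys q \<subseteq> Y} \<inter> (\<Inter>p\<in>X. {q. dot q p = 0})"
    by (auto simp: perp_def dot_commute)
  moreover have "pm.subspace (\<Inter>p\<in>X. {q. dot q p = 0})"
    by (intro pm.subspace_Int subspace_dot_left)
  ultimately show ?thesis using pm.subspace_inter[OF keys_subspace] by metis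
qed

lemma perp_span: "perp Y (pm.span X) = perp Y X"
proof
  show "perp Y (pm.span X) \<subseteq> perp Y X" using pm.span_base unfolding perp_def by blast
  show "perp Y X \<subseteq> perp Y (pm.span X)"
  proof
    fix q assume q: "q \<in> perp Y X"
    have "pm.span X \<subseteq> {p. dot p q = 0}"
      using q by (intro pm.span_minimal subspace_dot_left) (auto simp: perp_def)
    then show "q \<in> perp Y (pm.span X)" using q by (auto simp: perp_def)
  qed
qed

text \<open>A projection with kernel X is nonzero at y, hence has a nonzero coordinate w there. That
  coordinate is a linear functional vanishing on X, and q is the vector representing it on the
  functions supported in the finite set Y.\<close>

lemma ex_separating:
  assumes X: "pm.subspace X" and Y: "finite Y" and y: "keys y \<subseteq> Y" "y \<notin> X"
    and XY: "\<And>p. p \<in> X \<Longrightarrow> keys p \<subseteq> Y"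
  shows "\<exists>q\<in>perp Y X. dot y q \<noteq> (0::'k::field)"
proof (rule ex_projection[OF X])
  fix \<pi> assume \<pi>: "plinear \<pi>" "\<And>x. \<pi> x = 0 \<longleftrightarrow> x \<in> X"
  have "\<pi> y \<noteq> 0" using \<pi>(2) y by simp
  then obtain w where w: "lookup (\<pi> y) w \<noteq> 0" by (metis lookup_zero poly_mapping_eqI)
  define q where "q = (\<Sum>v\<in>Y. single v (lookup (\<pi> (single v 1)) w))"
  have q: "keys q \<subseteq> Y"
    unfolding q_def by (rule keys_sum_subset) auto
  have lookup_q: "lookup q v = lookup (\<pi> (single v 1)) w" if "v \<in> Y" for v
    unfolding q_def using that Y by (simp add: lookup_sum lookup_single when_def)
  have dot_q: "dot p q = lookup (\<pi> p) w" if p: "keys p \<subseteq> Y" for p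
  proof -
    have "\<pi> p = \<pi> (\<Sum>v\<in>Y. smul (lookup p v) (single v 1))"
      using poly_mapping_decomp[OF Y p] by simp
    also have "\<dots> = (\<Sum>v\<in>Y. smul (lookup p v) (\<pi> (single v 1)))"
      by (simp only: pmp.linear_sum[OF \<pi>(1)] pmp.linear_scale[OF \<pi>(1)])
    finally show ?thesis using dot_superset[OF Y p, of q] by (simp add: lookup_sum lookup_q)
  qed
  have "dot p q = 0" if "p \<in> X" for p using dot_q[OF XY[OF that]] \<pi>(2)[of p] that by simp
  then have "q \<in> perp Y X" using q by (simp add: perp_def)
  then show ?thesis using dot_q[OF y(1)] w by (intro bexI[of _ q]) simp_all
qed

lemma perp_perp:
  assumes "pm.subspace X" "finite Y" "X \<subseteq> {p. keys p \<subseteq> Y}"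
  shows "perp Y (perp Y X) = X"
proof
  show "X \<subseteq> perp Y (perp Y X)" using assms(3) by (auto simp: perp_def dot_commute)
  show "perp Y (perp Y X) \<subseteq> X"
  proof (rule subsetI, rule ccontr)
    fix y assume y: "y \<in> perp Y (perp Y X)" "y \<notin> X"
    then have "\<exists>q\<in>perp Y X. dot y q \<noteq> 0"
      using assms by (intro ex_separating) (auto simp: perp_def)
    then show False using y(1) by (auto simp: perp_def dot_commute)
  qed
qed

text \<open>Pairing with the members of a basis \<open>Bx\<close> of X defines a linear map L into
  the functions on \<open>Bx\<close>, with kernel \<open>perp Y X\<close>. It is onto: a vector
  separating b from the span of the other basis vectors is, after scaling, a preimage of the basis
  function at b.\<close>

lemma dim_perp:
  assumes X: "pm.subspace X" and Y: "finite Y" and XY: "X \<subseteq> {p :: 'x \<Rightarrow>\<^sub>0 'k::field. keys p \<subseteq> Y}"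
  shows "pm.dim X + pm.dim (perp Y X) = pm.dim {p :: 'x \<Rightarrow>\<^sub>0 'k. keys p \<subseteq> Y}"
proof -
  let ?V = "{p :: 'x \<Rightarrow>\<^sub>0 'k. keys p \<subseteq> Y}"
  obtain Bx where Bx: "Bx \<subseteq> X" "pm.independent Bx" "X \<subseteq> pm.span Bx" "card Bx = pm.dim X"
    using pm.basis_exists by blast
  have fin: "finite Bx" using fdim_independent_finite[OF fdim_keys[OF Y]] Bx XY by blast
  define L :: "('x \<Rightarrow>\<^sub>0 'k) \<Rightarrow> (('x \<Rightarrow>\<^sub>0 'k) \<Rightarrow>\<^sub>0 'k)" where
    "L q = (\<Sum>b\<in>Bx. single b (dot b q))" for q
  have L: "plinear L"
    by (rule plinearI) (simp_all add: L_def dot_add_right single_add sum.distrib pm.scale_sum_right)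
  have lookup_L: "lookup (L q) b = dot b q" if "b \<in> Bx" for b q
    unfolding L_def using that fin by (simp add: lookup_sum lookup_single when_def)
  have "{q \<in> ?V. L q = 0} = perp Y Bx"
  proof (intro equalityI subsetI)
    fix q assume "q \<in> {q \<in> ?V. L q = 0}"
    then show "q \<in> perp Y Bx" using lookup_L[of _ q] by (auto simp: perp_def)
  next
    fix q assume "q \<in> perp Y Bx"
    then show "q \<in> {q \<in> ?V. L q = 0}" by (simp add: perp_def L_def)
  qed
  also have "\<dots> = perp Y X"
    using perp_span[of Y Bx] pm.span_subspace[OF Bx(1,3) X] by simp
  finally have ker: "{q \<in> ?V. L q = 0} = perp Y X" .
  have "L ` ?V = {r. keys r \<subseteq> Bx}"
  proof
    show "L ` ?V \<subseteq> {r. keys r \<subseteq> Bx}"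
    proof (rule image_subsetI, rule CollectI)
      show "keys (L q) \<subseteq> Bx" for q
        unfolding L_def by (rule keys_sum_subset) auto
    qed
    have "single b 1 \<in> L ` ?V" if b: "b \<in> Bx" for b
    proof -
      have nin: "b \<notin> pm.span (Bx - {b})" using Bx(2) b by (auto simp: pm.dependent_def)
      have span_keys: "keys p \<subseteq> Y" if "p \<in> pm.span (Bx - {b})" for p
        using pm.span_minimal[OF _ keys_subspace, of "Bx - {b}" Y] that Bx(1) XY by blast
      have "\<exists>q\<in>perp Y (pm.span (Bx - {b})). dot b q \<noteq> 0"
        using nin Y span_keys b Bx(1) XY by (intro ex_separating) auto
      then obtain q where "q \<in> perp Y (Bx - {b})" and q3: "dot b q \<noteq> 0"
        unfolding perp_span by blast
      then have q: "keys q \<subseteq> Y" "\<And>p. p \<in> Bx - {b} \<Longrightarrow> dot p q = 0"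
        by (simp_all add: perp_def)
      have "L (smul (1 / dot b q) q) = (\<Sum>b'\<in>Bx. if b' = b then single b 1 else 0)"
        unfolding L_def using q(2) q3 by (intro sum.cong refl) auto
      also have "\<dots> = single b 1" using b fin by simp
      finally show ?thesis using q(1) keys_smul[of "1 / dot b q" q] by (intro image_eqI[of _ _ "smul (1 / dot b q) q"]) auto
    qed
    then have "pm.span ((\<lambda>b. single b 1) ` Bx) \<subseteq> L ` ?V"
      by (intro pm.span_minimal pmp.linear_subspace_image[OF L keys_subspace]) blast
    then show "{r. keys r \<subseteq> Bx} \<subseteq> L ` ?V" by (simp add: span_singles)
  qed
  then have "pm.dim (L ` ?V) = pm.dim X" using dim_keys[OF fin] Bx(4) by simp
  then show ?thesis using rank_nullity[OF L keys_subspace fdim_keys[OF Y]] ker by simp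
qed

subsection \<open>Slices of homogeneous elements\<close>

definition slice :: "'i list \<Rightarrow> 'i list \<Rightarrow> ('i list \<Rightarrow>\<^sub>0 'k::field) \<Rightarrow> ('i list \<Rightarrow>\<^sub>0 'k)" where
  "slice u v = Poly_Mapping.map_key (\<lambda>w. u @ w @ v)"

lemma inj_sandwich: "inj (\<lambda>w. u @ w @ v)"
  by (simp add: inj_def)

lemma lookup_slice [simp]: "lookup (slice u v p) w = lookup p (u @ w @ v)"
  unfolding slice_def by (simp add: map_key.rep_eq[OF inj_sandwich])

lemma plinear_slice: "plinear (slice u v)"
  by (rule plinearI) (simp_all add: poly_mapping_eq_iff fun_eq_iff lookup_add)

lemma slice_homog:
  assumes "p \<in> homog B n" "length u + N + length v = n"
  shows "slice u v p \<in> homog B N"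
  unfolding homog_def
proof (intro CollectI subsetI)
  fix w assume "w \<in> keys (slice u v p)"
  then have "u @ w @ v \<in> keys p" by (simp add: in_keys_iff)
  then have "u @ w @ v \<in> words B n" using assms by (auto simp: homog_def)
  then show "w \<in> words B N" using assms by (auto simp: words_def)
qed

text \<open>Slicing is adjoint to multiplication by an outer prefix and suffix. This turns
  orthogonality to an ideal into a condition on slices.\<close>

lemma dot_sandwich:
  "dot (single u 1 * r * single v 1) q = dot r (slice u v q)"
proof -
  have "keys r \<subseteq> UNIV" by simp
  then show ?thesis
    by (induction rule: keys_span_induct)
      (simp_all add: single_mult_list dot_single_left distrib_left distrib_right dot_add_left)
qed

text \<open>Once the lengths of prefix and suffix are fixed, a word splits in only one way into
  prefix, middle and suffix.\<close>

lemma slice_sandwich: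
  assumes "length u = length u'" "length v = length v'"
  shows "slice u v (single u' 1 * r * single v' 1) =
    (if u = u' \<and> v = v' then r else 0)"
proof -
  have "keys r \<subseteq> UNIV" by simp
  then show ?thesis
  proof (induction rule: keys_span_induct)
    case (single w c)
    show ?case using assms
      by (intro poly_mapping_eqI) (auto simp: single_mult_list lookup_single when_def)
  next
    case (add p q)
    then show ?case
      by (simp add: distrib_left distrib_right pmp.linear_add[OF plinear_slice] split: if_splits)
  qed
qed

text \<open>By linearity p may be taken to be a single word. The only summand that survives is the
  one whose u and v are the first r and the last s letters of that word.\<close>

lemma slice_decomp:
  fixes p :: "'i list \<Rightarrow>\<^sub>0 'k::field"
  assumes p: "p \<in> homog B (r + N + s)" and B: "finite B"
  shows "p = (\<Sum>u\<in>words B r. \<Sum>v\<in>words B s.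
    single u 1 * slice u v p * single v 1)" (is "_ = ?f p")
proof -
  have lin: "plinear ?f"
    by (rule plinearI)
      (simp_all add: pmp.linear_add[OF plinear_slice] pmp.linear_scale[OF plinear_slice]
        distrib_left distrib_right sum.distrib pm.scale_sum_right)
  have "?f (single w 1) = single w 1" if w: "w \<in> words B (r + N + s)" for w
  proof -
    define u0 x0 v0 where "u0 = take r w" "x0 = take N (drop r w)" "v0 = drop (r + N) w"
    have w_eq: "w = u0 @ x0 @ v0"
      unfolding u0_x0_v0_def by (metis add.commute append_take_drop_id drop_drop)
    have len: "length u0 = r" "length v0 = s" "length w = r + N + s"
      using w by (auto simp: u0_x0_v0_def words_def)
    have mem: "u0 \<in> words B r" "v0 \<in> words B s" using w len unfolding w_eq by (auto simp: words_def)
    have single: "single w 1 = single u0 1 * single x0 (1::'k) * single v0 1"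
      by (simp add: single_mult_list w_eq)
    have "?f (single w 1) = (\<Sum>u\<in>words B r. \<Sum>v\<in>words B s.
      if v = v0 then (if u = u0 then single w 1 else 0) else 0)"
    proof (intro sum.cong refl)
      fix u v assume "u \<in> words B r" "v \<in> words B s"
      then have "length u = length u0" "length v = length v0" using len by (auto simp: words_def)
      then have "slice u v (single w (1::'k)) = (if u = u0 \<and> v = v0 then single x0 1 else 0)"
        unfolding single by (rule slice_sandwich)
      then show "single u 1 * slice u v (single w (1::'k)) * single v 1 =
        (if v = v0 then (if u = u0 then single w 1 else 0) else 0)"
        by (auto simp: single)
    qed
    also have "\<dots> = single w 1"
      using mem finite_words[OF B] by simp
    finally show ?thesis .
  qed
  then show ?thesis
    using plinear_eq_on_singles[OF pm.linear_ident lin, of "words B (r + N + s)" p] p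
    by (simp add: homog_def)
qed

text \<open>For m < N no pair u, v satisfies the length condition, so the whole tensor power
  results; both cases of \<open>koszul_coeff\<close> are covered by this one formula.\<close>

definition koszul_space :: "'i set \<Rightarrow> nat \<Rightarrow> ('i list \<Rightarrow>\<^sub>0 'k::field) set \<Rightarrow> nat \<Rightarrow> ('i list \<Rightarrow>\<^sub>0 'k) set" where
  "koszul_space B N S m = {p \<in> homog B m. \<forall>u\<in>lists B. \<forall>v\<in>lists B. length u + N + length v = m \<longrightarrow> slice u v p \<in> S}"

text \<open>A description by slices of R tensored with r copies of E on the left and s copies on the
  right. With basis words as outer factors every slice is y or 0, and linearity in x and z extends
  this; conversely \<open>slice_decomp\<close> writes p as a sum of generators.\<close>

lemma span_sandwich:
  fixes S :: "('i list \<Rightarrow>\<^sub>0 'k::field) set"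
  assumes S: "pm.subspace S" "S \<subseteq> homog B N" and B: "finite B"
  shows "pm.span {x * y * z |x y z. x \<in> homog B r \<and> y \<in> S \<and> z \<in> homog B s} =
    {p \<in> homog B (r + N + s). \<forall>u\<in>words B r. \<forall>v\<in>words B s. slice u v p \<in> S}" (is "pm.span ?G = ?H")
proof
  have sub: "pm.subspace ?H"
    using subspace_homog[of B "r + N + s"] S(1)
    by (auto simp: pm.subspace_def pmp.linear_add[OF plinear_slice] pmp.linear_scale[OF plinear_slice]
        pmp.linear_0[OF plinear_slice])
  have gen: "single u 1 * y * single v 1 \<in> ?H"
    if "u \<in> words B r" "v \<in> words B s" "y \<in> S" for u v y
  proof -
    have "single u 1 * y * single v 1 \<in> homog B (r + N + s)"
      using that S sandwich_homog[of u B y N v] by (auto simp: words_def)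
    moreover have "slice u' v' (single u 1 * y * single v 1) \<in> S"
      if "u' \<in> words B r" "v' \<in> words B s" for u' v'
      using that \<open>u \<in> words B r\<close> \<open>v \<in> words B s\<close> \<open>y \<in> S\<close> pm.subspace_0[OF S(1)]
      by (subst slice_sandwich) (auto simp: words_def)
    ultimately show ?thesis by blast
  qed
  have left: "x * y * single v 1 \<in> ?H" if "x \<in> homog B r" "v \<in> words B s" "y \<in> S" for x y v
  proof -
    have "homog B r \<subseteq> {x. x * (y * single v 1) \<in> ?H}"
      unfolding homog_def[of B r] span_singles[symmetric]
      using gen that by (intro pm.span_minimal
          pmp.linear_subspace_linear_preimage[OF plinear_mult_right sub]) (auto simp: mult.assoc)
    then show ?thesis using that by (auto simp: mult.assoc)
  qed
  have "x * y * z \<in> ?H" if "x \<in> homog B r" "z \<in> homog B s" "y \<in> S" for x y z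
  proof -
    have "homog B s \<subseteq> {z. x * y * z \<in> ?H}"
      unfolding homog_def[of B s] span_singles[symmetric]
      using left that by (intro pm.span_minimal
          pmp.linear_subspace_linear_preimage[OF plinear_mult_left sub]) auto
    then show ?thesis using that by auto
  qed
  then show "pm.span ?G \<subseteq> ?H" by (intro pm.span_minimal[OF _ sub]) blast
  show "?H \<subseteq> pm.span ?G"
  proof
    fix p assume p: "p \<in> ?H"
    have "(\<Sum>u\<in>words B r. \<Sum>v\<in>words B s.
      single u 1 * slice u v p * single v 1) \<in> pm.span ?G"
    proof (intro pm.span_sum pm.span_base)
      fix u v assume uv: "u \<in> words B r" "v \<in> words B s"
      then have "single u (1::'k) \<in> homog B r" "single v (1::'k) \<in> homog B s"
        by (auto simp: homog_def)
      moreover have "slice u v p \<in> S" using p uv by blast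
      ultimately show "single u 1 * slice u v p * single v 1 \<in> ?G" by blast
    qed
    then show "p \<in> pm.span ?G" using slice_decomp[of p B r N s] p B by simp
  qed
qed

text \<open>By adjunction, being orthogonal to all u r v with r in the complement of S means that
  every slice is orthogonal to that complement, and by \<open>perp_perp\<close> such slices are
  exactly the elements of S.\<close>

lemma koszul_space_eq_perp:
  fixes S :: "('i list \<Rightarrow>\<^sub>0 'k::field) set"
  assumes S: "pm.subspace S" "S \<subseteq> homog B N" and B: "finite B"
  shows "koszul_space B N S m = perp (words B m) (two_sided_deg B N (perp (words B N) S) m)"
proof -
  let ?P = "perp (words B N) S"
  have PP: "perp (words B N) ?P = S"
    using S by (intro perp_perp finite_words B) (auto simp: homog_def)
  have iff: "slice u v q \<in> perp (words B N) ?P \<longleftrightarrow> (\<forall>r\<in>?P. dot r (slice u v q) = 0)"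
    if "q \<in> homog B m" "length u + N + length v = m" for u v and q :: "'i list \<Rightarrow>\<^sub>0 'k"
    using slice_homog[OF that] by (simp add: perp_def[of _ ?P] homog_def)
  have "q \<in> perp (words B m) (two_sided_deg B N ?P m) \<longleftrightarrow> q \<in> homog B m \<and> (\<forall>u r v.
    u \<in> lists B \<and> r \<in> ?P \<and> v \<in> lists B \<and> length u + N + length v = m \<longrightarrow>
    dot (single u 1 * r * single v 1) q = 0)" for q
    unfolding two_sided_deg_def perp_span unfolding perp_def[of "words B m"] homog_def by blast
  then have "q \<in> perp (words B m) (two_sided_deg B N ?P m) \<longleftrightarrow> q \<in> homog B m \<and> (\<forall>u\<in>lists B. \<forall>v\<in>lists B.
    length u + N + length v = m \<longrightarrow> (\<forall>r\<in>?P. dot r (slice u v q) = 0))" for q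
    unfolding dot_sandwich by blast
  then have "perp (words B m) (two_sided_deg B N ?P m) = {q \<in> homog B m. \<forall>u\<in>lists B. \<forall>v\<in>lists B.
    length u + N + length v = m \<longrightarrow> (\<forall>r\<in>?P. dot r (slice u v q) = 0)}" by blast
  also have "\<dots> = {q \<in> homog B m. \<forall>u\<in>lists B. \<forall>v\<in>lists B.
    length u + N + length v = m \<longrightarrow> slice u v q \<in> perp (words B N) ?P}"
    by (simp add: iff cong: conj_cong)
  finally show ?thesis by (simp add: PP koszul_space_def)
qed

text \<open>Its second summand and right-hand side are those of \<open>dim_component_add\<close> for
  the dual algebra. Cancelling them gives \<open>dim_dual_component_eq\<close>.\<close>

lemma dim_koszul_space:
  fixes S :: "('i list \<Rightarrow>\<^sub>0 'k::field) set"
  assumes S: "pm.subspace S" "S \<subseteq> homog B N" and B: "finite B"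
  shows "pm.dim (koszul_space B N S m) + pm.dim (two_sided_deg B N (perp (words B N) S) m) = pm.dim (homog B m :: ('i list \<Rightarrow>\<^sub>0 'k) set)"
proof -
  have "perp (words B N) S \<subseteq> homog B N" by (auto simp: perp_def homog_def)
  then have "two_sided_deg B N (perp (words B N) S) m \<subseteq> {p. keys p \<subseteq> words B m}"
    using two_sided_deg_homog unfolding homog_def by blast
  moreover have "pm.subspace (two_sided_deg B N (perp (words B N) S) m)"
    unfolding two_sided_deg_def by (rule pm.subspace_span)
  ultimately show ?thesis
    using dim_perp[OF _ finite_words[OF B], of "two_sided_deg B N (perp (words B N) S) m" m]
    by (simp add: koszul_space_eq_perp[OF S B] homog_def add.commute)
qed

lemma subspace_koszul_space: "pm.subspace S \<Longrightarrow> pm.subspace (koszul_space B N S m)"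
  using subspace_homog[of B m]
  by (auto simp: koszul_space_def pm.subspace_def pmp.linear_add[OF plinear_slice] pmp.linear_scale[OF plinear_slice]
        pmp.linear_0[OF plinear_slice])

lemma koszul_space_homog: "koszul_space B N S m \<subseteq> homog B m"
  by (auto simp: koszul_space_def)

subsection \<open>The dual algebra\<close>

lemma (in embedding) subspace_of_image:
  assumes "W \<subseteq> carrier M" "pm.subspace (f ` W)"
  shows "VectorSpace.subspace class_ring W M"
proof -
  interpret W: embedding "M\<lparr>carrier := W\<rparr>" f by (rule restrict_carrier[OF assms])
  interpret V: vectorspace class_ring M by (rule vectorspace)
  have "submodule class_ring W M"
    using W.zero_closed W.add_closed W.smult_closed assms(1) V.module_axioms
    by (auto simp: submodule_def)
  then show ?thesis using vectorspace by (simp add: VectorSpace.subspace_def)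
qed

context homogeneous_relations
begin

lemma Phi_koszul_coeff:
  "koszul_coeff E N R m \<subseteq> carrier T \<and> Phi ` koszul_coeff E N R m = koszul_space B N rels m"
proof (cases "m < N")
  case True
  then show ?thesis
    using tensor_power_closed Phi_tensor_power by (auto simp: koszul_coeff_def koszul_space_def)
next
  case False
  define G where "G r = {x \<otimes>\<^bsub>T\<^esub> y \<otimes>\<^bsub>T\<^esub> z |x y z.
    x \<in> tensor_power E r \<and> y \<in> R \<and> z \<in> tensor_power E (m - N - r)}" for r
  let ?G' = "\<lambda>r. {x * y * z |x y z. x \<in> homog B r \<and> y \<in> rels \<and> z \<in> homog B (m - N - r)}"
  have closed: "x \<in> carrier T" if "x \<in> tensor_power E r" for x r
    using that tensor_power_closed by blast
  have G_closed: "G r \<subseteq> carrier T" for r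
    unfolding G_def using closed R_closed T.mult_closed by blast
  have Phi3: "Phi (x \<otimes>\<^bsub>T\<^esub> y \<otimes>\<^bsub>T\<^esub> z) = Phi x * Phi y * Phi z"
    if "x \<in> carrier T" "y \<in> carrier T" "z \<in> carrier T" for x y z
    using that by (simp add: T.f_mult T.mult_closed)
  have "Phi ` G r = ?G' r" for r
  proof (intro equalityI subsetI)
    fix p assume "p \<in> Phi ` G r"
    then obtain x y z where *: "x \<in> tensor_power E r" "y \<in> R" "z \<in> tensor_power E (m - N - r)"
      "p = Phi (x \<otimes>\<^bsub>T\<^esub> y \<otimes>\<^bsub>T\<^esub> z)" unfolding G_def by blast
    then have "p = Phi x * Phi y * Phi z" using Phi3 closed R_closed by blast
    moreover have "Phi x \<in> homog B r" "Phi y \<in> rels" "Phi z \<in> homog B (m - N - r)"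
      using * Phi_tensor_power unfolding rels_def by blast+
    ultimately show "p \<in> ?G' r" by blast
  next
    fix p assume "p \<in> ?G' r"
    then obtain x y z where *: "x \<in> homog B r" "y \<in> rels" "z \<in> homog B (m - N - r)" "p = x * y * z"
      by blast
    obtain x' y' z' where **: "x' \<in> tensor_power E r" "y' \<in> R" "z' \<in> tensor_power E (m - N - r)"
      "x = Phi x'" "y = Phi y'" "z = Phi z'"
      using * unfolding rels_def Phi_tensor_power[symmetric] by blast
    have "x' \<in> carrier T" "y' \<in> carrier T" "z' \<in> carrier T" using ** closed R_closed by blast+
    then have "p = Phi (x' \<otimes>\<^bsub>T\<^esub> y' \<otimes>\<^bsub>T\<^esub> z')" using *(4) **(4-6) by (simp only: Phi3)
    then show "p \<in> Phi ` G r" unfolding G_def using ** by blast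
  qed
  then have image: "Phi ` vspan T (G r) = {p \<in> homog B m. \<forall>u\<in>words B r. \<forall>v\<in>words B (m - N - r). slice u v p \<in> rels}"
    if "r \<le> m - N" for r
    using that False span_sandwich[OF subspace_rels rels_homog finite_B, of r "m - N - r"]
    by (simp add: T.image_vspan[OF G_closed])
  have kc: "koszul_coeff E N R m = (\<Inter>r\<in>{..m - N}. vspan T (G r))"
    using False by (simp add: koszul_coeff_def G_def)
  have sub: "koszul_coeff E N R m \<subseteq> carrier T"
    unfolding kc using T.vspan_closed[OF G_closed, of 0] by blast
  have "Phi ` koszul_coeff E N R m = (\<Inter>r\<in>{..m - N}. Phi ` vspan T (G r))"
    unfolding kc
    \<comment> \<open>Taking images commutes with the intersection because \<open>Phi\<close> is
      injective on the carrier; the index 0 shows that the intersection is not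
      empty-indexed.\<close>
    by (rule image_INT[OF T.inj, of _ _ 0]) (use T.vspan_closed[OF G_closed] in auto)
  also have "\<dots> = (\<Inter>r\<in>{..m - N}. {p \<in> homog B m. \<forall>u\<in>words B r. \<forall>v\<in>words B (m - N - r). slice u v p \<in> rels})"
    by (intro INF_cong refl image) simp
  also have "\<dots> = koszul_space B N rels m"
  proof (intro equalityI subsetI)
    fix p assume p: "p \<in> (\<Inter>r\<in>{..m - N}. {p \<in> homog B m. \<forall>u\<in>words B r. \<forall>v\<in>words B (m - N - r). slice u v p \<in> rels})"
    then have "p \<in> homog B m" by blast
    moreover have "slice u v p \<in> rels" if "u \<in> lists B" "v \<in> lists B" "length u + N + length v = m" for u v
    proof -
      have "length u \<in> {..m - N}" "u \<in> words B (length u)" "v \<in> words B (m - N - length u)"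
        using that by (auto simp: words_def)
      then show ?thesis using p by blast
    qed
    ultimately show "p \<in> koszul_space B N rels m" unfolding koszul_space_def by blast
  next
    fix p assume p: "p \<in> koszul_space B N rels m"
    show "p \<in> (\<Inter>r\<in>{..m - N}. {p \<in> homog B m. \<forall>u\<in>words B r. \<forall>v\<in>words B (m - N - r). slice u v p \<in> rels})"
      using p False by (auto simp: koszul_space_def words_def)
  qed
  finally show ?thesis using sub by blast
qed

end

section \<open>The pairing of tensors over E and over its dual\<close>

lemma lookup_single_Cons_mult:
  "lookup (single [c] a * q) (b # w) =
    (if b = c then a * lookup q w else (0 :: 'k::field))"
proof -
  have "keys q \<subseteq> UNIV" by simp
  then show ?thesis
    by (induction rule: keys_span_induct)
      (auto simp: single_mult_list lookup_single lookup_add when_def distrib_left)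
qed

lemma dot_Cons:
  "dot (single [b] a * p) (single [c] a' * q) =
    (if b = c then a * a' * dot p q else (0 :: 'k::field))"
proof -
  have "keys p \<subseteq> UNIV" by simp
  then show ?thesis
    by (induction rule: keys_span_induct)
      (auto simp: single_mult_list dot_single_left lookup_single_Cons_mult distrib_left dot_add_left)
qed

text \<open>On decomposable tensors the dot product factors over the letters; this is the inductive
  step of \<open>dot_word\<close>.\<close>

lemma dot_linear_mult:
  fixes \<alpha> \<beta> :: "'i \<Rightarrow> 'k::field"
  assumes "finite B"
  shows "dot ((\<Sum>b\<in>B. single [b] (\<alpha> b)) * p) ((\<Sum>b\<in>B. single [b] (\<beta> b)) * q) =
    (\<Sum>b\<in>B. \<alpha> b * \<beta> b) * dot p q"
proof -
  have "dot ((\<Sum>b\<in>B. single [b] (\<alpha> b)) * p) ((\<Sum>b\<in>B. single [b] (\<beta> b)) * q)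
    = (\<Sum>b\<in>B. \<Sum>c\<in>B. if c = b then \<alpha> b * \<beta> b * dot p q else 0)"
    unfolding sum_distrib_right dot_sum_left dot_sum_right
    by (intro sum.cong refl) (auto simp: dot_Cons)
  then show ?thesis using assms by (simp add: sum_distrib_right)
qed

lemma dot_homog_neq:
  assumes "p \<in> homog B m" "q \<in> homog B n" "m \<noteq> n" shows "dot p q = 0"
  unfolding dot_def
proof (rule sum.neutral, rule ballI)
  fix w assume "w \<in> keys p"
  then have "w \<notin> keys q" using assms by (auto simp: homog_def words_def)
  then show "lookup p w * lookup q w = 0" by (simp add: in_keys_iff)
qed

context coordinates
begin

lemma T_mem_closed: "t \<in> carrier T \<Longrightarrow> p \<in> t \<Longrightarrow> p \<in> carrier F"
  unfolding carrier_T using TQ.coset_eq by blast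

abbreviation "dual \<equiv> dual_space E"

lemma dual_simps [simp]:
  "carrier dual = {f \<in> extensional (carrier E).
       (\<forall>x\<in>carrier E. \<forall>y\<in>carrier E. f (x \<oplus>\<^bsub>E\<^esub> y) = f x + f y) \<and>
       (\<forall>c. \<forall>x\<in>carrier E. f (c \<odot>\<^bsub>E\<^esub> x) = c * f x)}"
  "f \<oplus>\<^bsub>dual\<^esub> g = restrict (\<lambda>v. f v + g v) (carrier E)"
  "c \<odot>\<^bsub>dual\<^esub> f = restrict (\<lambda>v. c * f v) (carrier E)"
  "\<zero>\<^bsub>dual\<^esub> = restrict (\<lambda>v. 0) (carrier E)"
  by (simp_all add: dual_space_def ring.func_space_def[OF class_ring.ring_axioms])

definition dual_bas :: "'i \<Rightarrow> 'e \<Rightarrow> 'k" where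
  "dual_bas b = restrict (\<lambda>x. crd x b) (carrier E)"

lemma functional_expansion:
  assumes f: "f \<in> carrier dual" and x: "x \<in> carrier E"
  shows "f x = (\<Sum>b\<in>B. crd x b * f (bas b))"
proof -
  let ?g = "\<lambda>b. crd x b \<odot>\<^bsub>E\<^esub> bas b"
  have "f (finsum E ?g S) = (\<Sum>b\<in>S. crd x b * f (bas b))" if "finite S" "S \<subseteq> B" for S
    using that
  proof (induction S)
    case empty
    have "\<zero>\<^bsub>E\<^esub> \<in> carrier E" by simp
    then have "f (0 \<odot>\<^bsub>E\<^esub> \<zero>\<^bsub>E\<^esub>) = 0 * f \<zero>\<^bsub>E\<^esub>" using f unfolding dual_simps by blast
    then show ?case by simp
  next
    case (insert c S)
    have eq: "finsum E ?g (insert c S) = ?g c \<oplus>\<^bsub>E\<^esub> finsum E ?g S"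
      using insert expansion_closed[OF x, of "insert c S"] by (intro E.finsum_insert) auto
    have c: "bas c \<in> carrier E" "?g c \<in> carrier E" "finsum E ?g S \<in> carrier E"
      using insert expansion_closed[OF x, of "insert c S"] bas_closed by (auto intro!: E.finsum_closed)
    have "f (finsum E ?g (insert c S)) = f (?g c) + f (finsum E ?g S)"
      unfolding eq using f c by simp
    also have "f (?g c) = crd x c * f (bas c)" using f c by simp
    finally show ?case using insert by simp
  qed
  from this[OF finite_B order_refl] show ?thesis unfolding expansion[OF x, symmetric] .
qed

lemma dual_add_closed: "f \<in> carrier dual \<Longrightarrow> g \<in> carrier dual \<Longrightarrow> f \<oplus>\<^bsub>dual\<^esub> g \<in> carrier dual"
  by (auto simp: E.smult_closed algebra_simps)

lemma dual_smult_closed: "f \<in> carrier dual \<Longrightarrow> c \<odot>\<^bsub>dual\<^esub> f \<in> carrier dual"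
  by (auto simp: E.smult_closed algebra_simps)

lemma dual_eqI:
  assumes "f \<in> carrier dual" "g \<in> carrier dual" "\<And>b. b \<in> B \<Longrightarrow> f (bas b) = g (bas b)"
  shows "f = g"
proof (rule extensionalityI)
  show "f \<in> extensional (carrier E)" "g \<in> extensional (carrier E)" using assms by simp_all
  show "f x = g x" if x: "x \<in> carrier E" for x
    unfolding functional_expansion[OF assms(1) x] functional_expansion[OF assms(2) x]
    by (intro sum.cong refl) (simp only: assms(3))
qed

lemma vectorspace_dual: "vectorspace class_ring dual"
proof (rule embedding.vectorspace)
  let ?h = "\<lambda>f. \<Sum>b\<in>B. single b (f (bas b))"
  have lookup: "lookup (?h f) b = f (bas b)" if "b \<in> B" for f b
    using that finite_B by (simp add: lookup_sum lookup_single when_def)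
  show "embedding dual ?h"
  proof
    show "inj_on ?h (carrier dual)"
      by (intro inj_onI dual_eqI) (simp_all only: lookup[symmetric])
    show "\<zero>\<^bsub>dual\<^esub> \<in> carrier dual" by (simp add: E.smult_closed)
    show "?h \<zero>\<^bsub>dual\<^esub> = 0" using bas_closed by simp
    fix f g c assume "f \<in> carrier dual"
    show "?h (c \<odot>\<^bsub>dual\<^esub> f) = smul c (?h f)"
      unfolding pm.scale_sum_right by (intro sum.cong refl) (simp add: bas_closed)
    show "?h (f \<oplus>\<^bsub>dual\<^esub> g) = ?h f + ?h g"
      unfolding sum.distrib[symmetric] by (intro sum.cong refl) (simp add: bas_closed single_add)
  qed (fact dual_add_closed dual_smult_closed)+
qed

text \<open>The coordinates of a functional are its values on the basis vectors. The dual basis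
  shares the index set B, so the pairing of tensor powers becomes \<open>dot\<close> on one space of
  words.\<close>

lemma dual_coordinates: "coordinates dual B (\<lambda>f b. f (bas b)) dual_bas"
proof (rule coordinates.intro)
  show "dual_bas b \<in> carrier dual" if "b \<in> B" for b
    using that by (auto simp: dual_bas_def crd_add crd_smult E.smult_closed)
  show "f = g" if "f \<in> carrier dual" "g \<in> carrier dual" "\<And>b. b \<in> B \<Longrightarrow> f (bas b) = g (bas b)" for f g
    using that by (rule dual_eqI)
qed (use vectorspace_dual finite_B in \<open>auto simp: dual_bas_def bas_closed crd_bas\<close>)

interpretation D: coordinates dual B "\<lambda>f b. f (bas b)" dual_bas
  by (rule dual_coordinates)

text \<open>Words of different lengths have different degrees and are orthogonal. For equal lengths
  each position contributes the sum of the products of coordinates of f and x, which is f x by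
  \<open>functional_expansion\<close>.\<close>

lemma dot_word:
  "fs \<in> lists (carrier dual) \<Longrightarrow> xs \<in> lists (carrier E) \<Longrightarrow>
    dot (D.word fs) (word xs) = (if length xs = length fs then (\<Prod>i<length fs. (fs ! i) (xs ! i)) else 0)"
proof (induction fs arbitrary: xs)
  case Nil
  show ?case
  proof (cases xs)
    case Nil
    have "dot (1 :: 'i list \<Rightarrow>\<^sub>0 'k) 1 = 1"
      using dot_single_left[of "[]" 1 "1 :: 'i list \<Rightarrow>\<^sub>0 'k"] by (simp add: zero_list_def lookup_one flip: single_one)
    then show ?thesis using Nil by simp
  next
    case (Cons x ys)
    then show ?thesis using dot_homog_neq[OF D.word_homog[of "[]"] word_homog[of xs]] by simp
  qed
next
  case (Cons f fs)
  show ?case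
  proof (cases xs)
    case Nil
    then show ?thesis using dot_homog_neq[OF D.word_homog[of "f # fs"] word_homog[of "[]"]] by simp
  next
    case xs: (Cons x ys)
    have "dot (D.word (f # fs)) (word xs) = (\<Sum>b\<in>B. f (bas b) * crd x b) * dot (D.word fs) (word ys)"
      unfolding xs word_simps D.word_simps D.lin_def lin_def by (rule dot_linear_mult[OF finite_B])
    also have "(\<Sum>b\<in>B. f (bas b) * crd x b) = f x"
      using functional_expansion[of f x] Cons.prems by (simp add: xs mult.commute del: dual_simps)
    also have "dot (D.word fs) (word ys) = (if length ys = length fs then (\<Prod>i<length fs. (fs ! i) (ys ! i)) else 0)"
      using Cons xs by simp
    finally show ?thesis by (simp add: xs prod.lessThan_Suc_shift del: prod.lessThan_Suc)
  qed
qed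

text \<open>Since \<open>phi\<close> vanishes on the tensor ideal, this formula makes
  \<open>word_pairing\<close> depend only on the tensors that p and q represent.\<close>

lemma word_pairing_eq_dot:
  assumes p: "p \<in> carrier D.F" and q: "q \<in> carrier F"
  shows "word_pairing p q = dot (D.phi p) (phi q)"
proof -
  have keys: "fs \<in> lists (carrier dual)" "xs \<in> lists (carrier E)"
    if "fs \<in> keys p" "xs \<in> keys q" for fs xs
    using p q that unfolding F_simps D.F_simps by blast+
  have "dot (D.phi p) (phi q) = (\<Sum>fs\<in>keys p. \<Sum>xs\<in>keys q.
    lookup p fs * (lookup q xs * dot (D.word fs) (word xs)))"
    unfolding phi_def D.phi_def lin_ext_def dot_sum_left dot_sum_right
    by (subst sum.swap) (intro sum.cong refl, simp add: mult_ac)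
  also have "\<dots> = (\<Sum>fs\<in>keys p. \<Sum>xs\<in>keys q.
    if length xs = length fs then lookup p fs * lookup q xs * (\<Prod>i<length fs. (fs ! i) (xs ! i)) else 0)"
    by (intro sum.cong refl) (simp add: dot_word[OF keys] mult.assoc del: dual_simps)
  also have "\<dots> = word_pairing p q"
    unfolding word_pairing_def
    by (rule sum.cong[OF refl]) (simp add: sum.inter_filter)
  finally show ?thesis ..
qed

lemma annihilator_eq:
  assumes R: "R \<subseteq> carrier T"
  shows "annihilator E N R = {s \<in> tensor_power dual N. \<forall>t\<in>R. dot (D.Phi s) (Phi t) = 0}"
proof -
  have "(\<forall>p\<in>s. \<forall>q\<in>t. word_pairing p q = 0) \<longleftrightarrow> dot (D.Phi s) (Phi t) = 0"
    if s: "s \<in> tensor_power dual N" and t: "t \<in> R" for s t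
  proof -
    have s': "s \<in> carrier D.T" using s D.tensor_power_closed by blast
    have t': "t \<in> carrier T" using t R by blast
    have *: "word_pairing p q = dot (D.Phi s) (Phi t)" if "p \<in> s" "q \<in> t" for p q
      using word_pairing_eq_dot[OF D.T_mem_closed[OF s' that(1)] T_mem_closed[OF t' that(2)]]
        D.Phi_mem[OF s' that(1)] Phi_mem[OF t' that(2)] by simp
    have "(\<forall>p\<in>s. \<forall>q\<in>t. word_pairing p q = 0) \<longleftrightarrow> (\<forall>p\<in>s. \<forall>q\<in>t. dot (D.Phi s) (Phi t) = 0)"
      by (intro ball_cong refl) (simp add: *)
    then show ?thesis using D.T_nonempty[OF s'] T_nonempty[OF t'] by blast
  qed
  then show ?thesis unfolding annihilator_def by blast
qed

end

context homogeneous_relations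
begin

interpretation D: coordinates dual B "\<lambda>f b. f (bas b)" dual_bas
  by (rule dual_coordinates)

lemma Phi_annihilator: "D.Phi ` annihilator E N R = perp (words B N) rels"
proof -
  have "D.Phi ` annihilator E N R = {p \<in> D.Phi ` tensor_power dual N. \<forall>t\<in>R. dot p (Phi t) = 0}"
    unfolding annihilator_eq[OF R_closed] by blast
  also have "\<dots> = perp (words B N) rels"
    unfolding D.Phi_tensor_power by (auto simp: perp_def homog_def rels_def dot_commute)
  finally show ?thesis .
qed

text \<open>The dual algebra is an instance of the same locale, so the dimension formula for A
  applies to it as well.\<close>

lemma homogeneous_relations_dual:
  "homogeneous_relations dual B (\<lambda>f b. f (bas b)) dual_bas N (annihilator E N R)"
proof (rule homogeneous_relations.intro[OF dual_coordinates homogeneous_relations_axioms.intro])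
  show "annihilator E N R \<subseteq> tensor_power dual N" by (auto simp: annihilator_def)
  then have "annihilator E N R \<subseteq> carrier D.T" using D.tensor_power_closed by blast
  then show "VectorSpace.subspace class_ring (annihilator E N R) D.T"
    by (rule D.T.subspace_of_image) (simp add: Phi_annihilator subspace_perp)
qed

lemma dim_dual_component_eq:
  "dim_dual_component E N R m = pm.dim (koszul_space B N rels m)"
proof -
  interpret DH: homogeneous_relations dual B "\<lambda>f b. f (bas b)" dual_bas N "annihilator E N R"
    by (rule homogeneous_relations_dual)
  have "DH.rels = perp (words B N) rels" unfolding DH.rels_def by (rule Phi_annihilator)
  then show ?thesis
    using DH.dim_component_add[of m] dim_koszul_space[OF subspace_rels rels_homog finite_B, of m]
    by (simp add: dim_dual_component_def)
qed

end

subsection \<open>Tensor products\<close>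

definition tens :: "('a \<Rightarrow>\<^sub>0 'k::field) \<Rightarrow> ('b \<Rightarrow>\<^sub>0 'k) \<Rightarrow> ('a \<times> 'b \<Rightarrow>\<^sub>0 'k)" where
  "tens p q = lin_ext (\<lambda>u. lin_ext (\<lambda>w. single (u, w) 1) q) p"

lemma lookup_lin_ext:
  "lookup (lin_ext g p) y = (\<Sum>w\<in>keys p. lookup p w * lookup (g w) y)"
  by (simp add: lin_ext_def lookup_sum)

lemma sum_keys_when:
  fixes r :: "'z \<Rightarrow>\<^sub>0 'k::field"
  shows "(\<Sum>x\<in>keys r. lookup r x * (c when x = y)) = lookup r y * c"
proof -
  have "(\<Sum>x\<in>keys r. lookup r x * (c when x = y))
    = (\<Sum>x\<in>keys r. if x = y then lookup r y * c else 0)"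
    by (intro sum.cong refl) (simp add: when_def)
  then show ?thesis by (simp add: in_keys_iff)
qed

lemma lookup_tens [simp]:
  "lookup (tens p q) (u, w) = lookup p u * lookup q w"
proof -
  have "lookup (lin_ext (\<lambda>w. single (x, w) 1) q) (u, w) = (lookup q w when x = u)" for x
    using sum_keys_when[of q 1 w] by (cases "x = u") (simp_all add: lookup_lin_ext lookup_single when_def)
  then show ?thesis unfolding tens_def lookup_lin_ext[of _ p] by (simp add: sum_keys_when)
qed

lemma pair_poly_mapping_eqI:
  "(\<And>u w. lookup p (u, w) = lookup q (u, w)) \<Longrightarrow> p = q"
  by (rule poly_mapping_eqI) auto

lemma tens_add_left: "tens (p + p') q = tens p q + tens p' q"
  and tens_add_right: "tens p (q + q') = tens p q + tens p q'"
  and tens_smul_left: "tens (smul c p) q = smul c (tens p q)"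
  and tens_smul_right: "tens p (smul c q) = smul c (tens p q)"
  and tens_zero_left [simp]: "tens 0 q = 0" and tens_zero_right [simp]: "tens p 0 = 0"
  by (rule pair_poly_mapping_eqI; simp add: lookup_add algebra_simps)+

lemma plinear_tens_left: "plinear (\<lambda>p. tens p q)" and plinear_tens_right: "plinear (\<lambda>q. tens p q)"
  by (rule plinearI; simp add: tens_add_left tens_add_right tens_smul_left tens_smul_right)+

lemma tens_single: "tens (single u a) (single w b) = single (u, w) (a * b)"
  by (rule pair_poly_mapping_eqI) (auto simp: lookup_single when_def)

definition tens_span :: "('a \<Rightarrow>\<^sub>0 'k::field) set \<Rightarrow> ('b \<Rightarrow>\<^sub>0 'k) set \<Rightarrow> ('a \<times> 'b \<Rightarrow>\<^sub>0 'k) set" where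
  "tens_span X Y = pm.span {tens p q |p q. p \<in> X \<and> q \<in> Y}"

lemma tens_in_span: "p \<in> X \<Longrightarrow> q \<in> Y \<Longrightarrow> tens p q \<in> tens_span X Y"
  unfolding tens_span_def by (rule pm.span_base) blast

lemma subspace_tens_span: "pm.subspace (tens_span X Y)"
  unfolding tens_span_def by (rule pm.subspace_span)

lemma tens_span_minimal:
  "pm.subspace S \<Longrightarrow> (\<And>p q. p \<in> X \<Longrightarrow> q \<in> Y \<Longrightarrow> tens p q \<in> S) \<Longrightarrow> tens_span X Y \<subseteq> S"
  unfolding tens_span_def by (rule pm.span_minimal) blast+

lemma tens_span_span: "tens_span (pm.span X) (pm.span Y) = tens_span X Y"
proof
  show "tens_span X Y \<subseteq> tens_span (pm.span X) (pm.span Y)"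
    by (intro tens_span_minimal subspace_tens_span tens_in_span pm.span_base)
  have 1: "tens p q \<in> tens_span X Y" if "p \<in> pm.span X" "q \<in> Y" for p q
  proof -
    have "pm.span X \<subseteq> {p. tens p q \<in> tens_span X Y}"
      using that tens_in_span by (intro pm.span_minimal
          pmp.linear_subspace_linear_preimage[OF plinear_tens_left subspace_tens_span]) blast
    then show ?thesis using that by blast
  qed
  have "tens p q \<in> tens_span X Y" if "p \<in> pm.span X" "q \<in> pm.span Y" for p q
  proof -
    have "pm.span Y \<subseteq> {q. tens p q \<in> tens_span X Y}"
      using that 1 by (intro pm.span_minimal
          pmp.linear_subspace_linear_preimage[OF plinear_tens_right subspace_tens_span]) blast
    then show ?thesis using that by blast
  qed
  then show "tens_span (pm.span X) (pm.span Y) \<subseteq> tens_span X Y"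
    by (intro tens_span_minimal subspace_tens_span)
qed

text \<open>Bases A of X and B of Y give a linear map from the functions on pairs onto the span. It
  is injective: evaluating a vanishing combination at a fixed first coordinate u gives a relation
  among the vectors of B, whose coefficients must vanish for every u; these in turn are relations
  among the vectors of A.\<close>

lemma fdim_and_dim_tens_span:
  fixes X :: "('a \<Rightarrow>\<^sub>0 'k::field) set" and Y :: "('b \<Rightarrow>\<^sub>0 'k) set"
  assumes X: "pm.subspace X" "fdim X" and Y: "pm.subspace Y" "fdim Y"
  shows "fdim (tens_span X Y) \<and> pm.dim (tens_span X Y) = pm.dim X * pm.dim Y"
proof -
  obtain A where A: "A \<subseteq> X" "pm.independent A" "X \<subseteq> pm.span A" "card A = pm.dim X"
    using pm.basis_exists by blast
  obtain B where B: "B \<subseteq> Y" "pm.independent B" "Y \<subseteq> pm.span B" "card B = pm.dim Y"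
    using pm.basis_exists by blast
  have fin: "finite A" "finite B"
    using fdim_independent_finite X Y A B by blast+
  let ?L = "lin_ext (\<lambda>(p, q). tens p q) :: (('a \<Rightarrow>\<^sub>0 'k) \<times> ('b \<Rightarrow>\<^sub>0 'k) \<Rightarrow>\<^sub>0 'k) \<Rightarrow> _"
  let ?V = "{r :: ('a \<Rightarrow>\<^sub>0 'k) \<times> ('b \<Rightarrow>\<^sub>0 'k) \<Rightarrow>\<^sub>0 'k. keys r \<subseteq> A \<times> B}"
  note L = plinear_lin_ext[of "\<lambda>(p, q). tens p q"]
  have "?L ` ?V = pm.span (?L ` (\<lambda>w. single w 1) ` (A \<times> B))"
    unfolding span_singles[symmetric] by (rule pmp.linear_span_image[OF L, symmetric])
  also have "?L ` (\<lambda>w. single w 1) ` (A \<times> B) = {tens p q |p q. p \<in> A \<and> q \<in> B}"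
    by (force simp: image_image)
  also have "pm.span \<dots> = tens_span X Y"
    using tens_span_span[of A B] pm.span_subspace[OF A(1,3) X(1)] pm.span_subspace[OF B(1,3) Y(1)]
    by (simp add: tens_span_def)
  finally have img: "?L ` ?V = tens_span X Y" .
  have fV: "fdim ?V" using fin by (intro fdim_keys) simp
  have ker: "r = 0" if r: "keys r \<subseteq> A \<times> B" "?L r = 0" for r
  proof -
    have zero: "(\<Sum>p\<in>A. lookup r (p, q) * lookup p u) = 0" if q: "q \<in> B" for q u
    proof -
      have "(\<Sum>q\<in>B. smul (\<Sum>p\<in>A. lookup r (p, q) * lookup p u) q) = 0"
      proof (rule poly_mapping_eqI)
        fix w
        have "0 = lookup (?L r) (u, w)" using r(2) by simp
        also have "?L r = (\<Sum>(p, q)\<in>A \<times> B. smul (lookup r (p, q)) (tens p q))"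
          using lin_ext_superset[OF _ r(1), of "\<lambda>(p, q). tens p q"] fin by (simp add: case_prod_unfold)
        also have "lookup \<dots> (u, w) = (\<Sum>p\<in>A. \<Sum>q\<in>B. lookup r (p, q) * (lookup p u * lookup q w))"
          by (simp add: lookup_sum case_prod_unfold sum.cartesian_product)
        also have "\<dots> = (\<Sum>q\<in>B. (\<Sum>p\<in>A. lookup r (p, q) * lookup p u) * lookup q w)"
          by (subst sum.swap) (simp add: sum_distrib_right mult.assoc)
        finally show "lookup (\<Sum>q\<in>B. smul (\<Sum>p\<in>A. lookup r (p, q) * lookup p u) q) w
          = lookup 0 w" by (simp add: lookup_sum)
      qed
      then show ?thesis by (rule pm.independentD[OF B(2) fin(2) order_refl _ q])
    qed
    have "lookup r (p, q) = 0" if "p \<in> A" "q \<in> B" for p q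
    proof -
      have "(\<Sum>p\<in>A. smul (lookup r (p, q)) p) = 0"
        using zero[OF that(2)] by (intro poly_mapping_eqI) (simp add: lookup_sum)
      then show ?thesis by (rule pm.independentD[OF A(2) fin(1) order_refl _ that(1)])
    qed
    then show "r = 0" using r(1) by (intro pair_poly_mapping_eqI) (auto simp: in_keys_iff)
  qed
  have dV: "pm.dim ?V = card (A \<times> B)" by (rule dim_keys) (use fin in simp)
  have "{r \<in> ?V. ?L r = 0} = {0}" using ker pmp.linear_0[OF L] by auto
  then have "pm.dim {r \<in> ?V. ?L r = 0} = 0"
    by (simp add: dim_zero)
  then have "pm.dim (tens_span X Y) = card (A \<times> B)"
    using rank_nullity[OF L keys_subspace fV] img dV by simp
  then show ?thesis
    using fdim_image[OF L fV] img A(4) B(4) by (simp add: card_cartesian_product)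
qed

section \<open>The tensor product of two embedded spaces\<close>

definition bilinear_gens ::
  "('k::field, 'v, 'm) module_scheme \<Rightarrow> ('k, 'w, 'n) module_scheme \<Rightarrow> ('v \<times> 'w \<Rightarrow>\<^sub>0 'k) set" where
  "bilinear_gens V W =
    ({single (x \<oplus>\<^bsub>V\<^esub> x', y) 1 - single (x, y) 1 - single (x', y) 1
       |x x' y. x \<in> carrier V \<and> x' \<in> carrier V \<and> y \<in> carrier W} \<union>
     {single (x, y \<oplus>\<^bsub>W\<^esub> y') 1 - single (x, y) 1 - single (x, y') 1
       |x y y'. x \<in> carrier V \<and> y \<in> carrier W \<and> y' \<in> carrier W} \<union>
     {single (c \<odot>\<^bsub>V\<^esub> x, y) 1 - single (x, y) c
       |c x y. x \<in> carrier V \<and> y \<in> carrier W} \<union>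
     {single (x, c \<odot>\<^bsub>W\<^esub> y) 1 - single (x, y) c
       |c x y. x \<in> carrier V \<and> y \<in> carrier W})"

text \<open>The asymmetry is deliberate: W comes with a basis e indexed by Y, while V is merely
  embedded. In the application V is the quotient algebra A, for which no basis is chosen, and W is
  the tensor algebra with its basis of words.\<close>

locale tensor_embedding = V: embedding V f + W: embedding W g
  for V :: "('k::field, 'v, 'm) module_scheme" and f :: "'v \<Rightarrow> ('a \<Rightarrow>\<^sub>0 'k)"
    and W :: "('k, 'w, 'n) module_scheme" and g :: "'w \<Rightarrow> ('b \<Rightarrow>\<^sub>0 'k)" +
  fixes Y :: "'b set" and e :: "'b \<Rightarrow> 'w"
  assumes e_closed: "\<And>w. w \<in> Y \<Longrightarrow> e w \<in> carrier W"
    and g_e: "\<And>w. w \<in> Y \<Longrightarrow> g (e w) = single w 1"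
    and g_keys: "\<And>y. y \<in> carrier W \<Longrightarrow> keys (g y) \<subseteq> Y"
begin

abbreviation "FS \<equiv> free_space (carrier V \<times> carrier W) :: ('k, 'v \<times> 'w \<Rightarrow>\<^sub>0 'k) module"

sublocale FS: embedding FS id by (rule embedding_free_space)

lemma carrier_FS: "carrier FS = {p. keys p \<subseteq> carrier V \<times> carrier W}"
  by (simp add: free_space_def)

abbreviation "BR \<equiv> bilinear_relations V W"

lemma bilinear_gens_closed: "bilinear_gens V W \<subseteq> carrier FS"
proof
  have 1: "single (x, y) c \<in> {p. keys p \<subseteq> carrier V \<times> carrier W}"
    if "x \<in> carrier V" "y \<in> carrier W" for x y c
    using that by simp
  fix p assume "p \<in> bilinear_gens V W"
  then show "p \<in> carrier FS" unfolding bilinear_gens_def carrier_FS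
    by (elim UnE CollectE exE conjE; hypsubst; intro pm.subspace_diff[OF keys_subspace] 1)
      (simp_all add: V.add_closed V.smult_closed W.add_closed W.smult_closed)
qed

lemma BR_eq_span: "BR = pm.span (bilinear_gens V W)"
  using FS.image_vspan[OF bilinear_gens_closed]
  by (simp add: bilinear_relations_def bilinear_gens_def)

lemma subspace_BR: "pm.subspace BR"
  unfolding BR_eq_span by (rule pm.subspace_span)

lemma BR_closed: "BR \<subseteq> carrier FS"
  unfolding BR_eq_span carrier_FS
  using bilinear_gens_closed carrier_FS by (intro pm.span_minimal keys_subspace) blast

lemma BR_relations:
  shows "x \<in> carrier V \<Longrightarrow> x' \<in> carrier V \<Longrightarrow> y \<in> carrier W \<Longrightarrow>
      single (x \<oplus>\<^bsub>V\<^esub> x', y) 1 - single (x, y) 1 - single (x', y) 1 \<in> BR"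
    and "x \<in> carrier V \<Longrightarrow> y \<in> carrier W \<Longrightarrow> y' \<in> carrier W \<Longrightarrow>
      single (x, y \<oplus>\<^bsub>W\<^esub> y') 1 - single (x, y) 1 - single (x, y') 1 \<in> BR"
    and "x \<in> carrier V \<Longrightarrow> y \<in> carrier W \<Longrightarrow> single (c \<odot>\<^bsub>V\<^esub> x, y) 1 - single (x, y) c \<in> BR"
    and "x \<in> carrier V \<Longrightarrow> y \<in> carrier W \<Longrightarrow> single (x, c \<odot>\<^bsub>W\<^esub> y) 1 - single (x, y) c \<in> BR"
  unfolding BR_eq_span bilinear_gens_def by (rule pm.span_base, blast)+

definition tmap :: "('v \<times> 'w \<Rightarrow>\<^sub>0 'k) \<Rightarrow> ('a \<times> 'b \<Rightarrow>\<^sub>0 'k)" where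
  "tmap = lin_ext (\<lambda>(x, y). tens (f x) (g y))"

lemma plinear_tmap: "plinear tmap"
  unfolding tmap_def by (rule plinear_lin_ext)

lemma tmap_single [simp]: "tmap (single (x, y) c) = smul c (tens (f x) (g y))"
  by (simp add: tmap_def)

lemma tmap_BR: "z \<in> BR \<Longrightarrow> tmap z = 0"
  unfolding BR_eq_span
proof (rule pmp.linear_eq_0_on_span[OF plinear_tmap])
  fix z assume "z \<in> bilinear_gens V W"
  then show "tmap z = 0" unfolding bilinear_gens_def
    by (elim UnE CollectE exE conjE; hypsubst)
      (simp_all add: pmp.linear_diff[OF plinear_tmap] V.f_add W.f_add V.f_smult W.f_smult
        tens_add_left tens_add_right tens_smul_left tens_smul_right)
qed

lemma BR_zero: "y \<in> carrier W \<Longrightarrow> single (\<zero>\<^bsub>V\<^esub>, y) 1 \<in> BR"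
proof -
  assume y: "y \<in> carrier W"
  have "0 \<odot>\<^bsub>V\<^esub> \<zero>\<^bsub>V\<^esub> = \<zero>\<^bsub>V\<^esub>"
    by (rule V.eqI) (simp_all add: V.smult_closed V.zero_closed V.f_smult V.f_zero)
  then show ?thesis using BR_relations(3)[OF V.zero_closed y, of 0] by simp
qed

definition row_form :: "('b \<Rightarrow> 'v) \<Rightarrow> 'b set \<Rightarrow> ('v \<times> 'w \<Rightarrow>\<^sub>0 'k)" where
  "row_form X S = (\<Sum>w\<in>S. single (X w, e w) 1)"

text \<open>A normal form modulo the bilinear relations: a sum over basis vectors of W with
  coefficients X w in V. The function X is total and zero off S, so that two such forms can be
  brought to a common support and added.\<close>

definition rows :: "('v \<times> 'w \<Rightarrow>\<^sub>0 'k) \<Rightarrow> ('b \<Rightarrow> 'v) \<Rightarrow> 'b set \<Rightarrow> bool" where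
  "rows z X S \<longleftrightarrow> finite S \<and> S \<subseteq> Y \<and> (\<forall>w. X w \<in> carrier V) \<and> (\<forall>w. w \<notin> S \<longrightarrow> X w = \<zero>\<^bsub>V\<^esub>) \<and>
    z - row_form X S \<in> BR"

lemma rows_superset:
  assumes "rows z X S" "finite S'" "S \<subseteq> S'" "S' \<subseteq> Y"
  shows "rows z X S'"
proof -
  have "row_form X S' = row_form X S + row_form X (S' - S)"
    unfolding row_form_def by (subst sum.subset_diff[OF assms(3,2)]) (rule add.commute)
  moreover have "row_form X (S' - S) \<in> BR"
    unfolding row_form_def
  proof (rule pm.subspace_sum[OF subspace_BR])
    fix w assume "w \<in> S' - S"
    then have "X w = \<zero>\<^bsub>V\<^esub>" "e w \<in> carrier W" using assms e_closed by (auto simp: rows_def)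
    then show "single (X w, e w) 1 \<in> BR" using BR_zero by simp
  qed
  ultimately have "z - row_form X S' \<in> BR"
    using assms(1) pm.subspace_diff[OF subspace_BR, of "z - row_form X S" "row_form X (S' - S)"]
    by (simp add: rows_def diff_diff_eq)
  then show ?thesis using assms by (auto simp: rows_def)
qed

lemma rows_add:
  assumes "rows z X S" "rows z' X' S'"
  shows "rows (z + z') (\<lambda>w. X w \<oplus>\<^bsub>V\<^esub> X' w) (S \<union> S')"
proof -
  let ?S = "S \<union> S'"
  have S: "finite ?S" "?S \<subseteq> Y" using assms by (auto simp: rows_def)
  have r: "rows z X ?S" "rows z' X' ?S"
    by (rule rows_superset[OF assms(1) S(1) _ S(2)] rows_superset[OF assms(2) S(1) _ S(2)], simp)+
  then have c: "X w \<in> carrier V" "X' w \<in> carrier V" for w by (auto simp: rows_def)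
  have ec: "e w \<in> carrier W" if "w \<in> ?S" for w using r that e_closed by (auto simp: rows_def)
  have BR1: "z - row_form X ?S \<in> BR" and BR2: "z' - row_form X' ?S \<in> BR" using r by (auto simp: rows_def)
  have BR3: "row_form (\<lambda>w. X w \<oplus>\<^bsub>V\<^esub> X' w) ?S - row_form X ?S - row_form X' ?S \<in> BR"
    unfolding row_form_def sum_subtractf[symmetric]
    by (rule pm.subspace_sum[OF subspace_BR]) (rule BR_relations(1)[OF c ec])
  have "(z - row_form X ?S) + (z' - row_form X' ?S) -
      (row_form (\<lambda>w. X w \<oplus>\<^bsub>V\<^esub> X' w) ?S - row_form X ?S - row_form X' ?S) \<in> BR"
    by (rule pm.subspace_diff[OF subspace_BR pm.subspace_add[OF subspace_BR BR1 BR2] BR3])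
  also have "(z - row_form X ?S) + (z' - row_form X' ?S) -
      (row_form (\<lambda>w. X w \<oplus>\<^bsub>V\<^esub> X' w) ?S - row_form X ?S - row_form X' ?S) =
      z + z' - row_form (\<lambda>w. X w \<oplus>\<^bsub>V\<^esub> X' w) ?S" by simp
  finally have "z + z' - row_form (\<lambda>w. X w \<oplus>\<^bsub>V\<^esub> X' w) ?S \<in> BR" .
  moreover have "\<zero>\<^bsub>V\<^esub> \<oplus>\<^bsub>V\<^esub> \<zero>\<^bsub>V\<^esub> = \<zero>\<^bsub>V\<^esub>"
    by (rule V.eqI) (simp_all add: V.add_closed V.zero_closed V.f_add V.f_zero)
  ultimately show ?thesis using r c unfolding rows_def by (simp add: V.add_closed)
qed

text \<open>The second entry y is expanded in the basis e, and its coefficients, together with c,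
  are moved to the first entry by the scaling relations.\<close>

lemma rows_single:
  assumes x: "x \<in> carrier V" and y: "y \<in> carrier W"
  shows "\<exists>X S. rows (single (x, y) c) X S"
proof -
  let ?q = "lookup (g y)" and ?S = "keys (g y)"
  interpret WV: vectorspace class_ring W by (rule W.vectorspace)
  interpret VV: vectorspace class_ring V by (rule V.vectorspace)
  have SY: "?S \<subseteq> Y" by (rule g_keys[OF y])
  let ?h = "\<lambda>w. ?q w \<odot>\<^bsub>W\<^esub> e w"
  have h: "?h \<in> S \<rightarrow> carrier W" if "S \<subseteq> ?S" for S
    using that SY e_closed W.smult_closed by blast
  have "finsum W ?h ?S \<in> carrier W" by (rule WV.finsum_closed) (rule h, simp)
  moreover have "g (finsum W ?h ?S) = g y"
  proof -
    have "g (finsum W ?h ?S) = (\<Sum>w\<in>?S. g (?h w))" by (rule W.f_finsum) (use h in auto)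
    also have "\<dots> = (\<Sum>w\<in>?S. single w (?q w))"
      using SY by (intro sum.cong refl) (auto simp: W.f_smult e_closed g_e)
    finally show ?thesis using poly_mapping_decomp[of ?S "g y"] by simp
  qed
  ultimately have y_eq: "y = finsum W ?h ?S" using y W.eqI by metis
  have expand: "single (x, finsum W ?h S) 1 - (\<Sum>w\<in>S. single (x, e w) (?q w)) \<in> BR"
    if "finite S" "S \<subseteq> ?S" for S
    using that
  proof (induction S)
    case empty
    have "0 \<odot>\<^bsub>W\<^esub> \<zero>\<^bsub>W\<^esub> = \<zero>\<^bsub>W\<^esub>"
      by (rule W.eqI) (simp_all add: W.smult_closed W.zero_closed W.f_smult W.f_zero)
    then show ?case using BR_relations(4)[OF x W.zero_closed, of 0] by simp
  next
    case (insert w S)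
    have eq: "finsum W ?h (insert w S) = ?h w \<oplus>\<^bsub>W\<^esub> finsum W ?h S"
      using insert h[of "insert w S"] by (intro WV.finsum_insert) auto
    have c: "e w \<in> carrier W" "?h w \<in> carrier W" "finsum W ?h S \<in> carrier W"
      using insert h[of "insert w S"] SY e_closed by (auto intro!: WV.finsum_closed)
    have "single (x, finsum W ?h (insert w S)) 1 - (\<Sum>w\<in>insert w S. single (x, e w) (?q w))
      = (single (x, ?h w \<oplus>\<^bsub>W\<^esub> finsum W ?h S) 1 - single (x, ?h w) 1
        - single (x, finsum W ?h S) 1)
      + (single (x, ?h w) 1 - single (x, e w) (?q w))
      + (single (x, finsum W ?h S) 1 - (\<Sum>w\<in>S. single (x, e w) (?q w)))"
      unfolding eq using insert by simp
    also have "\<dots> \<in> BR"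
      using insert.prems by (intro pm.subspace_add[OF subspace_BR
          pm.subspace_add[OF subspace_BR BR_relations(2)[OF x c(2,3)] BR_relations(4)[OF x c(1)]] insert.IH]) simp
    finally show ?case .
  qed
  define X where "X w = (c * ?q w) \<odot>\<^bsub>V\<^esub> x" for w
  have 1: "single (x, y) c - (\<Sum>w\<in>?S. single (x, e w) (c * ?q w)) \<in> BR"
    using pm.subspace_scale[OF subspace_BR expand[OF _ order_refl], of c]
    by (simp add: y_eq[symmetric] pm.scale_right_diff_distrib pm.scale_sum_right)
  have 2: "row_form X ?S - (\<Sum>w\<in>?S. single (x, e w) (c * ?q w)) \<in> BR"
    unfolding row_form_def sum_subtractf[symmetric] X_def
    using x SY e_closed by (intro pm.subspace_sum[OF subspace_BR] BR_relations(3)) auto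
  have "single (x, y) c - row_form X ?S \<in> BR"
    using pm.subspace_diff[OF subspace_BR 1 2] by simp
  moreover have "X w = \<zero>\<^bsub>V\<^esub>" if "w \<notin> ?S" for w
    using that x by (intro V.eqI)
      (simp_all add: X_def in_keys_iff V.smult_closed V.zero_closed V.f_smult V.f_zero)
  ultimately have "rows (single (x, y) c) X ?S"
    using SY x by (auto simp: rows_def X_def V.smult_closed)
  then show ?thesis by blast
qed

lemma ex_rows:
  assumes "z \<in> carrier FS" shows "\<exists>X S. rows z X S"
proof -
  have "keys z \<subseteq> carrier V \<times> carrier W" using assms carrier_FS by blast
  then show ?thesis
  proof (induction rule: keys_span_induct)
    case (single p c)
    show ?case
    proof (cases "c = 0")
      case True
      have "rows 0 (\<lambda>_. \<zero>\<^bsub>V\<^esub>) {}"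
        using pm.subspace_0[OF subspace_BR] by (simp add: rows_def row_form_def V.zero_closed)
      then show ?thesis using True by auto
    next
      case False
      then show ?thesis using single rows_single[of "fst p" "snd p" c] by (cases p) auto
    qed
  next
    case (add p q)
    then show ?case using rows_add by blast
  qed
qed

text \<open>In the normal form the second factors map to distinct basis functions. If the total is
  0, each coefficient X w is zero, so the normal form is a sum of relations and z is a
  relation.\<close>

lemma kernel_tmap:
  assumes z: "z \<in> carrier FS" "tmap z = 0" shows "z \<in> BR"
proof -
  obtain X S where r: "rows z X S" using ex_rows[OF z(1)] by blast
  have S: "finite S" "S \<subseteq> Y" "\<And>w. X w \<in> carrier V" "z - row_form X S \<in> BR"
    using r by (auto simp: rows_def)
  have "tmap (row_form X S) = (\<Sum>w\<in>S. tens (f (X w)) (single w 1))"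
    unfolding row_form_def pmp.linear_sum[OF plinear_tmap]
    using S(2) by (intro sum.cong refl) (auto simp: g_e)
  moreover have "tmap (row_form X S) = 0"
    using tmap_BR[OF S(4)] z(2) by (simp add: pmp.linear_diff[OF plinear_tmap])
  ultimately have zero: "(\<Sum>w\<in>S. tens (f (X w)) (single w 1)) = 0" by simp
  have "f (X w) = 0" if w: "w \<in> S" for w
  proof (rule poly_mapping_eqI)
    fix u
    have "0 = lookup (\<Sum>w\<in>S. tens (f (X w)) (single w 1)) (u, w)"
      using zero by simp
    also have "\<dots> = lookup (f (X w)) u"
      using w S(1) by (simp add: lookup_sum lookup_single when_def if_distrib[of "(*) _"] cong: if_cong)
    finally show "lookup (f (X w)) u = lookup 0 u" by simp
  qed
  then have "X w = \<zero>\<^bsub>V\<^esub>" if "w \<in> S" for w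
    using S(3) that by (intro V.eqI) (simp_all add: V.zero_closed V.f_zero)
  then have "row_form X S \<in> BR"
    unfolding row_form_def using S(2) e_closed BR_zero by (intro pm.subspace_sum[OF subspace_BR]) auto
  then show ?thesis using pm.subspace_add[OF subspace_BR S(4)] by force
qed

lemma quotient_map_tmap: "quotient_map FS id BR tmap"
proof
  show "BR \<subseteq> carrier FS" by (rule BR_closed)
  show "tmap x = 0 \<longleftrightarrow> x \<in> BR" if "x \<in> carrier FS" for x
    using kernel_tmap[OF that] tmap_BR by blast
qed (simp_all add: free_space_def pmp.linear_add[OF plinear_tmap] pmp.linear_scale[OF plinear_tmap])

sublocale TP: quotient_map FS id BR tmap by (rule quotient_map_tmap)

definition temb :: "('v \<times> 'w \<Rightarrow>\<^sub>0 'k) set \<Rightarrow> ('a \<times> 'b \<Rightarrow>\<^sub>0 'k)" where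
  "temb = induced tmap"

lemma embedding_tensor_prod: "embedding (tensor_prod V W) temb"
  unfolding temb_def tensor_prod_def by (rule TP.embedding_quot)

lemma pure_tensor_closed:
  assumes "x \<in> carrier V" "y \<in> carrier W"
  shows "pure_tensor V W x y \<in> carrier (tensor_prod V W)"
    and "temb (pure_tensor V W x y) = tens (f x) (g y)"
proof -
  have s: "single (x, y) 1 \<in> carrier FS" using assms by (simp add: carrier_FS)
  show "pure_tensor V W x y \<in> carrier (tensor_prod V W)"
    unfolding pure_tensor_def tensor_prod_def TP.carrier_quot using s by (rule imageI)
  show "temb (pure_tensor V W x y) = tens (f x) (g y)"
    unfolding pure_tensor_def temb_def TP.induced_coset[OF s] by simp
qed

lemma temb_image: "temb ` carrier (tensor_prod V W) = tens_span (f ` carrier V) (g ` carrier W)"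
proof -
  have "temb ` carrier (tensor_prod V W) = tmap ` carrier FS"
    unfolding temb_def tensor_prod_def by (rule TP.image_quot)
  also have "\<dots> = pm.span (tmap ` (\<lambda>w. single w 1) ` (carrier V \<times> carrier W))"
    unfolding carrier_FS span_singles[symmetric] by (rule pmp.linear_span_image[OF plinear_tmap, symmetric])
  also have "tmap ` (\<lambda>w. single w 1) ` (carrier V \<times> carrier W) =
      {tens p q |p q. p \<in> f ` carrier V \<and> q \<in> g ` carrier W}"
    by (force simp: image_image)
  finally show ?thesis by (simp add: tens_span_def)
qed

end

subsection \<open>The Koszul differential\<close>

lemma slice_single:
  "slice [b] [] (single w c) =
    (case w of [] \<Rightarrow> 0 | c' # v \<Rightarrow> if b = c' then single v c else (0 :: _ \<Rightarrow>\<^sub>0 'k::field))"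
  by (rule poly_mapping_eqI) (auto simp: lookup_single when_def split: list.splits)

lemma slice_keys:
  assumes "keys q \<subseteq> lists B" shows "keys (slice u v q) \<subseteq> lists B"
proof
  fix w assume "w \<in> keys (slice u v q)"
  then have "u @ w @ v \<in> keys q" by (simp add: in_keys_iff)
  then have "u @ w @ v \<in> lists B" using assms by blast
  then show "w \<in> lists B" by simp
qed

lemma words_Suc: "words B (Suc n) = (\<lambda>(u, b). u @ [b]) ` (words B n \<times> B)"
proof (intro equalityI subsetI)
  fix w assume w: "w \<in> words B (Suc n)"
  then have "w \<noteq> []" by (auto simp: words_def)
  then have "w = butlast w @ [last w]" by simp
  moreover have "butlast w \<in> words B n" "last w \<in> B"
    using w \<open>w \<noteq> []\<close> by (auto simp: words_def lists_eq_set dest: in_set_butlastD)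
  ultimately show "w \<in> (\<lambda>(u, b). u @ [b]) ` (words B n \<times> B)" by force
qed (auto simp: words_def)

lemma words_0: "words B 0 = {[]}"
  by (auto simp: words_def)

lemma slice_Nil [simp]: "slice [] [] q = q"
  by (rule poly_mapping_eqI) simp

lemma slice_slice: "slice u' v' (slice u v q) = slice (u @ u') (v' @ v) q"
  by (rule poly_mapping_eqI) simp

lemma koszul_space_keys: "q \<in> koszul_space B N S m \<Longrightarrow> keys q \<subseteq> lists B"
  using koszul_space_homog homog_lists by blast

text \<open>A slice of a slice is a slice of q with the prefix lengthened by b. This is why the
  differential respects the Koszul spaces.\<close>

lemma slice_koszul_space:
  assumes "q \<in> koszul_space B N S (Suc m)" "b \<in> B" shows "slice [b] [] q \<in> koszul_space B N S m"
  unfolding koszul_space_def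
proof (intro CollectI conjI ballI impI)
  show "slice [b] [] q \<in> homog B m"
    using assms(1) by (intro slice_homog[of q B "Suc m"]) (auto simp: koszul_space_def)
  fix u v assume "u \<in> lists B" "v \<in> lists B" "length u + N + length v = m"
  then show "slice u v (slice [b] [] q) \<in> S"
    using assms by (auto simp: slice_slice koszul_space_def)
qed

context homogeneous_relations
begin

lemma rels_rel_ideal: "rels \<subseteq> rel_ideal"
proof
  fix r assume r: "r \<in> rels"
  have "single [] 1 * r * single [] 1 = r"
    by (metis mult.left_neutral mult.right_neutral single_one zero_list_def)
  then show "r \<in> rel_ideal"
    unfolding rel_ideal_def two_sided_def using r
    by (intro pm.span_base CollectI exI[of _ "[]"] exI[of _ r] conjI) auto
qed

text \<open>The Koszul map in coordinates. It is defined for every word u, reduced or not, so that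
  it is linear on the whole function space; it represents \<open>koszul_d\<close> on the image of
  \<open>Psi\<close>.\<close>

definition model_d :: "('i list \<times> 'i list \<Rightarrow>\<^sub>0 'k) \<Rightarrow> ('i list \<times> 'i list \<Rightarrow>\<^sub>0 'k)" where
  "model_d = lin_ext (\<lambda>(u, w). case w of [] \<Rightarrow> 0
     | b # v \<Rightarrow> tens (nf (single (u @ [b]) 1)) (single v 1))"

lemma plinear_model_d: "plinear model_d"
  unfolding model_d_def by (rule plinear_lin_ext)

lemma model_d_tens:
  assumes q: "keys q \<subseteq> lists B"
  shows "model_d (tens p q) = (\<Sum>b\<in>B. tens (nf (p * single [b] 1)) (slice [b] [] q))"
proof -
  have "keys p \<subseteq> UNIV" by simp
  then show ?thesis
  proof (induction rule: keys_span_induct)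
    case (single u a)
    show ?case using q
    proof (induction rule: keys_span_induct)
      case (single w c)
      show ?case
      proof (cases w)
        case Nil
        then show ?thesis by (simp add: tens_single model_d_def slice_single)
      next
        case (Cons b v)
        have nf_a: "nf (single (u @ [b]) a) = smul a (nf (single (u @ [b]) 1))"
          using pmp.linear_scale[OF plinear_nf, of a "single (u @ [b]) 1"] by simp
        have single_c: "single v c = smul c (single v 1)" by simp
        have "model_d (tens (single u a) (single w c)) =
          smul (a * c) (tens (nf (single (u @ [b]) 1)) (single v 1))"
          by (simp add: tens_single model_d_def Cons)
        also have "\<dots> = tens (nf (single (u @ [b]) a)) (single v c)"
          unfolding nf_a single_c tens_smul_left tens_smul_right by simp
        finally have 1: "model_d (tens (single u a) (single w c)) =
          tens (nf (single (u @ [b]) a)) (single v c)" .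
        show ?thesis
        \<comment> \<open>A term with coefficient 0 may carry a word that is not over B; its first
          letter would then be missing from the sum.\<close>
        proof (cases "c = 0")
          case True
          then show ?thesis
            by (simp add: pmp.linear_0[OF plinear_model_d] pmp.linear_0[OF plinear_slice])
        next
          case False
          then have b: "b \<in> B" using single Cons by auto
          have "(\<Sum>b'\<in>B. tens (nf (single u a * single [b'] 1)) (slice [b'] [] (single w c)))
            = (\<Sum>b'\<in>B. if b' = b then tens (nf (single (u @ [b]) a)) (single v c) else 0)"
            by (intro sum.cong refl) (simp add: slice_single Cons single_mult_list)
          also have "\<dots> = tens (nf (single (u @ [b]) a)) (single v c)"
            using b finite_B by simp
          finally show ?thesis using 1 by simp
        qed
      qed
    next
      case (add q q')
      then show ?case
        by (simp add: tens_add_right pmp.linear_add[OF plinear_model_d] pmp.linear_add[OF plinear_slice] sum.distrib)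
    qed
  next
    case (add p p')
    then show ?case
      by (simp add: tens_add_left pmp.linear_add[OF plinear_model_d] pmp.linear_add[OF plinear_nf]
          distrib_right sum.distrib)
  qed
qed

lemma plinear_model_d_pow: "plinear (model_d ^^ j)"
proof (induction j)
  case 0
  show ?case using pm.linear_id by (simp add: id_def)
next
  case (Suc j)
  show ?case using plinear_compose[OF Suc plinear_model_d] by (simp add: o_def)
qed

text \<open>The first factor is taken as \<open>nf p\<close> so that the formula includes j = 0. The
  reduction after each single step is absorbed by \<open>nf_mult_nf\<close>.\<close>

lemma model_d_pow_tens:
  assumes q: "keys q \<subseteq> lists B"
  shows "(model_d ^^ j) (tens (nf p) q) = (\<Sum>u\<in>words B j. tens (nf (p * single u 1)) (slice u [] q))"
proof (induction j)
  case 0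
  have "p * single [] 1 = p" by (metis mult.right_neutral single_one zero_list_def)
  then show ?case by (simp add: words_0)
next
  case (Suc j)
  have nf1: "nf (nf (p * single u 1) * single [b] 1) = nf (p * single (u @ [b]) 1)"
    if "b \<in> B" for u b
    using that by (subst nf_mult_nf) (auto simp: mult.assoc single_mult_list)
  have "(model_d ^^ Suc j) (tens (nf p) q) = (\<Sum>u\<in>words B j. model_d (tens (nf (p * single u 1)) (slice u [] q)))"
    by (simp add: Suc pmp.linear_sum[OF plinear_model_d])
  also have "\<dots> = (\<Sum>u\<in>words B j. \<Sum>b\<in>B. tens (nf (p * single (u @ [b]) 1)) (slice (u @ [b]) [] q))"
    by (intro sum.cong refl) (simp add: model_d_tens slice_keys[OF q] nf1 slice_slice)
  also have "\<dots> = (\<Sum>u\<in>words B (Suc j). tens (nf (p * single u 1)) (slice u [] q))"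
    unfolding words_Suc
    by (subst sum.reindex) (auto simp: inj_on_def sum.cartesian_product case_prod_unfold)
  finally show ?case .
qed

text \<open>The case distinction expresses that A vanishes in negative degrees, where the truncated
  difference n - m would select degree 0.\<close>

definition model_part :: "nat \<Rightarrow> nat \<Rightarrow> ('i list \<times> 'i list \<Rightarrow>\<^sub>0 'k) set" where
  "model_part n m = (if m \<le> n then tens_span (nf ` homog B (n - m)) (koszul_space B N rels m) else {0})"

lemma subspace_model_part: "pm.subspace (model_part n m)"
  by (simp add: model_part_def subspace_tens_span)

lemma dim_model_part:
  "fdim (model_part n m) \<and> pm.dim (model_part n m) =
    (if m \<le> n then dim_component E R (n - m) * dim_dual_component E N R m else 0)"
proof (cases "m \<le> n")
  case True
  have "fdim (tens_span (nf ` homog B (n - m)) (koszul_space B N rels m)) \<and>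
    pm.dim (tens_span (nf ` homog B (n - m)) (koszul_space B N rels m)) =
    pm.dim (nf ` homog B (n - m)) * pm.dim (koszul_space B N rels m)"
    by (intro fdim_and_dim_tens_span pmp.linear_subspace_image[OF plinear_nf subspace_homog]
        fdim_image[OF plinear_nf fdim_homog[OF finite_B]] subspace_koszul_space[OF subspace_rels]
        fdim_subset[OF fdim_homog[OF finite_B] koszul_space_homog])
  then show ?thesis using True by (simp add: model_part_def dim_component_eq_dim dim_dual_component_eq)
next
  case False
  have "fdim {0 :: 'i list \<times> 'i list \<Rightarrow>\<^sub>0 'k}" unfolding fdim_def by (rule exI[of _ "{}"]) simp
  moreover have "pm.dim {0 :: 'i list \<times> 'i list \<Rightarrow>\<^sub>0 'k} = 0"
    by (simp add: dim_zero)
  ultimately show ?thesis using False by (simp add: model_part_def)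
qed

lemma model_d_model_part:
  assumes "x \<in> model_part n (Suc m)" shows "model_d x \<in> model_part n m"
proof (cases "Suc m \<le> n")
  case True
  have "tens_span (nf ` homog B (n - Suc m)) (koszul_space B N rels (Suc m)) \<subseteq> {x. model_d x \<in> model_part n m}"
  proof (rule tens_span_minimal)
    show "pm.subspace {x. model_d x \<in> model_part n m}"
      by (rule pmp.linear_subspace_linear_preimage[OF plinear_model_d subspace_model_part])
    fix p q :: "'i list \<Rightarrow>\<^sub>0 'k"
    assume p: "p \<in> nf ` homog B (n - Suc m)" and q: "q \<in> koszul_space B N rels (Suc m)"
    obtain p0 where p0: "p0 \<in> homog B (n - Suc m)" "p = nf p0" using p by blast
    have "model_d (tens p q) = (\<Sum>b\<in>B. tens (nf (p * single [b] 1)) (slice [b] [] q))"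
      by (rule model_d_tens[OF koszul_space_keys[OF q]])
    also have "\<dots> \<in> model_part n m"
    proof (rule pm.subspace_sum[OF subspace_model_part])
      fix b assume b: "b \<in> B"
      have "nf (p * single [b] 1) = nf (p0 * single [b] 1)"
        unfolding p0(2) using b by (intro nf_mult_nf) simp
      moreover have "p0 * single [b] 1 \<in> homog B (n - Suc m + length [b])"
        using b by (intro homog_mult[OF p0(1)] single_homog) simp
      moreover have "n - Suc m + length [b] = n - m" using True by simp
      ultimately show "tens (nf (p * single [b] 1)) (slice [b] [] q) \<in> model_part n m"
        using True slice_koszul_space[OF q b] by (auto simp: model_part_def intro!: tens_in_span)
    qed
    finally show "tens p q \<in> {x. model_d x \<in> model_part n m}" by simp
  qed
  then show ?thesis using assms True unfolding model_part_def by (auto split: if_splits)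
next
  case False
  then show ?thesis using assms pm.subspace_0[OF subspace_model_part, of n m]
    by (simp add: model_part_def[of _ "Suc m"] pmp.linear_0[OF plinear_model_d])
qed

lemma model_d_pow_model_part: "x \<in> model_part n (m + j) \<Longrightarrow> (model_d ^^ j) x \<in> model_part n m"
proof (induction j arbitrary: m)
  case (Suc j)
  then have "(model_d ^^ j) x \<in> model_part n (Suc m)" by simp
  then show ?case using model_d_model_part by simp
qed simp

lemma model_d_pow_N_zero:
  assumes x: "x \<in> model_part n m" and m: "N \<le> m" shows "(model_d ^^ N) x = 0"
proof (cases "m \<le> n")
  case True
  have "tens_span (nf ` homog B (n - m)) (koszul_space B N rels m) \<subseteq> {x. (model_d ^^ N) x = 0}"
  proof (rule tens_span_minimal)
    show "pm.subspace {x. (model_d ^^ N) x = 0}"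
      by (rule pmp.linear_subspace_kernel[OF plinear_model_d_pow])
    fix p q :: "'i list \<Rightarrow>\<^sub>0 'k"
    assume p: "p \<in> nf ` homog B (n - m)" and q: "q \<in> koszul_space B N rels m"
    obtain p0 where p0: "p0 \<in> homog B (n - m)" "p = nf p0" using p by blast
    have "(model_d ^^ N) (tens p q) = (\<Sum>u\<in>words B N. tens (nf (p0 * single u 1)) (slice u [] q))"
      unfolding p0(2) by (rule model_d_pow_tens[OF koszul_space_keys[OF q]])
    also have "\<dots> = 0"
    proof (rule pair_poly_mapping_eqI)
      fix y v
      \<comment> \<open>At a fixed second coordinate v, the first factors add up to
        \<open>nf\<close> of p0 times the function u -> q(u v). If v has length m - N, this function
        is a slice of q and hence a relation; for other v it is zero by homogeneity of q.\<close>
      have "(\<Sum>u\<in>words B N. smul (lookup q (u @ v)) (nf (p0 * single u 1))) = 0"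
      proof (cases "v \<in> words B (m - N)")
        case True
        let ?r = "slice [] v q"
        have r: "?r \<in> rels" using q True m by (auto simp: koszul_space_def words_def)
        have r_eq: "?r = (\<Sum>u\<in>words B N. smul (lookup q (u @ v)) (single u 1))"
          using poly_mapping_decomp[OF finite_words[OF finite_B], of ?r N] r rels_homog
          by (auto simp: homog_def)
        have "p0 * ?r \<in> rel_ideal"
          using two_sided_ideal(1)[of ?r B rels p0] r rels_rel_ideal homog_lists[OF p0(1)]
          unfolding rel_ideal_def by blast
        then have "0 = nf (p0 * ?r)" using nf_eq_0 by simp
        also have "\<dots> = (\<Sum>u\<in>words B N. smul (lookup q (u @ v)) (nf (p0 * single u 1)))"
          unfolding r_eq sum_distrib_left smul_mult_right
          by (simp only: pmp.linear_sum[OF plinear_nf] pmp.linear_scale[OF plinear_nf])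
        finally show ?thesis by simp
      next
        case False
        have "lookup q (u @ v) = 0" if "u \<in> words B N" for u
        proof -
          have "u @ v \<notin> words B m" using that False m by (auto simp: words_def)
          then show ?thesis using q by (auto simp: koszul_space_def homog_def in_keys_iff)
        qed
        then show ?thesis by simp
      qed
      then have "lookup (\<Sum>u\<in>words B N. smul (lookup q (u @ v)) (nf (p0 * single u 1))) y = 0"
        by simp
      then show "lookup (\<Sum>u\<in>words B N. tens (nf (p0 * single u 1)) (slice u [] q)) (y, v)
        = lookup 0 (y, v)"
        by (simp add: lookup_sum mult.commute)
    qed
    finally show "tens p q \<in> {x. (model_d ^^ N) x = 0}" by simp
  qed
  then show ?thesis using x True unfolding model_part_def by auto
next
  case False
  then show ?thesis using x pmp.linear_0[OF plinear_model_d_pow] by (simp add: model_part_def)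
qed

section \<open>The abstract complex and its coordinate model\<close>

sublocale TA: tensor_embedding A alpha T Phi "lists B" "\<lambda>w. tensor_word E (map bas w)"
proof (unfold_locales)
  fix w assume w: "w \<in> lists B"
  then have "map bas w \<in> lists (carrier E)" using bas_closed by auto
  then show "tensor_word E (map bas w) \<in> carrier T" "Phi (tensor_word E (map bas w)) = single w 1"
    using w by (simp_all add: tensor_word_closed Phi_tensor_word word_bas)
qed (rule Phi_lists)

abbreviation "KA \<equiv> koszul_ambient E R"

definition Psi where "Psi = TA.temb"

sublocale KE: embedding KA Psi
  unfolding Psi_def koszul_ambient_def by (rule TA.embedding_tensor_prod)

lemma koszul_tensor_closed:
  assumes "a \<in> carrier A" "t \<in> carrier T"
  shows "koszul_tensor E R a t \<in> carrier KA" "Psi (koszul_tensor E R a t) = tens (alpha a) (Phi t)"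
  using TA.pure_tensor_closed[OF assms] by (simp_all add: koszul_ambient_def koszul_tensor_def Psi_def)

lemma Psi_image: "Psi ` carrier KA = tens_span (alpha ` carrier A) {p. keys p \<subseteq> lists B}"
  unfolding Psi_def koszul_ambient_def TA.temb_image Phi_image ..

lemma alpha_rmul:
  assumes "a \<in> carrier A" "x \<in> carrier E"
  shows "a \<otimes>\<^bsub>A\<^esub> algebra_proj E R (tensor_word E [x]) \<in> carrier A"
    and "alpha (a \<otimes>\<^bsub>A\<^esub> algebra_proj E R (tensor_word E [x])) = nf (alpha a * lin x)"
  using A_mult[OF assms(1) tensor_word_closed[of "[x]"]] assms(2)
  by (simp_all add: Phi_tensor_word)

text \<open>Stability of the image is what allows \<open>model_d\<close> to be pulled back along the
  injective map \<open>Psi\<close>.\<close>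

lemma model_d_Psi_image:
  assumes "y \<in> Psi ` carrier KA" shows "model_d y \<in> Psi ` carrier KA"
proof -
  have "tens_span (alpha ` carrier A) {p. keys p \<subseteq> lists B} \<subseteq> {y. model_d y \<in> Psi ` carrier KA}"
  proof (rule tens_span_minimal)
    show "pm.subspace {y. model_d y \<in> Psi ` carrier KA}"
      by (rule pmp.linear_subspace_linear_preimage[OF plinear_model_d KE.image_subspace])
    fix p q :: "'i list \<Rightarrow>\<^sub>0 'k"
    assume p: "p \<in> alpha ` carrier A" and q: "q \<in> {p. keys p \<subseteq> lists B}"
    obtain a where a: "a \<in> carrier A" "p = alpha a" using p by blast
    have "(\<Sum>b\<in>B. tens (nf (p * single [b] 1)) (slice [b] [] q)) \<in> Psi ` carrier KA"
    proof (rule pm.subspace_sum[OF KE.image_subspace])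
      fix b assume b: "b \<in> B"
      have "nf (p * single [b] 1) \<in> alpha ` carrier A"
        using alpha_rmul[OF a(1) bas_closed[OF b]] unfolding a(2) lin_bas[OF b] by (metis imageI)
      moreover have "slice [b] [] q \<in> {p. keys p \<subseteq> lists B}"
        using slice_keys[of q B "[b]" "[]"] q by simp
      ultimately show "tens (nf (p * single [b] 1)) (slice [b] [] q) \<in> Psi ` carrier KA"
        unfolding Psi_image by (rule tens_in_span)
    qed
    then show "tens p q \<in> {y. model_d y \<in> Psi ` carrier KA}" using model_d_tens q by simp
  qed
  then show ?thesis using assms unfolding Psi_image by blast
qed

lemma slice_lin_mult: "b \<in> B \<Longrightarrow> slice [b] [] (lin x * q) = smul (crd x b) q"
proof (rule poly_mapping_eqI)
  fix w assume b: "b \<in> B"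
  have "lookup (slice [b] [] (lin x * q)) w =
    (\<Sum>c\<in>B. if c = b then crd x b * lookup q w else 0)"
    unfolding lin_def sum_distrib_right lookup_slice lookup_sum
    by (intro sum.cong refl) (simp add: lookup_single_Cons_mult)
  then show "lookup (slice [b] [] (lin x * q)) w = lookup (smul (crd x b) q) w"
    using b finite_B by simp
qed

text \<open>The rule for moving a basis letter, extended to an arbitrary vector x: slicing at b
  extracts the coordinate of x at b, and the sum over b reassembles \<open>lin x\<close> in the
  first factor.\<close>

lemma model_d_tens_lin:
  assumes "keys q \<subseteq> lists B"
  shows "model_d (tens p (lin x * q)) = tens (nf (p * lin x)) q"
proof -
  have "keys (lin x * q) \<subseteq> lists B"
    by (rule keys_mult_lists[OF homog_lists[OF lin_homog] assms])
  then have "model_d (tens p (lin x * q)) = (\<Sum>b\<in>B. tens (nf (p * single [b] 1)) (slice [b] [] (lin x * q)))"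
    by (rule model_d_tens)
  also have "\<dots> = (\<Sum>b\<in>B. tens (nf (p * single [b] (crd x b))) q)"
  proof (intro sum.cong refl)
    fix b assume b: "b \<in> B"
    have "p * single [b] (crd x b) = smul (crd x b) (p * single [b] 1)"
      unfolding smul_mult_right[symmetric] by simp
    then show "tens (nf (p * single [b] 1)) (slice [b] [] (lin x * q)) =
      tens (nf (p * single [b] (crd x b))) q"
      by (simp only: slice_lin_mult[OF b] pmp.linear_scale[OF plinear_nf] tens_smul_left tens_smul_right)
  qed
  also have "\<dots> = tens (nf (p * lin x)) q"
    unfolding lin_def sum_distrib_left pmp.linear_sum[OF plinear_nf] pmp.linear_sum[OF plinear_tens_left] ..
  finally show ?thesis .
qed

lemma model_d_tens_one: "model_d (tens p 1) = 0"
proof -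
  have one: "(1 :: 'i list \<Rightarrow>\<^sub>0 'k) = single [] 1" by (simp add: zero_list_def flip: single_one)
  show ?thesis by (subst model_d_tens) (simp_all add: one slice_single)
qed

text \<open>The witness for the definite description in \<open>koszul_d\<close>, which asks for an
  extensional map; hence the restriction to the carrier.\<close>

definition transported_d where
  "transported_d = restrict (\<lambda>z. inv_into (carrier KA) Psi (model_d (Psi z))) (carrier KA)"

lemma transported_d:
  assumes "z \<in> carrier KA"
  shows "transported_d z \<in> carrier KA" "Psi (transported_d z) = model_d (Psi z)"
  using model_d_Psi_image[of "Psi z"] assms
  by (simp_all add: transported_d_def inv_into_into f_inv_into_f)

definition koszul_d_spec where
  "koszul_d_spec d \<longleftrightarrow> d \<in> LinearCombinations.module_hom class_ring KA KA \<and>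
     d \<in> extensional (carrier KA) \<and>
     (\<forall>a\<in>carrier A.
        d (koszul_tensor E R a (tensor_word E [])) = \<zero>\<^bsub>KA\<^esub> \<and>
        (\<forall>x\<in>carrier E. \<forall>xs\<in>lists (carrier E).
           d (koszul_tensor E R a (tensor_word E (x # xs))) =
           koszul_tensor E R (a \<otimes>\<^bsub>A\<^esub> algebra_proj E R (tensor_word E [x])) (tensor_word E xs)))"

lemma transported_d_spec: "koszul_d_spec transported_d"
  unfolding koszul_d_spec_def
proof (intro conjI ballI)
  show "transported_d \<in> LinearCombinations.module_hom class_ring KA KA"
    unfolding LinearCombinations.module_hom_def
  proof (intro CollectI conjI allI impI)
    show "transported_d \<in> carrier KA \<rightarrow> carrier KA" by (simp add: transported_d(1) Pi_I)
    show "transported_d (y \<oplus>\<^bsub>KA\<^esub> z) = transported_d y \<oplus>\<^bsub>KA\<^esub> transported_d z" if "y \<in> carrier KA \<and> z \<in> carrier KA" for y z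
      using that by (intro KE.eqI) (simp_all add: transported_d KE.add_closed KE.f_add pmp.linear_add[OF plinear_model_d])
    show "transported_d (c \<odot>\<^bsub>KA\<^esub> z) = c \<odot>\<^bsub>KA\<^esub> transported_d z" if "c \<in> carrier class_ring \<and> z \<in> carrier KA" for c z
      using that by (intro KE.eqI) (simp_all add: transported_d KE.smult_closed KE.f_smult pmp.linear_scale[OF plinear_model_d])
  qed
  show "transported_d \<in> extensional (carrier KA)" by (simp add: transported_d_def)
  fix a assume a: "a \<in> carrier A"
  show "transported_d (koszul_tensor E R a (tensor_word E [])) = \<zero>\<^bsub>KA\<^esub>"
  proof (rule KE.eqI)
    have t: "tensor_word E [] \<in> carrier T" by (simp add: tensor_word_closed)
    show "transported_d (koszul_tensor E R a (tensor_word E [])) \<in> carrier KA"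
      by (rule transported_d(1)[OF koszul_tensor_closed(1)[OF a t]])
    show "Psi (transported_d (koszul_tensor E R a (tensor_word E []))) = Psi \<zero>\<^bsub>KA\<^esub>"
      unfolding transported_d(2)[OF koszul_tensor_closed(1)[OF a t]] koszul_tensor_closed(2)[OF a t] KE.f_zero
      by (simp add: Phi_tensor_word model_d_tens_one)
  qed (rule KE.zero_closed)
  fix x xs assume x: "x \<in> carrier E" and xs: "xs \<in> lists (carrier E)"
  show "transported_d (koszul_tensor E R a (tensor_word E (x # xs))) =
    koszul_tensor E R (a \<otimes>\<^bsub>A\<^esub> algebra_proj E R (tensor_word E [x])) (tensor_word E xs)"
  proof (rule KE.eqI)
    have t: "tensor_word E (x # xs) \<in> carrier T" "tensor_word E xs \<in> carrier T"
      using x xs by (simp_all add: tensor_word_closed)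
    note a' = alpha_rmul[OF a x]
    show "transported_d (koszul_tensor E R a (tensor_word E (x # xs))) \<in> carrier KA"
      by (rule transported_d(1)[OF koszul_tensor_closed(1)[OF a t(1)]])
    show "koszul_tensor E R (a \<otimes>\<^bsub>A\<^esub> algebra_proj E R (tensor_word E [x])) (tensor_word E xs) \<in> carrier KA"
      by (rule koszul_tensor_closed(1)[OF a'(1) t(2)])
    have "Phi (tensor_word E (x # xs)) = lin x * word xs" using x xs by (subst Phi_tensor_word) simp_all
    then show "Psi (transported_d (koszul_tensor E R a (tensor_word E (x # xs)))) =
      Psi (koszul_tensor E R (a \<otimes>\<^bsub>A\<^esub> algebra_proj E R (tensor_word E [x])) (tensor_word E xs))"
      unfolding transported_d(2)[OF koszul_tensor_closed(1)[OF a t(1)]] koszul_tensor_closed(2)[OF a t(1)]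
        koszul_tensor_closed(2)[OF a'(1) t(2)] a'(2)
      using model_d_tens_lin[OF homog_lists[OF word_homog]] xs by (simp add: Phi_tensor_word)
  qed
qed

definition word_tensors where
  "word_tensors = {koszul_tensor E R a (tensor_word E xs) |a xs. a \<in> carrier A \<and> xs \<in> lists (carrier E)}"

lemma word_tensors_span: "word_tensors \<subseteq> carrier KA \<and> vspan KA word_tensors = carrier KA"
proof
  show W: "word_tensors \<subseteq> carrier KA"
    unfolding word_tensors_def using koszul_tensor_closed(1) tensor_word_closed by blast
  have "Psi ` carrier KA \<subseteq> pm.span (Psi ` word_tensors)"
    unfolding Psi_image span_singles[symmetric]
  proof -
    have "tens_span (alpha ` carrier A) (pm.span ((\<lambda>w. single w 1) ` lists B))
      \<subseteq> tens_span (pm.span (alpha ` carrier A)) (pm.span ((\<lambda>w. single w 1) ` lists B))"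
      by (intro tens_span_minimal subspace_tens_span) (rule tens_in_span[OF pm.span_base])
    also have "\<dots> = tens_span (alpha ` carrier A) ((\<lambda>w. single w 1) ` lists B)"
      by (rule tens_span_span)
    also have "\<dots> \<subseteq> pm.span (Psi ` word_tensors)"
    proof (rule tens_span_minimal[OF pm.subspace_span])
      fix p q :: "'i list \<Rightarrow>\<^sub>0 'k"
      assume "p \<in> alpha ` carrier A" "q \<in> (\<lambda>w. single w 1) ` lists B"
      then obtain a w where aw: "a \<in> carrier A" "w \<in> lists B" "p = alpha a" "q = single w 1" by blast
      then have l: "map bas w \<in> lists (carrier E)" using bas_closed by auto
      have "Psi (koszul_tensor E R a (tensor_word E (map bas w))) = tens p q"
        using koszul_tensor_closed(2)[OF aw(1) tensor_word_closed[OF l]] aw l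
        by (simp add: Phi_tensor_word word_bas)
      moreover have "koszul_tensor E R a (tensor_word E (map bas w)) \<in> word_tensors"
        unfolding word_tensors_def using aw l by blast
      ultimately show "tens p q \<in> pm.span (Psi ` word_tensors)" by (metis imageI pm.span_base)
    qed
    finally show "tens_span (alpha ` carrier A) (pm.span ((\<lambda>w. single w 1) ` lists B))
      \<subseteq> pm.span (Psi ` word_tensors)" .
  qed
  then show "vspan KA word_tensors = carrier KA"
    using KE.vspan_closed[OF W] KE.mem_vspan_iff[OF W] by blast
qed

text \<open>The elements on which two candidates agree form a submodule containing the spanning set
  \<open>word_tensors\<close>: the empty word and the words with a first letter are the two
  prescribed cases. Off the carrier extensionality decides.\<close>

lemma koszul_d_spec_unique:
  assumes d: "koszul_d_spec d" shows "d = transported_d"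
proof (rule extensionalityI)
  show "d \<in> extensional (carrier KA)" using d by (simp add: koszul_d_spec_def)
  show "transported_d \<in> extensional (carrier KA)" by (simp add: transported_d_def)
  interpret V: vectorspace class_ring KA by (rule KE.vectorspace)
  let ?K = "{z \<in> carrier KA. d z = transported_d z}"
  have hom: "d \<in> LinearCombinations.module_hom class_ring KA KA" "transported_d \<in> LinearCombinations.module_hom class_ring KA KA"
    using d transported_d_spec by (simp_all add: koszul_d_spec_def)
  \<comment> \<open>Module homomorphisms are specified by addition and scalars, so the value at zero
    is obtained from zero = 0 times zero.\<close>
  have zero: "d \<zero>\<^bsub>KA\<^esub> = transported_d \<zero>\<^bsub>KA\<^esub>"
  proof -
    have "0 \<odot>\<^bsub>KA\<^esub> \<zero>\<^bsub>KA\<^esub> = \<zero>\<^bsub>KA\<^esub>" by (rule KE.eqI) (simp_all add: KE.smult_closed KE.zero_closed KE.f_smult KE.f_zero)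
    moreover have "d (0 \<odot>\<^bsub>KA\<^esub> \<zero>\<^bsub>KA\<^esub>) = 0 \<odot>\<^bsub>KA\<^esub> d \<zero>\<^bsub>KA\<^esub>" "transported_d (0 \<odot>\<^bsub>KA\<^esub> \<zero>\<^bsub>KA\<^esub>) = 0 \<odot>\<^bsub>KA\<^esub> transported_d \<zero>\<^bsub>KA\<^esub>"
      using KE.zero_closed by (simp_all only: LinearCombinations.module_hom_smult[OF hom(1)] LinearCombinations.module_hom_smult[OF hom(2)] partial_object.select_convs UNIV_I)
    moreover have "0 \<odot>\<^bsub>KA\<^esub> d \<zero>\<^bsub>KA\<^esub> = 0 \<odot>\<^bsub>KA\<^esub> transported_d \<zero>\<^bsub>KA\<^esub>"
      using funcset_mem[OF LinearCombinations.module_hom_closed[OF hom(1)] KE.zero_closed]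
        funcset_mem[OF LinearCombinations.module_hom_closed[OF hom(2)] KE.zero_closed]
      by (intro KE.eqI) (simp_all add: KE.smult_closed KE.f_smult)
    ultimately show ?thesis by simp
  qed
  have "submodule class_ring ?K KA"
  proof (rule submodule.intro)
    show "Module.module class_ring KA" by (rule V.module_axioms)
  qed (use zero in \<open>auto simp: KE.zero_closed KE.add_closed KE.smult_closed
        LinearCombinations.module_hom_add[OF hom(1)] LinearCombinations.module_hom_add[OF hom(2)] LinearCombinations.module_hom_smult[OF hom(1)] LinearCombinations.module_hom_smult[OF hom(2)]\<close>)
  moreover have "word_tensors \<subseteq> ?K"
  proof
    fix z assume z: "z \<in> word_tensors"
    then obtain a xs where az: "z = koszul_tensor E R a (tensor_word E xs)" "a \<in> carrier A" "xs \<in> lists (carrier E)"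
      unfolding word_tensors_def by blast
    have "d z = transported_d z"
    proof (cases xs)
      case Nil
      then show ?thesis using d transported_d_spec az by (simp add: koszul_d_spec_def)
    next
      case (Cons x ys)
      then show ?thesis using d transported_d_spec az by (simp add: koszul_d_spec_def)
    qed
    then show "z \<in> ?K" using z word_tensors_span by blast
  qed
  ultimately have "vspan KA word_tensors \<subseteq> ?K" by (intro V.span_is_subset)
  then show "d z = transported_d z" if "z \<in> carrier KA" for z using that word_tensors_span by blast
qed

lemma koszul_d_eq: "koszul_d E R = transported_d"
  unfolding koszul_d_def
  by (rule the_equality; fold koszul_d_spec_def; (rule transported_d_spec | rule koszul_d_spec_unique, assumption))

lemma koszul_d_pow:
  assumes "z \<in> carrier KA"
  shows "(koszul_d E R ^^ j) z \<in> carrier KA \<and> Psi ((koszul_d E R ^^ j) z) = (model_d ^^ j) (Psi z)"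
  unfolding koszul_d_eq by (induction j) (use assms in \<open>simp_all add: transported_d\<close>)

lemma Psi_koszul_part: "koszul_part E N R n m \<subseteq> carrier KA \<and> Psi ` koszul_part E N R n m = model_part n m"
proof (cases "m \<le> n")
  case True
  let ?G = "{koszul_tensor E R a w |a w. a \<in> algebra_component E R (n - m) \<and> w \<in> koszul_coeff E N R m}"
  have mem: "a \<in> carrier A" "w \<in> carrier T" if "a \<in> algebra_component E R (n - m)" "w \<in> koszul_coeff E N R m" for a w
    using that algebra_component_closed Phi_koszul_coeff by blast+
  then have G: "?G \<subseteq> carrier KA" using koszul_tensor_closed(1) by blast
  have "Psi ` ?G = {tens p q |p q. p \<in> nf ` homog B (n - m) \<and> q \<in> koszul_space B N rels m}"
  proof (intro equalityI subsetI)
    fix y assume "y \<in> Psi ` ?G"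
    then obtain a w where aw: "a \<in> algebra_component E R (n - m)" "w \<in> koszul_coeff E N R m"
      "y = Psi (koszul_tensor E R a w)" by blast
    then have "y = tens (alpha a) (Phi w)" using koszul_tensor_closed(2)[OF mem(1) mem(2)] aw by blast
    moreover have "alpha a \<in> nf ` homog B (n - m)" "Phi w \<in> koszul_space B N rels m"
      using aw alpha_component Phi_koszul_coeff by blast+
    ultimately show "y \<in> {tens p q |p q. p \<in> nf ` homog B (n - m) \<and> q \<in> koszul_space B N rels m}" by blast
  next
    fix y assume "y \<in> {tens p q |p q. p \<in> nf ` homog B (n - m) \<and> q \<in> koszul_space B N rels m}"
    then obtain p q where pq: "p \<in> nf ` homog B (n - m)" "q \<in> koszul_space B N rels m" "y = tens p q" by blast
    obtain a where a: "a \<in> algebra_component E R (n - m)" "p = alpha a"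
      using pq(1) unfolding alpha_component[symmetric] by blast
    obtain w where w: "w \<in> koszul_coeff E N R m" "q = Phi w"
      using pq(2) Phi_koszul_coeff[of m] by blast
    have "y = Psi (koszul_tensor E R a w)"
      unfolding pq(3) a(2) w(2) by (rule koszul_tensor_closed(2)[symmetric]; rule mem[OF a(1) w(1)])
    then show "y \<in> Psi ` ?G" using a w by blast
  qed
  then show ?thesis
    using True KE.image_vspan[OF G] KE.vspan_closed[OF G]
    by (simp add: koszul_part_def model_part_def tens_span_def)
next
  case False
  then show ?thesis by (simp add: koszul_part_def model_part_def KE.zero_closed KE.f_zero)
qed

end

subsection \<open>The Euler characteristic\<close>

text \<open>A projection whose kernel is the image of W realises the quotient as a subspace of the
  function space, and rank-nullity on the image of Z counts its dimension.\<close>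

lemma (in embedding) vdim_subquotient:
  assumes Z: "Z \<subseteq> carrier M" "pm.subspace (f ` Z)" "fdim (f ` Z)"
    and W: "W \<subseteq> Z" "pm.subspace (f ` W)"
  shows "vdim (quot_module (M\<lparr>carrier := Z\<rparr>) W) + pm.dim (f ` W) = pm.dim (f ` Z)"
proof (rule ex_projection[OF W(2)])
  fix \<pi> :: "('x \<Rightarrow>\<^sub>0 'k) \<Rightarrow> ('x \<Rightarrow>\<^sub>0 'k)"
  assume \<pi>: "plinear \<pi>" "\<And>y. \<pi> y = 0 \<longleftrightarrow> y \<in> f ` W"
  interpret Z: embedding "M\<lparr>carrier := Z\<rparr>" f by (rule restrict_carrier[OF Z(1,2)])
  interpret Q: quotient_map "M\<lparr>carrier := Z\<rparr>" f W "\<lambda>x. \<pi> (f x)"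
  proof
    show "W \<subseteq> carrier (M\<lparr>carrier := Z\<rparr>)" using W by simp
    show "\<pi> (f x) = 0 \<longleftrightarrow> x \<in> W" if "x \<in> carrier (M\<lparr>carrier := Z\<rparr>)" for x
      using inj_on_image_mem_iff[OF Z.inj that, of W] W(1) \<pi>(2) by simp
  qed (simp_all only: Z.f_add Z.f_smult pmp.linear_add[OF \<pi>(1)] pmp.linear_scale[OF \<pi>(1)])
  interpret H: embedding "quot_module (M\<lparr>carrier := Z\<rparr>) W" "induced (\<lambda>x. \<pi> (f x))"
    by (rule Q.embedding_quot)
  have img: "induced (\<lambda>x. \<pi> (f x)) ` carrier (quot_module (M\<lparr>carrier := Z\<rparr>) W) = \<pi> ` f ` Z"
    using Q.image_quot by (simp add: image_image)
  have "vdim (quot_module (M\<lparr>carrier := Z\<rparr>) W) = pm.dim (\<pi> ` f ` Z)"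
    using H.vdim_eq fdim_image[OF \<pi>(1) Z(3)] by (simp add: img)
  moreover have "{y \<in> f ` Z. \<pi> y = 0} = f ` W" using W(1) \<pi>(2) by blast
  ultimately show ?thesis using rank_nullity[OF \<pi>(1) Z(2,3)] by simp
qed

text \<open>With cycles z and boundaries b, the homology has dimension dim z_k - dim b_k, while
  rank-nullity gives dim c_(k+1) = dim b_k + dim z_(k+1). In the alternating sum the boundaries
  cancel in pairs.\<close>

lemma (in embedding) euler_char_eq_sum_dim:
  fixes C :: "nat \<Rightarrow> 'v set" and D :: "nat \<Rightarrow> 'v \<Rightarrow> 'v" and c \<delta>
  assumes C: "\<And>k. C k \<subseteq> carrier M" "\<And>k. f ` C k = c k"
    and c: "\<And>k. pm.subspace (c k)" "\<And>k. fdim (c k)"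
    and D: "\<And>k x. x \<in> C k \<Longrightarrow> D k x \<in> carrier M" "\<And>k x. x \<in> C k \<Longrightarrow> f (D k x) = \<delta> k (f x)"
    and \<delta>: "\<And>k. plinear (\<delta> k)"
    and \<delta>_into: "\<And>k y. y \<in> c (Suc k) \<Longrightarrow> \<delta> (Suc k) y \<in> c k"
    and \<delta>\<delta>: "\<And>k y. y \<in> c (Suc (Suc k)) \<Longrightarrow> \<delta> (Suc k) (\<delta> (Suc (Suc k)) y) = 0"
    and zero: "\<And>k. n < k \<Longrightarrow> c k = {0}"
  shows "euler_char M C D = (\<Sum>k\<le>n. (-1) ^ k * int (pm.dim (c k)))"
proof -
  define Z where "Z k = {x \<in> C k. k = 0 \<or> D k x = \<zero>\<^bsub>M\<^esub>}" for k
  define W where "W k = D (Suc k) ` C (Suc k)" for k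
  define z where "z k = {y \<in> c k. k = 0 \<or> \<delta> k y = 0}" for k
  define b where "b k = \<delta> (Suc k) ` c (Suc k)" for k
  have DZ: "D k x = \<zero>\<^bsub>M\<^esub> \<longleftrightarrow> \<delta> k (f x) = 0" if "x \<in> C k" for k x
    using eqI[OF D(1)[OF that] zero_closed] D(2)[OF that] f_zero by auto
  have fZ: "f ` Z k = z k" for k
    unfolding Z_def z_def C(2)[of k, symmetric] using DZ by auto
  have fW: "f ` W k = b k" for k
    unfolding W_def b_def C(2)[of "Suc k", symmetric] image_image by (intro image_cong refl D(2))
  have bz: "b k \<subseteq> z k" for k
    unfolding b_def z_def using \<delta>_into \<delta>\<delta> by (cases k) auto
  have ZM: "Z k \<subseteq> carrier M" for k using C(1) unfolding Z_def by blast
  have WZ: "W k \<subseteq> Z k" for k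
  proof
    fix x assume x: "x \<in> W k"
    then have xM: "x \<in> carrier M" unfolding W_def using D(1) by blast
    have "f x \<in> f ` Z k" using x fW bz fZ by blast
    then show "x \<in> Z k" using inj_on_image_mem_iff[OF inj xM ZM] by blast
  qed
  have sub_z: "pm.subspace (z k)" for k
  proof (cases k)
    case 0
    then show ?thesis using c(1) by (simp add: z_def)
  next
    case (Suc m)
    then show ?thesis
      using pm.subspace_inter[OF c(1)[of k] pmp.linear_subspace_kernel[OF \<delta>[of k]]]
      by (simp add: z_def Int_def)
  qed
  have sub_b: "pm.subspace (b k)" for k
    unfolding b_def by (rule pmp.linear_subspace_image[OF \<delta> c(1)])
  have fd_z: "fdim (z k)" for k by (rule fdim_subset[OF c(2)[of k]]) (auto simp: z_def)
  define h where "h k = vdim (homology M C D k)" for k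
  have h: "int (h k) = int (pm.dim (z k)) - int (pm.dim (b k))" for k
  proof -
    have "h k + pm.dim (f ` W k) = pm.dim (f ` Z k)"
      unfolding h_def homology_def Z_def[symmetric] W_def[symmetric]
      using ZM sub_z sub_b fd_z WZ by (intro vdim_subquotient) (simp_all add: fZ fW)
    then show ?thesis by (simp add: fZ fW)
  qed
  have c0: "pm.dim (c 0) = pm.dim (z 0)" by (simp add: z_def)
  have cS: "int (pm.dim (c (Suc k))) = int (pm.dim (b k)) + int (pm.dim (z (Suc k)))" for k
    using rank_nullity[OF \<delta> c, of "Suc k" "Suc k"] by (simp add: b_def z_def)
  \<comment> \<open>The uncancelled term at m is the boundary space b m. It vanishes for m = n
    because the complex is zero from n + 1 on.\<close>
  have telescope: "(\<Sum>k\<le>m. (-1) ^ k * int (h k)) = (\<Sum>k\<le>m. (-1) ^ k * int (pm.dim (c k))) - (-1) ^ m * int (pm.dim (b m))" for m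
  proof (induction m)
    case 0
    show ?case by (simp add: h c0)
  next
    case (Suc m)
    then show ?case by (simp add: h cS algebra_simps)
  qed
  have "b n = {0}"
    unfolding b_def using zero[of "Suc n"] pmp.linear_0[OF \<delta>] by simp
  then have "(\<Sum>k\<le>n. (-1) ^ k * int (h k)) = (\<Sum>k\<le>n. (-1) ^ k * int (pm.dim (c k)))"
    using telescope[of n] by (simp add: dim_zero)
  moreover have "h k = 0" if "n < k" for k
  proof -
    have "z k = {0}" using zero[OF that] pm.subspace_0[OF sub_z[of k]] by (auto simp: z_def)
    then show ?thesis using h[of k] by (simp add: dim_zero)
  qed
  then have "{k. h k \<noteq> 0} \<subseteq> {..n}" by (auto simp: not_less[symmetric])
  then have "(\<Sum>k | h k \<noteq> 0. (-1) ^ k * int (h k)) = (\<Sum>k\<le>n. (-1) ^ k * int (h k))"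
    by (intro sum.mono_neutral_left) auto
  ultimately show ?thesis by (simp add: euler_char_def h_def)
qed

text \<open>Two steps in homological degree raise the internal degree by N, which is at least 2.
  Hence the part of total degree n has no terms beyond k = n.\<close>

lemma koszul_degree_ge: "2 \<le> N \<Longrightarrow> k \<le> koszul_degree N k"
proof -
  assume N: "2 \<le> N"
  have "k = (k div 2) * 2 + k mod 2" by simp
  also have "\<dots> \<le> (k div 2) * N + k mod 2" using mult_le_mono2[OF N, of "k div 2"] by linarith
  also have "\<dots> = koszul_degree N k" by (auto simp: koszul_degree_def odd_iff_mod_2_eq_one)
  finally show ?thesis .
qed

lemma koszul_degree_even: "koszul_degree N (2 * i) = i * N"
  and koszul_degree_odd: "koszul_degree N (Suc (2 * i)) = i * N + 1"
  by (simp_all add: koszul_degree_def)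

context homogeneous_relations
begin

definition model_boundary :: "nat \<Rightarrow> ('i list \<times> 'i list \<Rightarrow>\<^sub>0 'k) \<Rightarrow> ('i list \<times> 'i list \<Rightarrow>\<^sub>0 'k)" where
  "model_boundary k = (if odd k then model_d else model_d ^^ (N - 1))"

lemma euler_char_koszul:
  assumes N: "2 \<le> N"
  shows "euler_char KA (koszul_chain E N R n) (koszul_boundary E N R) =
    (\<Sum>k\<le>n. (-1) ^ k * int (pm.dim (model_part n (koszul_degree N k))))"
proof (rule KE.euler_char_eq_sum_dim[where \<delta> = model_boundary])
  show "koszul_chain E N R n k \<subseteq> carrier KA"
    "Psi ` koszul_chain E N R n k = model_part n (koszul_degree N k)" for k
    using Psi_koszul_part unfolding koszul_chain_def by blast+
  show "pm.subspace (model_part n (koszul_degree N k))" "fdim (model_part n (koszul_degree N k))" for k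
    using subspace_model_part dim_model_part by blast+
  show "koszul_boundary E N R k x \<in> carrier KA" "Psi (koszul_boundary E N R k x) = model_boundary k (Psi x)"
    if "x \<in> koszul_chain E N R n k" for k x
  proof -
    have "x \<in> carrier KA" using that Psi_koszul_part unfolding koszul_chain_def by blast
    then show "koszul_boundary E N R k x \<in> carrier KA" "Psi (koszul_boundary E N R k x) = model_boundary k (Psi x)"
      using koszul_d_pow[of x 1] koszul_d_pow[of x "N - 1"]
      by (simp_all add: koszul_boundary_def model_boundary_def)
  qed
  show "plinear (model_boundary k)" for k
    unfolding model_boundary_def using plinear_model_d plinear_model_d_pow by simp
  show "model_boundary (Suc k) y \<in> model_part n (koszul_degree N k)" if y: "y \<in> model_part n (koszul_degree N (Suc k))" for k y
  proof (cases "even k")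
    case True
    then obtain i where "k = 2 * i" by blast
    then show ?thesis using y model_d_model_part by (simp add: model_boundary_def koszul_degree_even koszul_degree_odd)
  next
    case False
    then obtain i where k: "k = Suc (2 * i)" by (metis oddE Suc_eq_plus1)
    \<comment> \<open>From i N + 1 up to (i + 1) N there are N - 1 steps, matching the power of d
      used in even homological degree.\<close>
    then have "koszul_degree N (Suc k) = koszul_degree N k + (N - 1)"
      using N koszul_degree_even[of N "Suc i"] by (simp add: koszul_degree_odd)
    then show ?thesis using y model_d_pow_model_part False by (simp add: model_boundary_def)
  qed
  show "model_boundary (Suc k) (model_boundary (Suc (Suc k)) y) = 0" if y: "y \<in> model_part n (koszul_degree N (Suc (Suc k)))" for k y
  proof -
    \<comment> \<open>Of two consecutive boundaries one is d and the other its power N - 1, so in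
      either order the composite is the N-th power.\<close>
    have "model_boundary (Suc k) (model_boundary (Suc (Suc k)) y) = (model_d ^^ Suc (N - 1)) y"
      by (simp add: model_boundary_def funpow_swap1)
    also have "Suc (N - 1) = N" using N by simp
    also have "(model_d ^^ N) y = 0"
    proof (rule model_d_pow_N_zero[OF y])
      show "N \<le> koszul_degree N (Suc (Suc k))" by (simp add: koszul_degree_def)
    qed
    finally show ?thesis .
  qed
  show "model_part n (koszul_degree N k) = {0}" if "n < k" for k
    using koszul_degree_ge[OF N, of k] that by (simp add: model_part_def)
qed

end

subsection \<open>Generating functions\<close>

text \<open>Indexing by the homological degree k merges the two families of terms into one with sign
  (-1)^k. The coefficient at j of the partial sums is constant from j + 1 on, since the internal
  degree is at least k; this is convergence in the X-adic topology.\<close>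

lemma suminf_koszul_series:
  fixes w :: "nat \<Rightarrow> int"
  assumes N: "2 \<le> N"
  shows "suminf (\<lambda>n. fps_const (w (n * N)) * fps_X ^ (n * N) - fps_const (w (n * N + 1)) * fps_X ^ (n * N + 1))
    = Abs_fps (\<lambda>j. \<Sum>k\<le>j. if koszul_degree N k = j then (-1) ^ k * w j else 0)" (is "suminf ?t = ?Q")
proof -
  have partial: "fps_nth (sum ?t {..<M}) j = (\<Sum>k<2 * M. if koszul_degree N k = j then (-1) ^ k * w j else 0)" for M j
  proof (induction M)
    case (Suc M)
    have "fps_nth (?t M) j = (if M * N = j then w j else 0) - (if M * N + 1 = j then w j else 0)"
      by (simp only: fps_sub_nth fps_mult_left_const_nth fps_X_power_nth) auto
    then show ?case using Suc by (simp add: koszul_degree_even koszul_degree_odd)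
  qed simp
  have "?t sums ?Q"
    unfolding sums_def
  proof (rule tendsto_fpsI)
    fix j
    show "eventually (\<lambda>M. fps_nth (sum ?t {..<M}) j = fps_nth ?Q j) sequentially"
    proof (rule eventually_sequentiallyI)
      fix M assume "Suc j \<le> M"
      then have "{..j} \<subseteq> {..<2 * M}" by auto
      moreover have "koszul_degree N k \<noteq> j" if "k \<notin> {..j}" for k
        using koszul_degree_ge[OF N, of k] that by auto
      ultimately show "fps_nth (sum ?t {..<M}) j = fps_nth ?Q j"
        unfolding partial fps_nth_Abs_fps by (intro sum.mono_neutral_right) auto
    qed
  qed
  then show ?thesis by (rule sums_unique[symmetric])
qed

lemma koszul_series_mult_nth:
  fixes p w :: "nat \<Rightarrow> int"
  assumes N: "2 \<le> N"
  shows "fps_nth (Abs_fps p * Abs_fps (\<lambda>j. \<Sum>k\<le>j. if koszul_degree N k = j then (-1) ^ k * w j else 0)) n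
    = (\<Sum>k\<le>n. (-1) ^ k * (if koszul_degree N k \<le> n then p (n - koszul_degree N k) * w (koszul_degree N k) else 0))"
proof -
  \<comment> \<open>Extending the inner range from j to n adds zero terms only and makes it
    independent of j, so that the two sums can be exchanged.\<close>
  have ext: "(\<Sum>k\<le>j. if koszul_degree N k = j then (-1) ^ k * w j else 0) =
    (\<Sum>k\<le>n. if koszul_degree N k = j then (-1) ^ k * w j else 0)" if "j \<le> n" for j
    using that koszul_degree_ge[OF N] by (intro sum.mono_neutral_left) auto
  have "fps_nth (Abs_fps p * Abs_fps (\<lambda>j. \<Sum>k\<le>j. if koszul_degree N k = j then (-1) ^ k * w j else 0)) n
    = (\<Sum>j\<le>n. p (n - j) * (\<Sum>k\<le>n. if koszul_degree N k = j then (-1) ^ k * w j else 0))"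
    by (subst mult.commute, subst fps_mult_nth) (simp add: atLeast0AtMost ext mult.commute)
  also have "\<dots> = (\<Sum>k\<le>n. \<Sum>j\<le>n. if j = koszul_degree N k then (-1) ^ k * (p (n - j) * w j) else 0)"
    unfolding sum_distrib_left by (subst sum.swap) (intro sum.cong refl, auto)
  also have "\<dots> = (\<Sum>k\<le>n. (-1) ^ k * (if koszul_degree N k \<le> n then p (n - koszul_degree N k) * w (koszul_degree N k) else 0))"
    by (intro sum.cong refl) simp
  finally show ?thesis .
qed

lemma (in homogeneous_relations) poincare_dual_euler:
  assumes N: "2 \<le> N"
  shows "poincare_series E R * dual_series E N R = euler_series E N R"
proof (rule fps_ext)
  fix n
  have "fps_nth (poincare_series E R * dual_series E N R) n = (\<Sum>k\<le>n. (-1) ^ k *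
    (if koszul_degree N k \<le> n then int (dim_component E R (n - koszul_degree N k)) * int (dim_dual_component E N R (koszul_degree N k)) else 0))"
    unfolding poincare_series_def dual_series_def
      suminf_koszul_series[OF N, of "\<lambda>m. int (dim_dual_component E N R m)"]
    by (rule koszul_series_mult_nth[OF N])
  also have "\<dots> = fps_nth (euler_series E N R) n"
    unfolding euler_series_def fps_nth_Abs_fps euler_char_koszul[OF N]
    using dim_model_part by (intro sum.cong refl) simp
  finally show "fps_nth (poincare_series E R * dual_series E N R) n = fps_nth (euler_series E N R) n" .
qed

text \<open>The vectors of a finite basis index themselves, whence \<open>id\<close> as the basis
  map. Coordinates are the unique coefficients of the basis expansion.\<close>

lemma ex_coordinates:
  assumes "vectorspace class_ring (E :: ('k::field, 'e, 'm) module_scheme)"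
    and "vectorspace.fin_dim class_ring E"
  shows "\<exists>(B :: 'e set) crd. coordinates E B crd id"
proof -
  interpret V: vectorspace class_ring E by fact
  obtain B where B: "finite B" "V.basis B" using V.finite_basis_exists[OF assms(2)] by blast
  have BE: "B \<subseteq> carrier E" using B(2) by (simp add: V.basis_def)
  have ex1: "\<exists>!a. a \<in> B \<rightarrow>\<^sub>E UNIV \<and> V.lincomb a B = x" if "x \<in> carrier E" for x
    using V.basis_criterion[OF B(1) BE] B(2) that by simp
  define crd where "crd x = (THE a. a \<in> B \<rightarrow>\<^sub>E (UNIV :: 'k set) \<and> V.lincomb a B = x)" for x
  have crd: "crd x \<in> B \<rightarrow>\<^sub>E UNIV \<and> V.lincomb (crd x) B = x" if "x \<in> carrier E" for x
    unfolding crd_def by (rule theI'[OF ex1[OF that]])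
  have crd_eq: "crd x b = a b" if "x \<in> carrier E" "V.lincomb a B = x" "b \<in> B" for x a b
  proof -
    \<comment> \<open>Uniqueness holds among coefficient functions that are extensional on B; an
      arbitrary a is restricted to B to be compared with them.\<close>
    have "V.lincomb (restrict a B) B = V.lincomb a B"
      using BE by (intro V.lincomb_cong) auto
    then have "crd x = restrict a B"
      using ex1[OF that(1)] crd[OF that(1)] that(2) by (metis restrict_PiE_iff UNIV_I)
    then show ?thesis using that(3) by simp
  qed
  have "coordinates E B crd id"
  proof (rule coordinates.intro)
    show "vectorspace class_ring E" "finite B" by fact+
    show "id b \<in> carrier E" if "b \<in> B" for b using that BE by auto
    show "crd (x \<oplus>\<^bsub>E\<^esub> y) b = crd x b + crd y b" if "x \<in> carrier E" "y \<in> carrier E" "b \<in> B" for x y b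
    proof (rule crd_eq[OF _ _ that(3)])
      show "V.lincomb (\<lambda>b. crd x b + crd y b) B = x \<oplus>\<^bsub>E\<^esub> y"
        using V.lincomb_sum[OF B(1) BE, of "crd x" "crd y"] crd[OF that(1)] crd[OF that(2)] by simp
    qed (use that in simp)
    show "crd (c \<odot>\<^bsub>E\<^esub> x) b = c * crd x b" if "x \<in> carrier E" "b \<in> B" for c x b
    proof (rule crd_eq[OF _ _ that(2)])
      show "V.lincomb (\<lambda>b. c * crd x b) B = c \<odot>\<^bsub>E\<^esub> x"
        using V.lincomb_smult[OF BE, of "crd x" c] crd[OF that(1)] by simp
    qed (use that V.smult_closed in simp)
    show "crd (id b) b' = (if b = b' then 1 else 0)" if "b \<in> B" "b' \<in> B" for b b'
    proof (rule crd_eq[OF _ _ that(2)])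
      have "V.lincomb (\<lambda>b'. if b = b' then 1 else 0) B = finsum E (\<lambda>b'. if b = b' then id b' else \<zero>\<^bsub>E\<^esub>) B"
        unfolding V.lincomb_def
      proof (rule V.finsum_cong')
        show "(\<lambda>b'. if b = b' then id b' else \<zero>\<^bsub>E\<^esub>) \<in> B \<rightarrow> carrier E" using BE by auto
        fix b' assume b': "b' \<in> B"
        then have "b' \<in> carrier E" using BE by blast
        then show "(if b = b' then 1 else 0) \<odot>\<^bsub>E\<^esub> b' = (if b = b' then id b' else \<zero>\<^bsub>E\<^esub>)"
          using V.smult_one V.smult_l_null by simp
      qed simp
      also have "\<dots> = id b"
        by (rule V.add.finprod_singleton[OF that(1) B(1)]) (use BE in auto)
      finally show "V.lincomb (\<lambda>b'. if b = b' then 1 else 0) B = id b" .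
    qed (use that BE in auto)
    show "x = y" if "x \<in> carrier E" "y \<in> carrier E" "\<And>b. b \<in> B \<Longrightarrow> crd x b = crd y b" for x y
    proof -
      have "crd x = crd y"
        using crd[OF that(1)] crd[OF that(2)] that(3) by (intro PiE_ext[of "crd x" B "\<lambda>_. UNIV"]) auto
      then show ?thesis using crd[OF that(1)] crd[OF that(2)] by metis
    qed
  qed
  then show ?thesis by blast
qed

theorem proposition1:
  fixes E :: "('k::field, 'e) module"
    and R :: "('e list \<Rightarrow>\<^sub>0 'k) set set"
    and N :: nat
  assumes "N \<ge> 2"
    and "vectorspace class_ring E"
    and "vectorspace.fin_dim class_ring E"
    and "VectorSpace.subspace class_ring R (tensor_algebra E)"
    and "R \<subseteq> tensor_power E N"
  shows "poincare_series E R * dual_series E N R = euler_series E N R"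
proof -
  obtain B crd where c: "coordinates E (B :: 'e set) crd id"
    using ex_coordinates[OF assms(2,3)] by blast
  interpret homogeneous_relations E B crd id N R
    by (rule homogeneous_relations.intro[OF c homogeneous_relations_axioms.intro[OF assms(4,5)]])
  show ?thesis by (rule poincare_dual_euler[OF assms(1)])
qed

end
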